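(* Let $s\in(0,1)$, $m>0$, $2^*_s=6/(3-2s)$. Let $A:\mathbb{R}^3\to\mathbb{R}^3$ be a (continuous) vector field with locally bounded gradient and satisfying $$g(x-y)\cdot A\left(g\,\frac{x+y}{2}\right)=(x-y)\cdot A\left(\frac{x+y}{2}\right)\quad\text{for all }x,y\in\mathbb{R}^3,\ g\in O(3).$$ For any $p\in(2,2^*_s)$ there exists a nontrivial weak solution $u\in H^s_{A,\mathrm{rad}}(\mathbb{R}^3,\mathbb{C})$ to $$(-\Delta+m^2)^s_A u=|u|^{p-2}u\quad\text{in }\mathbb{R}^3.$$
   Context: $C_s:=\dfrac{s\,2^{\frac{2s-1}{2}}}{\pi^{3/2}\,\Gamma(1-s)}$, where $\Gamma$ is the Gamma function. $\mathcal{K}_\nu$ is the modified Bessel function (also called MacDonald function) of order $\nu$: $\mathcal{K}_\nu(\zeta)=\frac12\left(\frac{\zeta}{2}\right)^\nu\int_0^{+\infty}e^{-\frac{\zeta^2}{4t}-t}t^{-1-\nu}\,dt$ for $\zeta>0$. For measurable $u,v:\mathbb{R}^3\to\mathbb{C}$ put $$\langle u,v\rangle_{A,s}:=\Re\int_{\mathbb{R}^3\times\mathbb{R}^3}\frac{\left(e^{-i(x-y)\cdot A\left(\frac{x+y}{2}\right)}u(x)-u(y)\right)\overline{\left(e^{-i(x-y)\cdot A\left(\frac{x+y}{2}\right)}v(x)-v(y)\right)}}{|x-y|^{\frac{3+2s}{2}}}\,\mathcal{K}_{\frac{3+2s}{2}}(m|x-y|)\,dx\,dy,$$ $(u,v)_{A,s}:=\frac{C_s}{2}m^{\frac{3+2s}{2}}\langle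 u,v\rangle_{A,s}+m^{2s}\Re\int_{\mathbb{R}^3}u\overline{v}\,dx$ and $\|u\|_{A,s}:=\sqrt{(u,u)_{A,s}}$. $H^s_A(\mathbb{R}^3,\mathbb{C})$ is the closure of $C^\infty_c(\mathbb{R}^3,\mathbb{C})$ in $\mathcal{H}:=\{u:\mathbb{R}^3\to\mathbb{C}: (u,u)_{A,s}<+\infty\}$ with respect to $\|\cdot\|_{A,s}$, and $H^s_{A,\mathrm{rad}}(\mathbb{R}^3,\mathbb{C}):=\{u\in H^s_A(\mathbb{R}^3,\mathbb{C}):u\text{ radially symmetric}\}$. $u\in H^s_A(\mathbb{R}^3,\mathbb{C})$ is a weak solution of $(-\Delta+m^2)^s_Au=|u|^{p-2}u$ in $\mathbb{R}^3$ if $(u,v)_{A,s}=\Re\int_{\mathbb{R}^3}|u|^{p-2}u\,\overline{v}\,dx$ for every $v\in H^s_A(\mathbb{R}^3,\mathbb{C})$. "Locally bounded gradient" means that $\nabla A$ exists and is bounded on every compact set. *)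

theory Defs
  imports "HOL-Analysis.Analysis"
begin

type_synonym R3 = "real ^ 3"

text \<open>Elements of the function spaces below are represented by functions (not by classes modulo
  null sets); measurability and integrals refer to Lebesgue measure.\<close>

definition MacDonald_K :: "real \<Rightarrow> real \<Rightarrow> real" where
  "MacDonald_K \<nu> \<zeta> =
     1 / 2 * (\<zeta> / 2) powr \<nu> * (LBINT t:{0<..}. exp (- (\<zeta>\<^sup>2 / (4 * t)) - t) * t powr (- 1 - \<nu>))"

definition C_const :: "real \<Rightarrow> real" where
  "C_const s = s * 2 powr ((2 * s - 1) / 2) / (pi powr (3 / 2) * Gamma (1 - s))"

definition magnetic_diff :: "(R3 \<Rightarrow> R3) \<Rightarrow> (R3 \<Rightarrow> complex) \<Rightarrow> R3 \<Rightarrow> R3 \<Rightarrow> complex" where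
  "magnetic_diff A u x y = exp (- (\<i> * of_real ((x - y) \<bullet> A (midpoint x y)))) * u x - u y"

definition form_integrand ::
    "(R3 \<Rightarrow> R3) \<Rightarrow> real \<Rightarrow> real \<Rightarrow> (R3 \<Rightarrow> complex) \<Rightarrow> (R3 \<Rightarrow> complex) \<Rightarrow> R3 \<times> R3 \<Rightarrow> complex" where
  "form_integrand A s m u v = (\<lambda>(x, y).
     magnetic_diff A u x y * cnj (magnetic_diff A v x y)
       / of_real (norm (x - y) powr ((3 + 2 * s) / 2))
       * of_real (MacDonald_K ((3 + 2 * s) / 2) (m * norm (x - y))))"

definition form_nonlocal ::
    "(R3 \<Rightarrow> R3) \<Rightarrow> real \<Rightarrow> real \<Rightarrow> (R3 \<Rightarrow> complex) \<Rightarrow> (R3 \<Rightarrow> complex) \<Rightarrow> real" where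
  "form_nonlocal A s m u v = Re (\<integral>z. form_integrand A s m u v z \<partial>lebesgue)"

definition inner_As ::
    "(R3 \<Rightarrow> R3) \<Rightarrow> real \<Rightarrow> real \<Rightarrow> (R3 \<Rightarrow> complex) \<Rightarrow> (R3 \<Rightarrow> complex) \<Rightarrow> real" where
  "inner_As A s m u v =
     C_const s / 2 * m powr ((3 + 2 * s) / 2) * form_nonlocal A s m u v
       + m powr (2 * s) * Re (\<integral>x. u x * cnj (v x) \<partial>lebesgue)"

definition norm_As :: "(R3 \<Rightarrow> R3) \<Rightarrow> real \<Rightarrow> real \<Rightarrow> (R3 \<Rightarrow> complex) \<Rightarrow> real" where
  "norm_As A s m u = sqrt (inner_As A s m u u)"

text \<open>Both integrands of \<open>(u, u)\<close> are nonnegative, so finiteness of \<open>(u, u)\<close> means that both are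
  integrable. It cannot be expressed through \<^const>\<open>inner_As\<close> itself, because the Bochner integral
  of a non-integrable function is 0.\<close>

definition finite_form_space :: "(R3 \<Rightarrow> R3) \<Rightarrow> real \<Rightarrow> real \<Rightarrow> (R3 \<Rightarrow> complex) set" where
  "finite_form_space A s m =
     {u. u \<in> borel_measurable lebesgue
       \<and> integrable lebesgue (form_integrand A s m u u)
       \<and> integrable lebesgue (\<lambda>x. u x * cnj (u x))}"

primrec C_k :: "nat \<Rightarrow> (R3 \<Rightarrow> complex) \<Rightarrow> bool" where
  "C_k 0 f \<longleftrightarrow> continuous_on UNIV f"
| "C_k (Suc k) f \<longleftrightarrow>
     f differentiable_on UNIV \<and> (\<forall>v. C_k k (\<lambda>x. frechet_derivative f (at x) v))"

definition test_functions :: "(R3 \<Rightarrow> complex) set" where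
  "test_functions = {\<phi>. (\<forall>k. C_k k \<phi>) \<and> compact (closure {x. \<phi> x \<noteq> 0})}"

text \<open>The intersection with \<^const>\<open>finite_form_space\<close> only ensures that the norm is never taken of a
  function with infinite form; for locally bounded \<open>A\<close> and \<open>0 < s < 1\<close> every test function lies in
  that space.\<close>

definition H_As :: "(R3 \<Rightarrow> R3) \<Rightarrow> real \<Rightarrow> real \<Rightarrow> (R3 \<Rightarrow> complex) set" where
  "H_As A s m = {u \<in> finite_form_space A s m.
     \<forall>\<epsilon>>0. \<exists>\<phi> \<in> test_functions \<inter> finite_form_space A s m. norm_As A s m (\<lambda>x. u x - \<phi> x) < \<epsilon>}"

definition radially_symmetric :: "(R3 \<Rightarrow> complex) \<Rightarrow> bool" where
  "radially_symmetric u \<longleftrightarrow> (\<forall>x y. norm x = norm y \<longrightarrow> u x = u y)"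

definition H_As_rad :: "(R3 \<Rightarrow> R3) \<Rightarrow> real \<Rightarrow> real \<Rightarrow> (R3 \<Rightarrow> complex) set" where
  "H_As_rad A s m = {u \<in> H_As A s m. radially_symmetric u}"

text \<open>The integrability clause says that the right-hand side is meaningful and not the default
  value 0. On the left-hand side integrability follows from the Cauchy--Schwarz inequality.\<close>

definition weak_solution ::
    "(R3 \<Rightarrow> R3) \<Rightarrow> real \<Rightarrow> real \<Rightarrow> real \<Rightarrow> (R3 \<Rightarrow> complex) \<Rightarrow> bool" where
  "weak_solution A s m p u \<longleftrightarrow> u \<in> H_As A s m \<and>
     (\<forall>v \<in> H_As A s m.
        integrable lebesgue (\<lambda>x. of_real (norm (u x) powr (p - 2)) * u x * cnj (v x)) \<and>
        inner_As A s m u v =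
          Re (\<integral>x. of_real (norm (u x) powr (p - 2)) * u x * cnj (v x) \<partial>lebesgue))"

definition locally_bounded_gradient :: "(R3 \<Rightarrow> R3) \<Rightarrow> bool" where
  "locally_bounded_gradient A \<longleftrightarrow>
     A differentiable_on UNIV \<and> (\<forall>K. compact K \<longrightarrow> bounded ((\<lambda>x. jacobian A (at x)) ` K))"

end

theory Submission
  imports Defs "HOL-Probability.Distributions" "HOL-Complex_Analysis.Great_Picard"
begin

text \<open>
A rescaled maximizer of \<open>Q u = \<integral>|u|\<^sup>p\<close> over the unit ball of the radial space solves the equation.
Let \<open>u\<close> be a maximizer. Since \<open>Q\<close> is homogeneous of degree \<open>p\<close>, every radial \<open>v\<close> satisfies
\<open>Q v \<le> Q u * \<parallel>v\<parallel>\<^sup>p\<close>, with equality at \<open>u\<close>. Comparing first derivatives at \<open>u\<close> gives the weak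
equation for radial test functions, up to a factor that a rescaling of \<open>u\<close> removes. Three
things remain: a maximizer exists, all test functions are admitted, and the radial space is not trivial.

\<^item> Existence. Let \<open>u\<^sub>n\<close> be a maximizing sequence such that \<open>Q\<close> is nearly maximal also at the
midpoints of \<open>u\<^sub>i\<close> and \<open>u\<^sub>j\<close>. Then the midpoints have norm close to 1, and the parallelogram law
makes the sequence Cauchy (lemma \<open>extremal_exists\<close>). The control of the midpoints amounts to
relative compactness in \<open>L\<^sup>p\<close> of bounded radial sequences (\<open>radial_compactness\<close>), which has three sources.
Large values contribute little to \<open>Q\<close>, uniformly on the unit ball, because \<open>p\<close> is subcritical
(\<open>uniform_tail\<close>). Far away points contribute little, because a rotation invariant set of finite
measure is thin far from the origin (\<open>radial_tail\<close>). On a fixed ball there is strong convergence in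
\<open>L\<^sup>2\<close> along a subsequence, because the energy bounds the distance to the averages over small cells
(\<open>local_compactness\<close>).

The first two rest on one observation (\<open>sparse_level_set_bound\<close>). If \<open>|u x| > 2 * \<mu>\<close> but
\<open>|u y| \<le> \<mu>\<close> for half of the points \<open>y\<close> of a small ball around \<open>x\<close>, then by the diamagnetic inequality
the difference \<open>D u x y\<close> is at least \<open>|u x| / 2\<close> for these \<open>y\<close>, so the nonlocal
energy near the diagonal bounds the integral of \<open>|u|\<^sup>2\<close> over such points \<open>x\<close>. If the radius is chosen
so that the ball has twice the volume of the level set, the result is a recursion for the
measures of dyadic level sets whose fixed point is decay with the critical exponent
\<open>6 / (3 - 2 * s)\<close>.

\<^item> Symmetric criticality. The functional \<open>v \<mapsto> Re \<integral>|u|\<^sup>p\<^sup>-\<^sup>2 u cnj v\<close> has a Riesz representative \<open>w\<close> in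
the full space. By the hypothesis on \<open>A\<close> the form is invariant under \<open>O(3)\<close>, so \<open>w\<close> is invariant almost
everywhere under each rotation, and therefore equal almost everywhere to a radial function
(\<open>radial_representative\<close>). The radial equation identifies that function as a multiple of \<open>u\<close>.

\<^item> Nontriviality. The standard bump function has finite energy, since the second
moment of the kernel is finite (\<open>bessel_kernel_second_moment\<close>).
\<close>

section \<open>The kernel of the form\<close>

definition bessel_kernel :: "real \<Rightarrow> real \<Rightarrow> R3 \<Rightarrow> real" where
  "bessel_kernel s m z = MacDonald_K ((3 + 2 * s) / 2) (m * norm z) / norm z powr ((3 + 2 * s) / 2)"

lemma MacDonald_K_nonneg: "0 \<le> MacDonald_K \<nu> \<zeta>"
  unfolding MacDonald_K_def set_lebesgue_integral_def
  by (intro mult_nonneg_nonneg integral_nonneg_AE) (auto intro!: AE_I2)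

lemma MacDonald_K_measurable [measurable]: "MacDonald_K \<nu> \<in> borel_measurable borel"
  unfolding MacDonald_K_def[abs_def] set_lebesgue_integral_def by measurable

lemma bessel_kernel_nonneg: "0 \<le> bessel_kernel s m z"
  unfolding bessel_kernel_def by (simp add: MacDonald_K_nonneg)

lemma bessel_kernel_measurable [measurable]: "bessel_kernel s m \<in> borel_measurable borel"
  unfolding bessel_kernel_def[abs_def] by measurable

text \<open>The inequality \<open>x / a \<le> exp (x / a)\<close>, raised to the power \<open>a\<close>.\<close>

lemma powr_mult_exp_minus_le:
  fixes a x :: real
  assumes "0 < a" "0 < x"
  shows "x powr a * exp (- x) \<le> a powr a"
proof -
  have "x / a \<le> exp (x / a)"
    using exp_ge_add_one_self[of "x / a"] by linarith
  then have "x \<le> a * exp (x / a)"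
    using assms by (simp add: field_simps)
  then have "x powr a \<le> (a * exp (x / a)) powr a"
    using assms by (intro powr_mono2) auto
  also have "\<dots> = a powr a * exp x"
    using assms by (simp add: powr_mult exp_powr_real)
  finally show ?thesis
    by (simp add: exp_minus field_simps)
qed

text \<open>The factor \<open>exp (- b / t)\<close> absorbs the power of \<open>t\<close> near 0, which leaves \<open>exp (- t)\<close> as a majorant.\<close>

lemma heat_weight_integrable:
  fixes b \<nu> :: real
  assumes "0 < b" "0 < \<nu>"
  shows "set_integrable lborel {0<..} (\<lambda>t. exp (- (b / t) - t) * t powr (- 1 - \<nu>))"
proof -
  have G: "set_integrable lborel {0<..} (\<lambda>t::real. exp (- t))"
  proof -
    have "((\<lambda>t::real. exp (- t)) has_integral Gamma 1) {0..}"
      using Gamma_integral_real[of 1]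
      by (intro has_integral_spike[of "{0}", OF _ _ Gamma_integral_real[of 1]]) (auto simp: exp_minus field_simps)
    then have "(\<lambda>t::real. exp (- t)) absolutely_integrable_on {0..}"
      by (intro nonnegative_absolutely_integrable_1) auto
    then have "set_integrable lborel {0::real..} (\<lambda>t. exp (- t))"
      by (simp add: set_integrable_def integrable_completion)
    then show ?thesis
      by (rule set_integrable_subset) auto
  qed
  show ?thesis
    unfolding set_integrable_def
  proof (rule Bochner_Integration.integrable_bound)
    show "integrable lborel (\<lambda>t. ((1 + \<nu>) powr (1 + \<nu>) * b powr (- 1 - \<nu>)) *\<^sub>R (indicat_real {0<..} t *\<^sub>R (exp (- t) :: real)))"
      by (rule integrable_scaleR_right) (rule G[unfolded set_integrable_def])
    show "AE t in lborel. norm (indicat_real {0<..} t *\<^sub>R (exp (- (b / t) - t) * t powr (- 1 - \<nu>)))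
      \<le> norm (((1 + \<nu>) powr (1 + \<nu>) * b powr (- 1 - \<nu>)) *\<^sub>R (indicat_real {0<..} t *\<^sub>R (exp (- t) :: real)))"
    proof (rule AE_I2)
      fix t :: real
      have "exp (- (b / t) - t) * t powr (- 1 - \<nu>) \<le> ((1 + \<nu>) powr (1 + \<nu>) * b powr (- 1 - \<nu>)) * exp (- t)" if "t > 0"
      proof -
        have "(b / t) powr (1 + \<nu>) * exp (- (b / t)) \<le> (1 + \<nu>) powr (1 + \<nu>)"
          using assms that by (intro powr_mult_exp_minus_le) auto
        moreover have "(b / t) powr (1 + \<nu>) = t powr (- 1 - \<nu>) / b powr (- 1 - \<nu>)"
        proof -
          have e: "- 1 - \<nu> = - (1 + \<nu>)" by simp
          show ?thesis
            unfolding e powr_minus_divide using assms that by (simp add: powr_divide)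
        qed
        ultimately have "t powr (- 1 - \<nu>) * exp (- (b / t)) \<le> (1 + \<nu>) powr (1 + \<nu>) * b powr (- 1 - \<nu>)"
          using assms by (simp add: field_simps)
        then have "t powr (- 1 - \<nu>) * exp (- (b / t)) * exp (- t) \<le> (1 + \<nu>) powr (1 + \<nu>) * b powr (- 1 - \<nu>) * exp (- t)"
          by (intro mult_right_mono) auto
        then show ?thesis
          by (simp add: exp_diff exp_minus field_simps)
      qed
      then show "norm (indicat_real {0<..} t *\<^sub>R (exp (- (b / t) - t) * t powr (- 1 - \<nu>)))
      \<le> norm (((1 + \<nu>) powr (1 + \<nu>) * b powr (- 1 - \<nu>)) *\<^sub>R (indicat_real {0<..} t *\<^sub>R exp (- t)))"
        by (auto simp: indicator_def abs_mult)
    qed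
  qed measurable
qed

definition kernel_const :: "real \<Rightarrow> real \<Rightarrow> real" where
  "kernel_const s m = 1 / 2 * (m / 2) powr ((3 + 2 * s) / 2)"

lemma kernel_const_nonneg: "0 \<le> kernel_const s m"
  by (simp add: kernel_const_def)

text \<open>The kernel is a superposition of Gaussians in \<open>z\<close>. Working with values in \<open>[0, \<infinity>]\<close> makes Tonelli's
theorem available; the integral agrees with the one that defines the MacDonald function because the
latter converges.\<close>

lemma bessel_kernel_heat:
  assumes "0 < s" "0 < m" "z \<noteq> 0"
  shows "ennreal (bessel_kernel s m z) = ennreal (kernel_const s m) *
    (\<integral>\<^sup>+t\<in>{0<..}. ennreal (exp (- ((m * norm z)\<^sup>2 / (4 * t)) - t) * t powr (- 1 - (3 + 2 * s) / 2)) \<partial>lborel)"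
proof -
  let ?f = "\<lambda>t. exp (- ((m * norm z)\<^sup>2 / (4 * t)) - t) * t powr (- 1 - (3 + 2 * s) / 2)"
  have I: "set_integrable lborel {0<..} ?f"
    using heat_weight_integrable[of "(m * norm z)\<^sup>2 / 4" "(3 + 2 * s) / 2"] assms
    by (simp add: mult.commute)
  have "(\<integral>\<^sup>+t\<in>{0<..}. ennreal (?f t) \<partial>lborel) = (\<integral>\<^sup>+t. ennreal (indicator {0<..} t *\<^sub>R ?f t) \<partial>lborel)"
    by (intro nn_integral_cong) (auto simp: indicator_def)
  also have "\<dots> = ennreal (LBINT t:{0<..}. ?f t)"
    using I unfolding set_integrable_def set_lebesgue_integral_def
    by (intro nn_integral_eq_integral) auto
  finally have *: "(\<integral>\<^sup>+t\<in>{0<..}. ennreal (?f t) \<partial>lborel) = ennreal (LBINT t:{0<..}. ?f t)" .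
  have "bessel_kernel s m z = kernel_const s m * (LBINT t:{0<..}. ?f t)"
    using assms unfolding bessel_kernel_def MacDonald_K_def kernel_const_def
    by (simp add: powr_mult powr_divide)
  then show ?thesis
    unfolding * by (simp only: ennreal_mult'[OF kernel_const_nonneg])
qed

text \<open>For \<open>t\<close> between \<open>|z|\<^sup>2\<close> and \<open>2 * |z|\<^sup>2\<close> the integrand is comparable to the power
\<open>|z|\<^sup>-\<^sup>5\<^sup>-\<^sup>2\<^sup>s\<close>, and this interval has length \<open>|z|\<^sup>2\<close>.\<close>

lemma bessel_kernel_lower:
  assumes "0 < s" "0 < m" "0 < \<rho>"
  obtains c where "0 < c"
    "\<And>z r. z \<noteq> 0 \<Longrightarrow> norm z < r \<Longrightarrow> r \<le> \<rho> \<Longrightarrow> c * r powr (- (3 + 2 * s)) \<le> bessel_kernel s m z"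
proof -
  define \<nu> where "\<nu> = (3 + 2 * s) / 2"
  define c where "c = kernel_const s m * (exp (- (m\<^sup>2 / 4) - 2 * \<rho>\<^sup>2) * 2 powr (- 1 - \<nu>))"
  have cpos: "0 < c"
    using assms by (simp add: c_def kernel_const_def)
  have lower: "c * r powr (- (3 + 2 * s)) \<le> bessel_kernel s m z"
    if z: "z \<noteq> 0" "norm z < r" "r \<le> \<rho>" for z r
  proof -
    define b where "b = (norm z)\<^sup>2"
    have b: "0 < b" "b \<le> \<rho>\<^sup>2"
      using z assms by (auto simp: b_def power_mono)
    let ?f = "\<lambda>t. exp (- ((m * norm z)\<^sup>2 / (4 * t)) - t) * t powr (- 1 - \<nu>)"
    let ?L = "exp (- (m\<^sup>2 / 4) - 2 * \<rho>\<^sup>2) * (2 * b) powr (- 1 - \<nu>)"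
    have "?L \<le> ?f t" if t: "t \<in> {b..2*b}" for t
    proof (intro mult_mono)
      have "(m * norm z)\<^sup>2 / (4 * t) \<le> (m * norm z)\<^sup>2 / (4 * b)"
        using t b by (intro divide_left_mono) auto
      also have "\<dots> = m\<^sup>2 / 4"
        using b by (simp add: b_def power_mult_distrib)
      finally show "exp (- (m\<^sup>2 / 4) - 2 * \<rho>\<^sup>2) \<le> exp (- ((m * norm z)\<^sup>2 / (4 * t)) - t)"
        using t b by simp
      have "0 < \<nu>" using assms by (simp add: \<nu>_def)
      then show "(2 * b) powr (- 1 - \<nu>) \<le> t powr (- 1 - \<nu>)"
        using t b by (intro powr_mono2') auto
    qed auto
    then have "(\<integral>\<^sup>+t\<in>{b..2*b}. ennreal ?L \<partial>lborel) \<le> (\<integral>\<^sup>+t\<in>{0<..}. ennreal (?f t) \<partial>lborel)"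
      using b by (intro nn_integral_mono) (auto simp: indicator_def intro!: ennreal_leI)
    also have "(\<integral>\<^sup>+t\<in>{b..2*b}. ennreal ?L \<partial>lborel) = ennreal (?L * b)"
      using b by (simp add: nn_integral_cmult_indicator ennreal_mult')
    finally have "ennreal (kernel_const s m) * ennreal (?L * b) \<le> ennreal (bessel_kernel s m z)"
      using bessel_kernel_heat[of s m z] assms z by (auto simp: \<nu>_def intro!: mult_left_mono)
    then have "kernel_const s m * (?L * b) \<le> bessel_kernel s m z"
      by (simp add: ennreal_mult'[OF kernel_const_nonneg, symmetric] bessel_kernel_nonneg)
    moreover have "kernel_const s m * (?L * b) = c * (norm z) powr (- (3 + 2 * s))"
    proof -
      have "b = norm z powr 2" using z by (simp add: b_def)
      then have "(2 * b) powr (- 1 - \<nu>) * b = 2 powr (- 1 - \<nu>) * (norm z powr (2 * (- 1 - \<nu>)) * norm z powr 2)"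
        by (simp only: powr_mult powr_powr mult.assoc)
      also have "norm z powr (2 * (- 1 - \<nu>)) * norm z powr 2 = norm z powr (- (3 + 2 * s))"
      proof -
        have "2 * (- 1 - \<nu>) + 2 = - (3 + 2 * s)"
          unfolding \<nu>_def by argo
        then show ?thesis by (simp only: powr_add[symmetric])
      qed
      finally have *: "(2 * b) powr (- 1 - \<nu>) * b = 2 powr (- 1 - \<nu>) * norm z powr (- (3 + 2 * s))" .
      have "kernel_const s m * (?L * b) = kernel_const s m * exp (- (m\<^sup>2 / 4) - 2 * \<rho>\<^sup>2) * ((2 * b) powr (- 1 - \<nu>) * b)"
        by (simp only: mult_ac)
      then show ?thesis unfolding * c_def by (simp only: mult_ac)
    qed
    moreover have "c * r powr (- (3 + 2 * s)) \<le> c * (norm z) powr (- (3 + 2 * s))"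
      using cpos z assms by (intro mult_left_mono powr_mono2') auto
    ultimately show ?thesis by linarith
  qed
  show ?thesis
    using that[OF cpos lower] by blast
qed

lemma gaussian_nn_integral_finite:
  assumes "0 < a"
  shows "(\<integral>\<^sup>+y. ennreal (exp (- a * (norm y)\<^sup>2)) \<partial>(lborel :: R3 measure)) < \<infinity>"
proof -
  \<comment> \<open>The standard deviation for which \<open>exp (- a * x\<^sup>2)\<close> is a multiple of the normal density.\<close>
  define \<sigma> where "\<sigma> = sqrt (1 / (2 * a))"
  have \<sigma>: "0 < \<sigma>" "2 * \<sigma>\<^sup>2 = 1 / a"
    using assms by (auto simp: \<sigma>_def)
  have 1: "(\<integral>\<^sup>+x. ennreal (exp (- a * x\<^sup>2)) \<partial>lborel) < \<infinity>"
  proof -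
    have "integrable lborel (\<lambda>x. sqrt (2 * pi * \<sigma>\<^sup>2) * normal_density 0 \<sigma> x)"
      using \<sigma> by (intro integrable_mult_right integrable_normal_density) auto
    also have "(\<lambda>x. sqrt (2 * pi * \<sigma>\<^sup>2) * normal_density 0 \<sigma> x) = (\<lambda>x. exp (- a * x\<^sup>2))"
      using \<sigma> by (auto simp: normal_density_def fun_eq_iff)
    finally show ?thesis
      by (simp add: integrable_iff_bounded)
  qed
  have "(\<integral>\<^sup>+y. ennreal (exp (- a * (norm y)\<^sup>2)) \<partial>(lborel :: R3 measure))
     = (\<integral>\<^sup>+y. (\<Prod>b\<in>Basis. exp (- a * (y \<bullet> b)\<^sup>2)) \<partial>(lborel :: R3 measure))"
  proof (intro nn_integral_cong arg_cong[of _ _ ennreal])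
    fix y :: R3
    have "(norm y)\<^sup>2 = (\<Sum>b\<in>Basis. (y \<bullet> b)\<^sup>2)"
      unfolding norm_conv_dist by (subst euclidean_dist_l2) (simp add: L2_set_def sum_nonneg)
    then show "exp (- a * (norm y)\<^sup>2) = (\<Prod>b\<in>Basis. exp (- a * (y \<bullet> b)\<^sup>2))"
      by (simp add: exp_sum[symmetric] sum_distrib_left sum_negf)
  qed
  also have "\<dots> = (\<Prod>b\<in>(Basis::R3 set). \<integral>\<^sup>+x. ennreal (exp (- a * x\<^sup>2)) \<partial>lborel)"
    by (subst nn_integral_lborel_prod[symmetric]) (auto simp: prod_ennreal)
  also have "\<dots> < \<infinity>"
    using 1 by (simp add: power_less_top_ennreal)
  finally show ?thesis .
qed

lemma nn_integral_scale_R3: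
  fixes f :: "R3 \<Rightarrow> ennreal"
  assumes [measurable]: "f \<in> borel_measurable borel" and "0 < c"
  shows "(\<integral>\<^sup>+z. f z \<partial>lborel) = ennreal (c ^ 3) * (\<integral>\<^sup>+y. f (c *\<^sub>R y) \<partial>lborel)"
  using assms(2)
  by (subst lborel_affine[of c 0]) (auto simp: nn_integral_density nn_integral_distr nn_integral_cmult)

text \<open>For fixed \<open>t\<close> the substitution \<open>z = sqrt t *\<^sub>R y\<close> turns the Gaussian second moment into a multiple of
\<open>t powr (5 / 2)\<close>. The remaining integral over \<open>t\<close> is \<open>Gamma (1 - s)\<close>, which is where \<open>s < 1\<close> enters.\<close>

lemma bessel_kernel_second_moment:
  assumes "0 < s" "s < 1" "0 < m"
  shows "(\<integral>\<^sup>+z. ennreal ((norm z)\<^sup>2 * bessel_kernel s m z) \<partial>lborel) < \<infinity>"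
proof -
  define \<nu> where "\<nu> = (3 + 2 * s) / 2"
  define G where "G z t = ennreal ((norm z)\<^sup>2 * exp (- ((m * norm z)\<^sup>2 / (4 * t)))) * ennreal (exp (- t) * t powr (- 1 - \<nu>)) * indicator {0<..} t"
    for z :: R3 and t :: real
  have [measurable]: "case_prod G \<in> borel_measurable (lborel \<Otimes>\<^sub>M lborel)"
    unfolding G_def[abs_def] by measurable
  define M where "M = (\<integral>\<^sup>+y. ennreal ((norm y)\<^sup>2 * exp (- ((m * norm y)\<^sup>2 / 4))) \<partial>(lborel :: R3 measure))"
  have M: "M < \<infinity>"
  proof -
    have "M \<le> (\<integral>\<^sup>+y. ennreal (8 / m\<^sup>2) * ennreal (exp (- (m\<^sup>2 / 8) * (norm y)\<^sup>2)) \<partial>(lborel :: R3 measure))"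
      unfolding M_def
    proof (intro nn_integral_mono)
      fix y :: R3
      define X where "X = m\<^sup>2 / 8 * (norm y)\<^sup>2"
      have "X \<le> exp X" using exp_ge_add_one_self[of X] by linarith
      then have "X * exp (- X) \<le> 1" by (simp add: exp_minus field_simps)
      then have "X * exp (- X) * exp (- X) \<le> exp (- X)" by (simp add: X_def)
      then have "8 / m\<^sup>2 * (X * exp (- 2 * X)) \<le> 8 / m\<^sup>2 * exp (- X)"
        by (intro mult_left_mono) (simp_all add: exp_add[symmetric] mult.assoc)
      moreover have "8 / m\<^sup>2 * (X * exp (- 2 * X)) = (norm y)\<^sup>2 * exp (- ((m * norm y)\<^sup>2 / 4))"
        using assms by (simp add: X_def field_simps)
      ultimately show "ennreal ((norm y)\<^sup>2 * exp (- ((m * norm y)\<^sup>2 / 4))) \<le> ennreal (8 / m\<^sup>2) * ennreal (exp (- (m\<^sup>2 / 8) * (norm y)\<^sup>2))"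
        using assms by (simp add: ennreal_mult'[symmetric] X_def ennreal_leI power_mult_distrib)
    qed
    also have "\<dots> < \<infinity>"
      using gaussian_nn_integral_finite[of "m\<^sup>2 / 8"] assms
      by (subst nn_integral_cmult) (auto simp: ennreal_mult_less_top)
    finally show ?thesis .
  qed
  have "(\<integral>\<^sup>+z. ennreal ((norm z)\<^sup>2 * bessel_kernel s m z) \<partial>lborel)
      = (\<integral>\<^sup>+z. ennreal (kernel_const s m) * (\<integral>\<^sup>+t. G z t \<partial>lborel) \<partial>lborel)"
  proof (intro nn_integral_cong)
    fix z :: R3
    show "ennreal ((norm z)\<^sup>2 * bessel_kernel s m z) = ennreal (kernel_const s m) * (\<integral>\<^sup>+t. G z t \<partial>lborel)"
    proof (cases "z = 0")
      case True then show ?thesis by (simp add: G_def)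
    next
      case False
      have "(\<integral>\<^sup>+t. G z t \<partial>lborel) = (\<integral>\<^sup>+t. ennreal ((norm z)\<^sup>2) * (ennreal (exp (- ((m * norm z)\<^sup>2 / (4 * t)) - t) * t powr (- 1 - \<nu>)) * indicator {0<..} t) \<partial>lborel)"
        by (intro nn_integral_cong)
           (auto simp: G_def indicator_def ennreal_mult'[symmetric] exp_diff exp_minus field_simps)
      also have "\<dots> = ennreal ((norm z)\<^sup>2) * (\<integral>\<^sup>+t\<in>{0<..}. ennreal (exp (- ((m * norm z)\<^sup>2 / (4 * t)) - t) * t powr (- 1 - \<nu>)) \<partial>lborel)"
        by (intro nn_integral_cmult) measurable
      finally show ?thesis
        using bessel_kernel_heat[of s m z] assms False
        by (simp add: ennreal_mult' \<nu>_def mult.left_commute)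
    qed
  qed
  also have "\<dots> = ennreal (kernel_const s m) * (\<integral>\<^sup>+z. (\<integral>\<^sup>+t. G z t \<partial>lborel) \<partial>lborel)"
    by (intro nn_integral_cmult) measurable
  also have "(\<integral>\<^sup>+z. (\<integral>\<^sup>+t. G z t \<partial>lborel) \<partial>lborel) = (\<integral>\<^sup>+t. (\<integral>\<^sup>+z. G z t \<partial>lborel) \<partial>lborel)"
    by (rule lborel_pair.Fubini'[symmetric]) measurable
  also have "\<dots> = (\<integral>\<^sup>+t. M * (ennreal (t powr (- s) / exp t) * indicator {0..} t) \<partial>lborel)"
  proof (intro nn_integral_cong_AE AE_I[where N = "{0}"])
    show "{t \<in> space lborel. (\<integral>\<^sup>+z. G z t \<partial>lborel) \<noteq> M * (ennreal (t powr (- s) / exp t) * indicator {0..} t)} \<subseteq> {0}"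
    proof clarsimp
      fix t :: real assume *: "(\<integral>\<^sup>+z. G z t \<partial>lborel) \<noteq> M * (ennreal (t powr (- s) / exp t) * indicator {0..} t)"
      show "t = 0"
      proof (rule ccontr)
        assume "t \<noteq> 0"
        have "(\<integral>\<^sup>+z. G z t \<partial>lborel) = M * (ennreal (t powr (- s) / exp t) * indicator {0..} t)"
        proof (cases "t > 0")
          case False then show ?thesis using \<open>t \<noteq> 0\<close> by (simp add: G_def indicator_def)
        next
          case True
          have "(\<integral>\<^sup>+z. G z t \<partial>lborel) = (\<integral>\<^sup>+z. ennreal ((norm z)\<^sup>2 * exp (- ((m * norm z)\<^sup>2 / (4 * t)))) \<partial>(lborel :: R3 measure)) * ennreal (exp (- t) * t powr (- 1 - \<nu>))"
            using True unfolding G_def by (subst nn_integral_multc[symmetric]) auto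
          also have "(\<integral>\<^sup>+z. ennreal ((norm z)\<^sup>2 * exp (- ((m * norm z)\<^sup>2 / (4 * t)))) \<partial>(lborel :: R3 measure))
             = ennreal (sqrt t ^ 3) * (\<integral>\<^sup>+y. ennreal t * ennreal ((norm y)\<^sup>2 * exp (- ((m * norm y)\<^sup>2 / 4))) \<partial>(lborel :: R3 measure))"
          proof -
            have "ennreal ((norm (sqrt t *\<^sub>R y))\<^sup>2 * exp (- ((m * norm (sqrt t *\<^sub>R y))\<^sup>2 / (4 * t))))
                = ennreal t * ennreal ((norm y)\<^sup>2 * exp (- ((m * norm y)\<^sup>2 / 4)))" for y :: R3
              using True by (simp add: power_mult_distrib ennreal_mult'[symmetric])
            note eq = this
            have "(\<integral>\<^sup>+z. ennreal ((norm z)\<^sup>2 * exp (- ((m * norm z)\<^sup>2 / (4 * t)))) \<partial>(lborel :: R3 measure))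
              = ennreal (sqrt t ^ 3) * (\<integral>\<^sup>+y. ennreal ((norm (sqrt t *\<^sub>R y))\<^sup>2 * exp (- ((m * norm (sqrt t *\<^sub>R y))\<^sup>2 / (4 * t)))) \<partial>(lborel :: R3 measure))"
              by (rule nn_integral_scale_R3) (use True in simp_all)
            then show ?thesis
              unfolding eq .
          qed
          also have "\<dots> = ennreal (sqrt t ^ 3) * (ennreal t * M)"
            unfolding M_def by (subst nn_integral_cmult) auto
          also have "\<dots> * ennreal (exp (- t) * t powr (- 1 - \<nu>)) = M * ennreal (sqrt t ^ 3 * t * (exp (- t) * t powr (- 1 - \<nu>)))"
            using True by (simp add: ennreal_mult' mult_ac)
          also have "sqrt t ^ 3 * t * (exp (- t) * t powr (- 1 - \<nu>)) = t powr (- s) / exp t"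
          proof -
            have "sqrt t ^ 3 * t * t powr (- 1 - \<nu>) = t powr (3 / 2) * t powr 1 * t powr (- 1 - \<nu>)"
              using True by (simp add: powr_half_sqrt[symmetric] powr_power)
            also have "\<dots> = t powr (3 / 2 + 1 + (- 1 - \<nu>))"
              by (simp only: powr_add)
            also have "3 / 2 + 1 + (- 1 - \<nu>) = - s"
              unfolding \<nu>_def by argo
            finally show ?thesis by (simp add: exp_minus field_simps)
          qed
          finally show ?thesis using True by simp
        qed
        with * show False by simp
      qed
    qed
  qed auto
  also have "\<dots> = M * (\<integral>\<^sup>+t\<in>{0..}. ennreal (t powr (- s) / exp t) \<partial>lborel)"
    by (intro nn_integral_cmult) measurable
  also have "(\<integral>\<^sup>+t\<in>{0..}. ennreal (t powr (- s) / exp t) \<partial>lborel) = ennreal (Gamma (1 - s))"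
    using assms by (subst Gamma_conv_nn_integral_real) (auto intro!: nn_integral_cong simp: indicator_def)
  finally show ?thesis
    using M by (simp add: ennreal_mult_less_top)
qed

section \<open>Maximizers of homogeneous functionals\<close>

text \<open>The elements are functions, and \<open>ip u u = 0\<close> is possible for \<open>u\<close> that vanish only almost everywhere, so
\<open>ip\<close> is a semi-inner product. The scalars are real because the energy form is the real part of a sesquilinear form.\<close>

locale function_hilbert =
  fixes H :: "('a \<Rightarrow> complex) set" and ip :: "('a \<Rightarrow> complex) \<Rightarrow> ('a \<Rightarrow> complex) \<Rightarrow> real"
  assumes add_closed: "\<And>u v. u \<in> H \<Longrightarrow> v \<in> H \<Longrightarrow> (\<lambda>x. u x + v x) \<in> H"
    and scale_closed: "\<And>c u. u \<in> H \<Longrightarrow> (\<lambda>x. of_real c * u x) \<in> H"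
    and ip_add: "\<And>u v w. u \<in> H \<Longrightarrow> v \<in> H \<Longrightarrow> w \<in> H \<Longrightarrow> ip (\<lambda>x. u x + v x) w = ip u w + ip v w"
    and ip_scale: "\<And>c u v. u \<in> H \<Longrightarrow> v \<in> H \<Longrightarrow> ip (\<lambda>x. of_real c * u x) v = c * ip u v"
    and ip_sym: "\<And>u v. u \<in> H \<Longrightarrow> v \<in> H \<Longrightarrow> ip u v = ip v u"
    and ip_nonneg: "\<And>u. u \<in> H \<Longrightarrow> 0 \<le> ip u u"
begin

abbreviation nrm2 :: "('a \<Rightarrow> complex) \<Rightarrow> real" where "nrm2 u \<equiv> ip u u"
abbreviation dist2 :: "('a \<Rightarrow> complex) \<Rightarrow> ('a \<Rightarrow> complex) \<Rightarrow> real" where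
  "dist2 u v \<equiv> ip (\<lambda>x. u x - v x) (\<lambda>x. u x - v x)"

lemma lin_closed: "u \<in> H \<Longrightarrow> v \<in> H \<Longrightarrow> (\<lambda>x. of_real a * u x + of_real b * v x) \<in> H"
  by (intro add_closed scale_closed)

lemma diff_closed: "u \<in> H \<Longrightarrow> v \<in> H \<Longrightarrow> (\<lambda>x. u x - v x) \<in> H"
  using lin_closed[of u v 1 "-1"] by simp

lemma ip_lin_left:
  "u \<in> H \<Longrightarrow> v \<in> H \<Longrightarrow> w \<in> H \<Longrightarrow> ip (\<lambda>x. of_real a * u x + of_real b * v x) w = a * ip u w + b * ip v w"
  using ip_add[of "\<lambda>x. of_real a * u x" "\<lambda>x. of_real b * v x" w]
  by (simp add: scale_closed ip_scale)

lemma ip_diff_left: "u \<in> H \<Longrightarrow> v \<in> H \<Longrightarrow> w \<in> H \<Longrightarrow> ip (\<lambda>x. u x - v x) w = ip u w - ip v w"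
  using ip_lin_left[of u v w 1 "-1"] by simp

lemma nrm2_lin:
  assumes "u \<in> H" "v \<in> H"
  shows "nrm2 (\<lambda>x. of_real a * u x + of_real b * v x) = a\<^sup>2 * nrm2 u + 2 * a * b * ip u v + b\<^sup>2 * nrm2 v"
proof -
  let ?w = "\<lambda>x. of_real a * u x + of_real b * v x"
  have w: "?w \<in> H" using assms by (rule lin_closed)
  have "ip u ?w = a * nrm2 u + b * ip u v" "ip v ?w = a * ip u v + b * nrm2 v"
    using assms w by (simp_all add: ip_sym[of _ ?w] ip_lin_left ip_sym[of v u])
  then show ?thesis
    using assms w by (simp add: ip_lin_left power2_eq_square algebra_simps)
qed

lemma nrm2_scale: "u \<in> H \<Longrightarrow> nrm2 (\<lambda>x. of_real c * u x) = c\<^sup>2 * nrm2 u"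
  using nrm2_lin[of u u c 0] by simp

lemma nrm2_add_scale:
  "u \<in> H \<Longrightarrow> v \<in> H \<Longrightarrow> nrm2 (\<lambda>x. u x + of_real t * v x) = nrm2 u + 2 * t * ip u v + t\<^sup>2 * nrm2 v"
  using nrm2_lin[of u v 1 t] by simp

lemma nrm2_diff: "u \<in> H \<Longrightarrow> v \<in> H \<Longrightarrow> dist2 u v = nrm2 u - 2 * ip u v + nrm2 v"
  using nrm2_lin[of u v 1 "-1"] by simp

lemma cauchy_schwarz:
  assumes u: "u \<in> H" and v: "v \<in> H"
  shows "\<bar>ip u v\<bar> \<le> sqrt (nrm2 u) * sqrt (nrm2 v)"
proof -
  have q: "0 \<le> nrm2 u + 2 * t * ip u v + t\<^sup>2 * nrm2 v" for t
    using ip_nonneg[OF add_closed[OF u scale_closed[OF v, of t]]] nrm2_add_scale[OF u v, of t] by simp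
  have "(ip u v)\<^sup>2 \<le> nrm2 u * nrm2 v"
  proof (cases "nrm2 v = 0")
    case True
    have "ip u v = 0"
    proof (rule ccontr)
      assume "ip u v \<noteq> 0"
      then show False
        using q[of "- (nrm2 u + 1) / (2 * ip u v)"] True by (simp add: field_simps)
    qed
    then show ?thesis using True by simp
  next
    case False
    then have "0 < nrm2 v" using ip_nonneg[OF v] by simp
    then show ?thesis
      using q[of "- ip u v / nrm2 v"] by (simp add: field_simps power2_eq_square)
  qed
  then have "sqrt ((ip u v)\<^sup>2) \<le> sqrt (nrm2 u * nrm2 v)"
    by (rule real_sqrt_le_mono)
  then show ?thesis by (simp add: real_sqrt_mult)
qed

lemma triangle:
  assumes "u \<in> H" "v \<in> H"
  shows "sqrt (nrm2 (\<lambda>x. u x + v x)) \<le> sqrt (nrm2 u) + sqrt (nrm2 v)"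
proof (rule real_le_lsqrt)
  have "nrm2 (\<lambda>x. u x + v x) = nrm2 u + 2 * ip u v + nrm2 v"
    using nrm2_add_scale[OF assms, of 1] by simp
  also have "\<dots> \<le> nrm2 u + 2 * (sqrt (nrm2 u) * sqrt (nrm2 v)) + nrm2 v"
    using cauchy_schwarz[OF assms] by linarith
  also have "\<dots> = (sqrt (nrm2 u) + sqrt (nrm2 v))\<^sup>2"
    using assms by (simp add: power2_sum ip_nonneg)
  finally show "nrm2 (\<lambda>x. u x + v x) \<le> (sqrt (nrm2 u) + sqrt (nrm2 v))\<^sup>2" .
qed (use assms ip_nonneg in auto)

lemma nrm2_minus_commute: "u \<in> H \<Longrightarrow> v \<in> H \<Longrightarrow> dist2 u v = dist2 v u"
  by (simp add: nrm2_diff ip_sym)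

lemma triangle_diff:
  assumes "u \<in> H" "v \<in> H" "w \<in> H"
  shows "sqrt (dist2 u w) \<le> sqrt (dist2 u v) + sqrt (dist2 v w)"
  using triangle[OF diff_closed[OF assms(1,2)] diff_closed[OF assms(2,3)]] by simp

definition nrm_complete :: bool where
  "nrm_complete \<longleftrightarrow> (\<forall>u. (\<forall>n. u n \<in> H) \<and>
      (\<forall>e>0. \<exists>N. \<forall>i\<ge>N. \<forall>j\<ge>N. dist2 (u i) (u j) < e) \<longrightarrow>
      (\<exists>l\<in>H. (\<lambda>n. dist2 (u n) l) \<longlonglongrightarrow> 0))"

text \<open>A maximizing sequence that is nearly maximal also at the midpoints converges in norm: by homogeneity a
midpoint of norm less than \<open>1 - e\<close> would have a value well below the supremum, so the
norms of the midpoints tend to 1, and the parallelogram law bounds the distances. This takes the place of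
weak compactness of the unit ball.\<close>

lemma extremal_exists:
  fixes F :: "('a \<Rightarrow> complex) \<Rightarrow> real" and d K :: real
  assumes complete: nrm_complete
    and d: "0 < d"
    and hom: "\<And>c u. 0 < c \<Longrightarrow> u \<in> H \<Longrightarrow> F (\<lambda>x. of_real c * u x) = c powr d * F u"
    and u0: "u0 \<in> H" "0 < F u0"
    and bound: "\<And>u. u \<in> H \<Longrightarrow> nrm2 u \<le> 1 \<Longrightarrow> F u \<le> K"
    and cont: "\<And>u l. (\<And>n. u n \<in> H) \<Longrightarrow> l \<in> H \<Longrightarrow> (\<lambda>n. dist2 (u n) l) \<longlonglongrightarrow> 0 \<Longrightarrow> (\<lambda>n. F (u n)) \<longlonglongrightarrow> F l"
    and quasi: "\<And>u. (\<And>n. u n \<in> H \<and> nrm2 (u n) \<le> 1) \<Longrightarrow> \<exists>r. strict_mono (r :: nat \<Rightarrow> nat) \<and>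
       (\<forall>e>0. \<exists>N. \<forall>i\<ge>N. \<forall>j\<ge>N. min (F (u (r i))) (F (u (r j))) - e \<le> F (\<lambda>x. of_real (1/2) * u (r i) x + of_real (1/2) * u (r j) x))"
  shows "\<exists>u\<in>H. nrm2 u = 1 \<and> 0 < F u \<and> (\<forall>v\<in>H. F v \<le> F u * nrm2 v powr (d / 2))"
proof -
  define S where "S = Sup (F ` {u\<in>H. nrm2 u \<le> 1})"
  have bdd: "bdd_above (F ` {u\<in>H. nrm2 u \<le> 1})"
    using bound by (auto intro!: bdd_aboveI[of _ K])
  have S_upper: "F u \<le> S" if "u \<in> H" "nrm2 u \<le> 1" for u
    unfolding S_def using that by (intro cSup_upper bdd) auto
  have F_null: "F v \<le> 0" if v: "v \<in> H" "nrm2 v = 0" for v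
  proof (rule ccontr)
    assume "\<not> F v \<le> 0"
    then have Fv: "0 < F v" by simp
    define c where "c = ((\<bar>K\<bar> + 1) / F v) powr (1 / d)"
    have "0 < c" using Fv by (simp add: c_def)
    have "c powr d * F v = \<bar>K\<bar> + 1"
      using Fv d by (simp add: c_def powr_powr)
    moreover have "c powr d * F v \<le> K"
      using bound[OF scale_closed[OF v(1), of c]] hom[OF \<open>0 < c\<close> v(1)] v by (simp add: nrm2_scale)
    ultimately show False by linarith
  qed
  have F_le: "F v \<le> S * nrm2 v powr (d / 2)" if v: "v \<in> H" for v
  proof (cases "nrm2 v = 0")
    case True
    then show ?thesis using F_null[OF v] by simp
  next
    case False
    then have pos: "0 < nrm2 v" using ip_nonneg[OF v] by simp
    define c where "c = nrm2 v powr (- 1 / 2)"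
    have c: "0 < c" using pos by (simp add: c_def)
    have c2: "c\<^sup>2 * nrm2 v = 1"
    proof -
      have "c\<^sup>2 = nrm2 v powr (- 1)"
        using pos unfolding c_def by (simp add: powr_power)
      then show ?thesis using pos by (simp add: powr_minus_divide)
    qed
    have le: "c powr d * F v \<le> S"
      using S_upper[OF scale_closed[OF v, of c]] hom[OF c v] c2 v by (simp add: nrm2_scale)
    have "c powr d = nrm2 v powr (- (d / 2))"
      by (simp add: c_def powr_powr)
    then have "c powr d * nrm2 v powr (d / 2) = 1"
      using pos by (simp add: powr_add[symmetric])
    then have "F v = (c powr d * F v) * nrm2 v powr (d / 2)"
      by (simp only: mult.assoc mult.left_commute[of _ "F v"])
    also have "\<dots> \<le> S * nrm2 v powr (d / 2)"
      by (intro mult_right_mono le) simp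
    finally show ?thesis .
  qed
  have S_pos: "0 < S"
  proof (rule ccontr)
    assume "\<not> 0 < S"
    then have "S * nrm2 u0 powr (d / 2) \<le> 0"
      by (intro mult_nonpos_nonneg) auto
    with F_le[OF u0(1)] u0(2) show False by linarith
  qed
  have "\<exists>u. u \<in> H \<and> nrm2 u \<le> 1 \<and> S - 1 / real (Suc n) < F u" for n
  proof -
    have ne: "F ` {u\<in>H. nrm2 u \<le> 1} \<noteq> {}"
      using scale_closed[OF u0(1), of 0] nrm2_scale[OF u0(1), of 0] by auto
    have "S - 1 / real (Suc n) < S" by simp
    then obtain y where "y \<in> F ` {u\<in>H. nrm2 u \<le> 1}" "S - 1 / real (Suc n) < y"
      using less_cSup_iff[OF ne bdd, of "S - 1 / real (Suc n)"] unfolding S_def[symmetric] by blast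
    then show ?thesis by auto
  qed
  then obtain u where u: "\<And>n. u n \<in> H" "\<And>n. nrm2 (u n) \<le> 1" "\<And>n. S - 1 / real (Suc n) < F (u n)"
    by metis
  obtain r :: "nat \<Rightarrow> nat" where r: "strict_mono r"
    and mid: "\<And>e. e > 0 \<Longrightarrow> \<exists>N. \<forall>i\<ge>N. \<forall>j\<ge>N. min (F (u (r i))) (F (u (r j))) - e \<le> F (\<lambda>x. of_real (1/2) * u (r i) x + of_real (1/2) * u (r j) x)"
    using quasi[of u] u by metis
  define w where "w n = u (r n)" for n
  have w: "w n \<in> H" "nrm2 (w n) \<le> 1" for n
    using u by (auto simp: w_def)
  have wF: "(\<lambda>n. F (w n)) \<longlonglongrightarrow> S"
  proof (rule tendsto_sandwich)
    have "S - 1 / real (Suc n) \<le> F (w n)" for n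
    proof -
      have "1 / real (Suc (r n)) \<le> 1 / real (Suc n)"
        using seq_suble[OF r, of n] by (intro divide_left_mono) auto
      then show ?thesis using u(3)[of "r n"] by (simp add: w_def)
    qed
    then show "\<forall>\<^sub>F n in sequentially. S - 1 / real (Suc n) \<le> F (w n)" by simp
    show "\<forall>\<^sub>F n in sequentially. F (w n) \<le> S" using S_upper w by simp
    show "(\<lambda>n. S - 1 / real (Suc n)) \<longlonglongrightarrow> S"
      using tendsto_diff[OF tendsto_const LIMSEQ_inverse_real_of_nat, of S] by (simp add: inverse_eq_divide)
  qed simp
  have cauchy: "\<exists>N. \<forall>i\<ge>N. \<forall>j\<ge>N. dist2 (w i) (w j) < e" if e: "0 < e" for e
  proof -
    \<comment> \<open>By the parallelogram law, a distance of at least \<open>e\<close> forces the midpoint to have \<open>nrm2\<close> at most \<open>1 - e / 4\<close>.\<close>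
    define y where "y = max 0 (1 - e / 4)"
    have y: "0 \<le> y" "y < 1" using e by (auto simp: y_def)
    have "y powr (d / 2) < 1"
      using powr_less_mono2[of "d / 2" y 1] y d by simp
    define \<epsilon> where "\<epsilon> = (S - S * y powr (d / 2)) / 2"
    have \<epsilon>: "0 < \<epsilon>"
      using S_pos \<open>y powr (d / 2) < 1\<close> by (simp add: \<epsilon>_def)
    obtain N1 where N1: "\<And>i j. N1 \<le> i \<Longrightarrow> N1 \<le> j \<Longrightarrow> min (F (w i)) (F (w j)) - \<epsilon> \<le> F (\<lambda>x. of_real (1/2) * w i x + of_real (1/2) * w j x)"
      using mid[OF \<epsilon>] by (auto simp: w_def)
    obtain N2 where N2: "\<And>i. N2 \<le> i \<Longrightarrow> S - \<epsilon> < F (w i)"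
      using order_tendstoD(1)[OF wF, of "S - \<epsilon>"] \<epsilon> by (auto simp: eventually_sequentially)
    have "dist2 (w i) (w j) < e" if ij: "max N1 N2 \<le> i" "max N1 N2 \<le> j" for i j
    proof (rule ccontr)
      assume neg: "\<not> dist2 (w i) (w j) < e"
      let ?m = "\<lambda>x. of_real (1/2) * w i x + of_real (1/2) * w j x"
      have mH: "?m \<in> H" using w by (intro lin_closed)
      have "nrm2 ?m = (1/2)\<^sup>2 * nrm2 (w i) + 2 * (1/2) * (1/2) * ip (w i) (w j) + (1/2)\<^sup>2 * nrm2 (w j)"
        using w by (intro nrm2_lin)
      moreover have "dist2 (w i) (w j) = nrm2 (w i) - 2 * ip (w i) (w j) + nrm2 (w j)"
        using w by (intro nrm2_diff)
      ultimately have "4 * nrm2 ?m = 2 * nrm2 (w i) + 2 * nrm2 (w j) - dist2 (w i) (w j)"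
        by (simp add: power2_eq_square)
      then have "nrm2 ?m \<le> y"
        using neg w(2)[of i] w(2)[of j] by (simp add: y_def)
      then have "nrm2 ?m powr (d / 2) \<le> y powr (d / 2)"
        using ip_nonneg[OF mH] d by (intro powr_mono2) auto
      then have "F ?m \<le> S * y powr (d / 2)"
        using F_le[OF mH] S_pos by (meson mult_left_mono less_imp_le order_trans)
      moreover have "S - \<epsilon> - \<epsilon> < F ?m"
        using N1[of i j] N2[of i] N2[of j] ij by linarith
      ultimately show False by (simp add: \<epsilon>_def)
    qed
    then show ?thesis by blast
  qed
  obtain l where l: "l \<in> H" and lim: "(\<lambda>n. dist2 (w n) l) \<longlonglongrightarrow> 0"
    using complete[unfolded nrm_complete_def, rule_format, of w] w(1) cauchy by auto
  have Fl: "F l = S"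
    using LIMSEQ_unique[OF cont[of w l, OF w(1) l lim] wF] .
  have "sqrt (nrm2 l) \<le> 1"
  proof (rule LIMSEQ_le_const)
    show "(\<lambda>n. sqrt (dist2 (w n) l) + 1) \<longlonglongrightarrow> 1"
      using tendsto_add[OF tendsto_real_sqrt[OF lim] tendsto_const, of 1] by simp
    have "sqrt (nrm2 l) \<le> sqrt (dist2 (w n) l) + 1" for n
    proof -
      have "sqrt (nrm2 l) \<le> sqrt (dist2 l (w n)) + sqrt (nrm2 (w n))"
        using triangle[OF diff_closed[OF l w(1)[of n]] w(1)[of n]] by simp
      moreover have "sqrt (nrm2 (w n)) \<le> 1" using w by simp
      ultimately show ?thesis
        unfolding nrm2_minus_commute[OF l w(1)[of n]] by linarith
    qed
    then show "\<exists>N. \<forall>n\<ge>N. sqrt (nrm2 l) \<le> sqrt (dist2 (w n) l) + 1" by blast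
  qed
  then have le1: "nrm2 l \<le> 1" by simp
  have "nrm2 l = 1"
  proof (rule ccontr)
    assume "nrm2 l \<noteq> 1"
    then have "nrm2 l powr (d / 2) < 1"
      using powr_less_mono2[of "d / 2" "nrm2 l" 1] le1 ip_nonneg[OF l] d by simp
    then have "S * nrm2 l powr (d / 2) < S * 1"
      using S_pos by (intro mult_strict_left_mono)
    then show False using F_le[OF l] Fl by simp
  qed
  then show ?thesis
    using l Fl S_pos F_le by auto
qed

text \<open>The difference of the two sides of the maximality estimate along the line \<open>u + t v\<close>, with the lower bound
inserted for \<open>F\<close>, is a nonnegative differentiable function of \<open>t\<close> that vanishes at 0.\<close>

lemma euler_lagrange:
  fixes F :: "('a \<Rightarrow> complex) \<Rightarrow> real" and d l :: real
  assumes u: "u \<in> H" "nrm2 u = 1" and v: "v \<in> H"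
    and max: "\<And>v. v \<in> H \<Longrightarrow> F v \<le> F u * nrm2 v powr (d / 2)"
    and below: "\<And>t. F u + t * l \<le> F (\<lambda>x. u x + of_real t * v x)"
  shows "l = F u * d * ip u v"
proof -
  define g where "g t = F u * (1 + 2 * t * ip u v + t\<^sup>2 * nrm2 v) powr (d / 2) - F u - t * l" for t
  have g_nonneg: "0 \<le> g t" for t
    using below[of t] max[OF add_closed[OF u(1) scale_closed[OF v, of t]]] nrm2_add_scale[OF u(1) v, of t] u(2)
    by (simp add: g_def)
  have "(g has_real_derivative (F u * d * ip u v - l)) (at 0)"
    unfolding g_def by (auto intro!: derivative_eq_intros)
  then have "F u * d * ip u v - l = 0"
    by (rule DERIV_local_min[of _ _ _ 1]) (use g_nonneg in \<open>auto simp: g_def\<close>)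
  then show ?thesis by simp
qed

text \<open>A linear functional is homogeneous of degree one and its value at a midpoint is the mean value, so
\<open>extremal_exists\<close> applies with the trivial subsequence. The Euler-Lagrange equation of the maximizer
\<open>u\<close> says that \<open>L u\<close> times \<open>u\<close> represents the functional.\<close>

lemma riesz:
  fixes L :: "('a \<Rightarrow> complex) \<Rightarrow> real"
  assumes complete: nrm_complete and ne: "z0 \<in> H"
    and L_lin: "\<And>u v a b. u \<in> H \<Longrightarrow> v \<in> H \<Longrightarrow> L (\<lambda>x. of_real a * u x + of_real b * v x) = a * L u + b * L v"
    and L_bound: "\<And>u. u \<in> H \<Longrightarrow> nrm2 u \<le> 1 \<Longrightarrow> L u \<le> K"
  shows "\<exists>w\<in>H. \<forall>v\<in>H. L v = ip w v"
proof (cases "\<exists>v\<in>H. L v \<noteq> 0")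
  case False
  then show ?thesis
    using scale_closed[OF ne, of 0] ip_scale[OF ne, of _ 0] by force
next
  case True
  have L_scale: "L (\<lambda>x. of_real c * u x) = c * L u" if "u \<in> H" for c u
    using L_lin[OF that that, of c 0] by simp
  have L_diff: "L (\<lambda>x. u x - v x) = L u - L v" if "u \<in> H" "v \<in> H" for u v
    using L_lin[OF that, of 1 "-1"] by simp
  from True obtain u0 where u0: "u0 \<in> H" "0 < L u0"
  proof -
    from True obtain v where v: "v \<in> H" "L v \<noteq> 0" by auto
    show ?thesis
    proof (cases "0 < L v")
      case True then show ?thesis using that v by blast
    next
      case False then show ?thesis
        using that[of "\<lambda>x. of_real (-1) * v x"] v scale_closed[OF v(1), of "-1"] L_scale[OF v(1), of "-1"] by simp
    qed
  qed
  have bound': "\<bar>L v\<bar> \<le> \<bar>K\<bar> * e" if v: "v \<in> H" and e: "0 < e" "nrm2 v \<le> e\<^sup>2" for v e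
  proof -
    have n: "(1 / e)\<^sup>2 * nrm2 v \<le> 1" using e by (simp add: power_divide)
    have "L (\<lambda>x. of_real (1 / e) * v x) \<le> K" "L (\<lambda>x. of_real (- (1 / e)) * v x) \<le> K"
      using L_bound scale_closed[OF v, of "1 / e"] scale_closed[OF v, of "- (1 / e)"]
        nrm2_scale[OF v, of "1 / e"] nrm2_scale[OF v, of "- (1 / e)"] n by auto
    then have "L v / e \<le> \<bar>K\<bar>" "- L v / e \<le> \<bar>K\<bar>"
      using L_scale[OF v, of "1 / e"] L_scale[OF v, of "- (1 / e)"] by auto
    then show ?thesis using e by (simp add: field_simps abs_le_iff)
  qed
  have "\<exists>u\<in>H. nrm2 u = 1 \<and> 0 < L u \<and> (\<forall>v\<in>H. L v \<le> L u * nrm2 v powr (1 / 2))"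
  proof (rule extremal_exists[OF complete, where K = K and ?u0.0 = u0])
    fix u :: "nat \<Rightarrow> 'a \<Rightarrow> complex" and l
    assume u: "\<And>n. u n \<in> H" and l: "l \<in> H" and lim: "(\<lambda>n. dist2 (u n) l) \<longlonglongrightarrow> 0"
    show "(\<lambda>n. L (u n)) \<longlonglongrightarrow> L l"
    proof (rule LIMSEQ_I)
      fix r :: real assume r: "0 < r"
      define e where "e = r / (\<bar>K\<bar> + 1)"
      have e: "0 < e" using r by (simp add: e_def add_nonneg_pos)
      obtain N where N: "\<And>n. N \<le> n \<Longrightarrow> dist2 (u n) l < e\<^sup>2"
        using order_tendstoD(2)[OF lim, of "e\<^sup>2"] e by (auto simp: eventually_sequentially)
      have "norm (L (u n) - L l) < r" if "N \<le> n" for n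
      proof -
        have "\<bar>L (u n) - L l\<bar> \<le> \<bar>K\<bar> * e"
          using bound'[OF diff_closed[OF u l] e less_imp_le[OF N[OF that]]] L_diff[OF u l] by simp
        also have "\<dots> < (\<bar>K\<bar> + 1) * e" using e by (simp add: distrib_right)
        also have "\<dots> = r" by (simp add: e_def add_nonneg_pos)
        finally show ?thesis by simp
      qed
      then show "\<exists>N. \<forall>n\<ge>N. norm (L (u n) - L l) < r" by blast
    qed
  next
    fix u :: "nat \<Rightarrow> 'a \<Rightarrow> complex" assume u: "\<And>n. u n \<in> H \<and> nrm2 (u n) \<le> 1"
    have "min (L (u i)) (L (u j)) - e \<le> L (\<lambda>x. of_real (1/2) * u i x + of_real (1/2) * u j x)" if "0 < e" for i j e
      using L_lin[of "u i" "u j" "1/2" "1/2"] u that by simp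
    then show "\<exists>r. strict_mono (r :: nat \<Rightarrow> nat) \<and> (\<forall>e>0. \<exists>N. \<forall>i\<ge>N. \<forall>j\<ge>N.
        min (L (u (r i))) (L (u (r j))) - e \<le> L (\<lambda>x. of_real (1/2) * u (r i) x + of_real (1/2) * u (r j) x))"
      by (intro exI[of _ "\<lambda>n. n"]) (auto simp: strict_mono_def)
  qed (use u0 L_scale L_bound in auto)
  then obtain u where u: "u \<in> H" "nrm2 u = 1" and max: "\<And>v. v \<in> H \<Longrightarrow> L v \<le> L u * nrm2 v powr (1 / 2)"
    by blast
  have "L v = ip (\<lambda>x. of_real (L u) * u x) v" if v: "v \<in> H" for v
  proof -
    have "L v = L u * 1 * ip u v"
      using u v max
    proof (rule euler_lagrange)
      show "L u + t * L v \<le> L (\<lambda>x. u x + of_real t * v x)" for t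
        using L_lin[OF u(1) v, of 1 t] by simp
    qed
    then show ?thesis using u v by (simp add: ip_scale)
  qed
  then show ?thesis using scale_closed[OF u(1)] by blast
qed

end

section \<open>Representatives and almost everywhere limits\<close>

abbreviation esq :: "complex \<Rightarrow> ennreal" where "esq a \<equiv> ennreal ((cmod a)\<^sup>2)"

lemma borel_representative:
  fixes u :: "'a::euclidean_space \<Rightarrow> complex"
  assumes [measurable]: "u \<in> borel_measurable lebesgue"
  obtains u' where "u' \<in> borel_measurable borel" "AE x in lebesgue. u x = u' x"
proof -
  have re: "(\<lambda>x. Re (u x)) \<in> borel_measurable lebesgue" and im: "(\<lambda>x. Im (u x)) \<in> borel_measurable lebesgue"
    by measurable
  obtain f where [measurable]: "f \<in> borel_measurable borel" and aef: "AE x in lborel. Re (u x) = f x"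
    using completion_ex_borel_measurable_real[OF re] by auto
  obtain g where [measurable]: "g \<in> borel_measurable borel" and aeg: "AE x in lborel. Im (u x) = g x"
    using completion_ex_borel_measurable_real[OF im] by auto
  note ae = aef aeg
  show ?thesis
  proof (rule that[of "\<lambda>x. of_real (f x) + \<i> * of_real (g x)"])
    show "AE x in lebesgue. u x = of_real (f x) + \<i> * of_real (g x)"
      unfolding AE_completion_iff using ae by eventually_elim (simp add: complex_eq_iff)
  qed measurable
qed

lemma AE_lebesgue_fst_snd:
  assumes "AE x in (lebesgue :: 'a::euclidean_space measure). P x"
  shows "AE z in (lebesgue :: ('a \<times> 'a) measure). P (fst z) \<and> P (snd z)"
proof -
  have "AE x in (lborel :: 'a measure). P x"
    using assms by (simp add: AE_completion_iff)
  then obtain N where N: "{x. \<not> P x} \<subseteq> N" "N \<in> null_sets (lborel :: 'a measure)"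
    by (auto elim!: AE_E simp: null_sets_def)
  then have [measurable]: "N \<in> sets borel" by auto
  have ae: "AE x in lborel. x \<notin> N" using N(2) by (rule AE_not_in)
  have "AE z in (lborel :: 'a measure) \<Otimes>\<^sub>M lborel. fst z \<notin> N \<and> snd z \<notin> N"
  proof (rule lborel_pair.AE_pair_measure)
    show "{z \<in> space (lborel \<Otimes>\<^sub>M lborel). fst z \<notin> N \<and> snd z \<notin> N} \<in> sets ((lborel :: 'a measure) \<Otimes>\<^sub>M lborel)"
      by measurable
    show "AE x in lborel. AE y in lborel. fst (x, y) \<notin> N \<and> snd (x, y) \<notin> N"
      using ae by eventually_elim (use ae in simp)
  qed
  then show ?thesis
    unfolding AE_completion_iff lborel_prod by (rule eventually_mono) (use N(1) in auto)
qed

lemma nn_integral_fatou_bound: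
  assumes "\<And>n. f n \<in> borel_measurable M"
    and lim: "AE x in M. (\<lambda>n. f n x) \<longlonglongrightarrow> (g x :: ennreal)"
    and bound: "\<And>n. N \<le> n \<Longrightarrow> (\<integral>\<^sup>+x. f n x \<partial>M) \<le> K"
  shows "(\<integral>\<^sup>+x. g x \<partial>M) \<le> K"
proof -
  have "(\<integral>\<^sup>+x. g x \<partial>M) = (\<integral>\<^sup>+x. liminf (\<lambda>n. f n x) \<partial>M)"
    using lim by (intro nn_integral_cong_AE) (auto elim!: eventually_mono simp: lim_imp_Liminf)
  also have "\<dots> \<le> liminf (\<lambda>n. \<integral>\<^sup>+x. f n x \<partial>M)"
    using assms(1) by (rule nn_integral_liminf)
  also have "\<dots> \<le> limsup (\<lambda>n. \<integral>\<^sup>+x. f n x \<partial>M)"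
    by (rule Liminf_le_Limsup) simp
  also have "\<dots> \<le> K"
    by (rule Limsup_bounded) (use bound in \<open>auto simp: eventually_sequentially\<close>)
  finally show ?thesis .
qed

lemma convergent_if_summable_steps:
  fixes f :: "nat \<Rightarrow> 'a::banach"
  assumes "summable (\<lambda>n. norm (f (Suc n) - f n))"
  shows "convergent f"
proof -
  have "summable (\<lambda>n. f (Suc n) - f n)"
    using assms by (rule summable_norm_cancel)
  then obtain l where "(\<lambda>n. \<Sum>i<n. f (Suc i) - f i) \<longlonglongrightarrow> l"
    unfolding summable_def sums_def by blast
  then have "(\<lambda>n. f n - f 0) \<longlonglongrightarrow> l"
    by (simp add: sum_lessThan_telescope)
  then have "(\<lambda>n. f n - f 0 + f 0) \<longlonglongrightarrow> l + f 0"
    by (intro tendsto_add tendsto_const)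
  then show ?thesis by (auto simp: convergent_def)
qed

text \<open>After multiplication by \<open>2 ^ n\<close> the integrals of the squared increments still have a convergent sum, so
almost everywhere the increments are bounded by a multiple of \<open>2 powr (- n / 2)\<close>.\<close>

lemma AE_convergent_if_fast_L2:
  fixes v :: "nat \<Rightarrow> 'a \<Rightarrow> complex"
  assumes [measurable]: "\<And>n. v n \<in> borel_measurable M"
    and fast: "\<And>n. (\<integral>\<^sup>+x. esq (v (Suc n) x - v n x) \<partial>M) \<le> ennreal (c * (1 / 4) ^ n)"
    and c: "0 \<le> c"
  shows "AE x in M. convergent (\<lambda>n. v n x)"
proof -
  define f where "f n x = ennreal (2 ^ n * (cmod (v (Suc n) x - v n x))\<^sup>2)" for n x
  have [measurable]: "f n \<in> borel_measurable M" for n unfolding f_def[abs_def] by measurable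
  have "(\<integral>\<^sup>+x. f n x \<partial>M) \<le> ennreal (c * (1 / 2) ^ n)" for n
  proof -
    have "(\<integral>\<^sup>+x. f n x \<partial>M) = ennreal (2 ^ n) * (\<integral>\<^sup>+x. esq (v (Suc n) x - v n x) \<partial>M)"
      unfolding f_def by (subst nn_integral_cmult[symmetric]) (auto simp: ennreal_mult')
    also have "\<dots> \<le> ennreal (2 ^ n) * ennreal (c * (1 / 4) ^ n)"
      by (intro mult_left_mono fast) auto
    also have "\<dots> = ennreal (c * (1 / 2) ^ n)"
      by (subst ennreal_mult'[symmetric]) (auto simp: power_mult_distrib[symmetric] mult.left_commute)
    finally show ?thesis .
  qed
  then have "(\<integral>\<^sup>+x. (\<Sum>n. f n x) \<partial>M) \<le> (\<Sum>n. ennreal (c * (1 / 2) ^ n))"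
    by (subst nn_integral_suminf) (auto intro!: suminf_le)
  also have "\<dots> = ennreal (\<Sum>n. c * (1 / 2) ^ n)"
    using c by (intro suminf_ennreal2) (auto intro!: summable_mult summable_geometric)
  also have "\<dots> < \<infinity>" by simp
  finally have "AE x in M. (\<Sum>n. f n x) \<noteq> \<infinity>"
    by (intro nn_integral_PInf_AE) auto
  then show ?thesis
  proof eventually_elim
    case (elim x)
    then obtain S where S: "(\<Sum>n. f n x) = ennreal S" "0 \<le> S"
      by (cases "\<Sum>n. f n x") auto
    have step: "cmod (v (Suc n) x - v n x) \<le> sqrt S * (1 / sqrt 2) ^ n" for n
    proof -
      have "f n x \<le> ennreal S"
        unfolding S(1)[symmetric] using sum_le_suminf[of "\<lambda>n. f n x" "{n}"] by simp
      then have "2 ^ n * (cmod (v (Suc n) x - v n x))\<^sup>2 \<le> S"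
        using S(2) by (simp add: f_def)
      then have "(cmod (v (Suc n) x - v n x))\<^sup>2 \<le> S * (1 / 2) ^ n"
        by (simp add: field_simps power_divide)
      also have "\<dots> = (sqrt S * (1 / sqrt 2) ^ n)\<^sup>2"
      proof -
        have "(sqrt S * (1 / sqrt 2) ^ n)\<^sup>2 = (sqrt S * sqrt S) * ((1 / sqrt 2) * (1 / sqrt 2)) ^ n"
          unfolding power2_eq_square power_mult_distrib by (rule mult.assoc[THEN trans]) (simp add: mult.left_commute)
        also have "\<dots> = S * (1 / 2) ^ n"
          using S(2) by simp
        finally show ?thesis by (rule sym)
      qed
      finally show ?thesis
        by (rule power2_le_imp_le) (use S(2) in simp)
    qed
    have "summable (\<lambda>n. sqrt S * (1 / sqrt 2) ^ n)"
      by (intro summable_mult summable_geometric) simp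
    then have "summable (\<lambda>n. cmod (v (Suc n) x - v n x))"
      by (rule summable_comparison_test'[where N = 0]) (simp only: norm_ge_zero real_norm_def abs_norm_cancel step)
    then show ?case by (rule convergent_if_summable_steps)
  qed
qed

lemma cnj_measurable [measurable]: "cnj \<in> borel_measurable borel"
  by (intro borel_measurable_continuous_onI continuous_on_cnj continuous_on_id)

lemma mult_le_sum_squares: "0 \<le> a \<Longrightarrow> 0 \<le> b \<Longrightarrow> a * b \<le> a\<^sup>2 + b\<^sup>2" for a b :: real
  using sum_squares_bound[of a b] mult_nonneg_nonneg[of a b] by linarith

lemma ennreal_le_divideI:
  fixes X Y :: ennreal
  assumes b: "0 < b" and c: "0 \<le> c" and le: "ennreal b * X \<le> ennreal c * Y"
  shows "X \<le> ennreal (c / b) * Y"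
proof -
  have "ennreal (1 / b) * ennreal b = 1"
    using b by (subst ennreal_mult'[symmetric]) auto
  then have "X = ennreal (1 / b) * (ennreal b * X)"
    by (simp only: mult.assoc[symmetric] mult_1)
  also have "\<dots> \<le> ennreal (1 / b) * (ennreal c * Y)"
    by (intro mult_left_mono le) simp
  also have "\<dots> = ennreal (c / b) * Y"
    using b c by (subst mult.assoc[symmetric], subst ennreal_mult'[symmetric]) auto
  finally show ?thesis .
qed

lemma ennreal_le_divideI':
  fixes X :: ennreal
  assumes "0 < b" "0 \<le> c" "ennreal b * X \<le> ennreal c"
  shows "X \<le> ennreal (c / b)"
  using ennreal_le_divideI[of b c X 1] assms by simp

section \<open>The energy form\<close>

locale magnetic =
  fixes A :: "R3 \<Rightarrow> R3" and s m :: real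
  assumes s_pos: "0 < s" and s_less_1: "s < 1" and m_pos: "0 < m"
    and continuous_A: "continuous_on UNIV A"
begin

abbreviation FFS where "FFS \<equiv> finite_form_space A s m"
abbreviation ip where "ip \<equiv> inner_As A s m"
abbreviation D where "D \<equiv> magnetic_diff A"
abbreviation dist2 where "dist2 u v \<equiv> ip (\<lambda>x. u x - v x) (\<lambda>x. u x - v x)"
abbreviation \<kappa> where "\<kappa> \<equiv> bessel_kernel s m"
abbreviation density where
  "density u z \<equiv> ennreal ((cmod (D u (fst z) (snd z)))\<^sup>2 * \<kappa> (fst z - snd z))"

definition c1 where "c1 = C_const s / 2 * m powr ((3 + 2 * s) / 2)"
definition c2 where "c2 = m powr (2 * s)"

lemma c1_pos: "0 < c1"
  using s_pos s_less_1 m_pos by (simp add: c1_def C_const_def Gamma_real_pos)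

lemma c2_pos: "0 < c2"
  using m_pos by (simp add: c2_def)

lemma A_measurable [measurable]: "A \<in> borel_measurable borel"
  using continuous_A by (rule borel_measurable_continuous_onI)

lemma form_integrand_eq:
  "form_integrand A s m u v z = D u (fst z) (snd z) * cnj (D v (fst z) (snd z)) * of_real (\<kappa> (fst z - snd z))"
  by (cases z) (simp add: form_integrand_def bessel_kernel_def)

lemma D_lin: "D (\<lambda>x. a * u x + b * v x) x y = a * D u x y + b * D v x y"
  by (simp add: magnetic_diff_def algebra_simps)

lemma D_add: "D (\<lambda>x. u x + v x) x y = D u x y + D v x y"
  using D_lin[of 1 u 1 v] by simp

lemma D_scale: "D (\<lambda>x. c * u x) x y = c * D u x y"
  using D_lin[of c u 0 u] by simp

lemma D_borel_measurable:
  assumes [measurable]: "u \<in> borel_measurable borel"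
  shows "(\<lambda>z. D u (fst z) (snd z)) \<in> borel_measurable (borel \<Otimes>\<^sub>M borel)"
  unfolding magnetic_diff_def midpoint_def by measurable

lemma D_measurable:
  assumes u: "u \<in> borel_measurable lebesgue"
  shows "(\<lambda>z. D u (fst z) (snd z)) \<in> borel_measurable lebesgue"
proof -
  obtain u' where u': "u' \<in> borel_measurable borel" "AE x in lebesgue. u x = u' x"
    using borel_representative[OF u] .
  have "(\<lambda>z. D u' (fst z) (snd z)) \<in> borel_measurable lebesgue"
    using D_borel_measurable[OF u'(1)] by (intro measurable_completion) (simp add: borel_prod)
  then show ?thesis
  proof (rule borel_measurable_AE)
    show "AE z in lebesgue. D u' (fst z) (snd z) = D u (fst z) (snd z)"
      using AE_lebesgue_fst_snd[OF u'(2)] by eventually_elim (simp add: magnetic_diff_def)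
  qed
qed

lemma \<kappa>_measurable_borel: "(\<lambda>z. \<kappa> (fst z - snd z)) \<in> borel_measurable (borel \<Otimes>\<^sub>M borel)"
  by measurable

lemma \<kappa>_measurable: "(\<lambda>z. \<kappa> (fst z - snd z)) \<in> borel_measurable lebesgue"
  using \<kappa>_measurable_borel by (intro measurable_completion) (simp add: borel_prod)

lemma form_integrand_measurable:
  assumes "u \<in> borel_measurable lebesgue" "v \<in> borel_measurable lebesgue"
  shows "form_integrand A s m u v \<in> borel_measurable lebesgue"
proof -
  note [measurable] = D_measurable[OF assms(1)] D_measurable[OF assms(2)] \<kappa>_measurable
  show ?thesis unfolding form_integrand_eq[abs_def] by measurable
qed

text \<open>The two parts of the energy with values in \<open>[0, \<infinity>]\<close>, where infinite energy is visible. In \<^const>\<open>inner_As\<close> a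
divergent integral has the default value 0.\<close>

definition nonlocal :: "(R3 \<Rightarrow> complex) \<Rightarrow> ennreal" where
  "nonlocal u = (\<integral>\<^sup>+z. density u z \<partial>lebesgue)"

definition mass :: "(R3 \<Rightarrow> complex) \<Rightarrow> ennreal" where
  "mass u = (\<integral>\<^sup>+x. esq (u x) \<partial>lebesgue)"

lemma nonlocal_integrand_measurable:
  assumes "u \<in> borel_measurable lebesgue"
  shows "(\<lambda>z. density u z) \<in> borel_measurable lebesgue"
  using D_measurable[OF assms] \<kappa>_measurable by measurable

lemma norm_form_integrand:
  "norm (form_integrand A s m u u z) = (cmod (D u (fst z) (snd z)))\<^sup>2 * \<kappa> (fst z - snd z)"
  by (simp add: form_integrand_eq norm_mult bessel_kernel_nonneg power2_eq_square)

lemma FFS_iff: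
  "u \<in> FFS \<longleftrightarrow> u \<in> borel_measurable lebesgue \<and> nonlocal u < \<infinity> \<and> mass u < \<infinity>"
proof (cases "u \<in> borel_measurable lebesgue")
  case True
  note [measurable] = True
  have "(\<lambda>x. u x * cnj (u x)) \<in> borel_measurable lebesgue" by measurable
  then show ?thesis
    using True form_integrand_measurable[OF True True]
    unfolding finite_form_space_def nonlocal_def mass_def
    by (simp add: integrable_iff_bounded norm_form_integrand norm_mult power2_eq_square)
qed (simp add: finite_form_space_def)

lemma FFS_measurable: "u \<in> FFS \<Longrightarrow> u \<in> borel_measurable lebesgue"
  by (simp add: finite_form_space_def)

lemma nonlocal_cong_AE:
  assumes "AE x in lebesgue. u x = v x"
  shows "nonlocal u = nonlocal v"
  unfolding nonlocal_def
  by (intro nn_integral_cong_AE eventually_mono[OF AE_lebesgue_fst_snd[OF assms]]) (simp add: magnetic_diff_def)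

lemma mass_cong_AE:
  assumes "AE x in lebesgue. u x = v x"
  shows "mass u = mass v"
  unfolding mass_def using assms by (intro nn_integral_cong_AE) (auto elim!: eventually_mono)

lemma FFS_cong_AE:
  assumes u: "u \<in> FFS" and "AE x in lebesgue. u x = v x"
  shows "v \<in> FFS"
  using u assms(2) borel_measurable_AE[OF _ assms(2)] nonlocal_cong_AE[OF assms(2)] mass_cong_AE[OF assms(2)]
  by (auto simp: FFS_iff)

lemma integrable_form:
  assumes u: "u \<in> FFS" and v: "v \<in> FFS"
  shows "integrable lebesgue (form_integrand A s m u v)"
proof (rule Bochner_Integration.integrable_bound)
  show "integrable lebesgue (\<lambda>z. norm (form_integrand A s m u u z) + norm (form_integrand A s m v v z))"
    using u v by (auto simp: finite_form_space_def)
  show "form_integrand A s m u v \<in> borel_measurable lebesgue"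
    using u v by (intro form_integrand_measurable FFS_measurable)
  show "AE z in lebesgue. norm (form_integrand A s m u v z) \<le> norm (norm (form_integrand A s m u u z) + norm (form_integrand A s m v v z))"
  proof (rule AE_I2)
    fix z
    let ?a = "cmod (D u (fst z) (snd z))" and ?b = "cmod (D v (fst z) (snd z))"
    have "?a * ?b \<le> ?a\<^sup>2 + ?b\<^sup>2"
      by (intro mult_le_sum_squares) auto
    then have "?a * ?b * \<kappa> (fst z - snd z) \<le> (?a\<^sup>2 + ?b\<^sup>2) * \<kappa> (fst z - snd z)"
      by (intro mult_right_mono bessel_kernel_nonneg)
    then show "norm (form_integrand A s m u v z) \<le> norm (norm (form_integrand A s m u u z) + norm (form_integrand A s m v v z))"
      unfolding norm_form_integrand 
      by (simp add: form_integrand_eq norm_mult bessel_kernel_nonneg distrib_right)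
  qed
qed

lemma integrable_product:
  assumes u: "u \<in> FFS" and v: "v \<in> FFS"
  shows "integrable lebesgue (\<lambda>x. u x * cnj (v x))"
proof (rule Bochner_Integration.integrable_bound)
  show "integrable lebesgue (\<lambda>x. norm (u x * cnj (u x)) + norm (v x * cnj (v x)))"
    using u v by (auto simp: finite_form_space_def)
  note [measurable] = FFS_measurable[OF u] FFS_measurable[OF v]
  show "(\<lambda>x. u x * cnj (v x)) \<in> borel_measurable lebesgue" by measurable
  show "AE x in lebesgue. norm (u x * cnj (v x)) \<le> norm (norm (u x * cnj (u x)) + norm (v x * cnj (v x)))"
  proof (rule AE_I2)
    fix x
    have "cmod (u x) * cmod (v x) \<le> cmod (u x) * cmod (u x) + cmod (v x) * cmod (v x)"
      using mult_le_sum_squares[of "cmod (u x)" "cmod (v x)"] by (simp add: power2_eq_square)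
    then show "norm (u x * cnj (v x)) \<le> norm (norm (u x * cnj (u x)) + norm (v x * cnj (v x)))"
      by (simp add: norm_mult)
  qed
qed

lemma ip_eq: "ip u v = c1 * form_nonlocal A s m u v + c2 * Re (\<integral>x. u x * cnj (v x) \<partial>lebesgue)"
  by (simp add: inner_As_def c1_def c2_def)

lemma ip_energy:
  assumes u: "u \<in> FFS"
  shows "ip u u = c1 * enn2real (nonlocal u) + c2 * enn2real (mass u)"
proof -
  have "form_integrand A s m u u = (\<lambda>z. complex_of_real ((cmod (D u (fst z) (snd z)))\<^sup>2 * \<kappa> (fst z - snd z)))"
    by (rule ext) (simp only: form_integrand_eq of_real_mult complex_norm_square)
  then have "form_nonlocal A s m u u = (\<integral>z. (cmod (D u (fst z) (snd z)))\<^sup>2 * \<kappa> (fst z - snd z) \<partial>lebesgue)"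
    unfolding form_nonlocal_def by (simp only: integral_complex_of_real Re_complex_of_real)
  also have "\<dots> = enn2real (nonlocal u)"
    unfolding nonlocal_def
    using D_measurable[OF FFS_measurable[OF u]] \<kappa>_measurable
    by (intro integral_eq_nn_integral AE_I2) (auto simp: bessel_kernel_nonneg)
  finally have 1: "form_nonlocal A s m u u = enn2real (nonlocal u)" .
  have "Re (\<integral>x. u x * cnj (u x) \<partial>lebesgue) = (\<integral>x. (cmod (u x))\<^sup>2 \<partial>lebesgue)"
    by (simp only: complex_norm_square[symmetric] integral_complex_of_real Re_complex_of_real)
  also have "\<dots> = enn2real (mass u)"
    unfolding mass_def using FFS_measurable[OF u] by (intro integral_eq_nn_integral AE_I2) auto
  finally show ?thesis by (simp add: ip_eq 1)
qed

lemma energy_le: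
  assumes u: "u \<in> FFS" and le: "ip u u \<le> e"
  shows "nonlocal u \<le> ennreal (e / c1)" "mass u \<le> ennreal (e / c2)"
proof -
  have "c1 * enn2real (nonlocal u) \<le> e" "c2 * enn2real (mass u) \<le> e"
    using le mult_nonneg_nonneg[OF less_imp_le[OF c1_pos] enn2real_nonneg[of "nonlocal u"]]
      mult_nonneg_nonneg[OF less_imp_le[OF c2_pos] enn2real_nonneg[of "mass u"]]
    unfolding ip_energy[OF u] by linarith+
  then have "enn2real (nonlocal u) \<le> e / c1" "enn2real (mass u) \<le> e / c2"
    using c1_pos c2_pos by (simp_all add: field_simps)
  then show "nonlocal u \<le> ennreal (e / c1)" "mass u \<le> ennreal (e / c2)"
    using u by (auto simp: FFS_iff ennreal_enn2real dest!: ennreal_leI)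
qed

lemma energy_ge:
  assumes "u \<in> FFS" "nonlocal u \<le> ennreal a" "mass u \<le> ennreal b" "0 \<le> a" "0 \<le> b"
  shows "ip u u \<le> c1 * a + c2 * b"
proof -
  have "enn2real (nonlocal u) \<le> a" "enn2real (mass u) \<le> b"
    using assms enn2real_mono[of _ "ennreal a"] enn2real_mono[of _ "ennreal b"] by auto
  then show ?thesis
    unfolding ip_energy[OF assms(1)] using c1_pos c2_pos by (intro add_mono mult_left_mono) auto
qed

lemma FFS_add:
  assumes u: "u \<in> FFS" and v: "v \<in> FFS"
  shows "(\<lambda>x. u x + v x) \<in> FFS"
proof -
  note [measurable] = FFS_measurable[OF u] FFS_measurable[OF v]
  have "form_integrand A s m (\<lambda>x. u x + v x) (\<lambda>x. u x + v x) = (\<lambda>z. (form_integrand A s m u u z + form_integrand A s m u v z)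
      + (form_integrand A s m v u z + form_integrand A s m v v z))"
    by (simp add: form_integrand_eq[abs_def] D_add algebra_simps)
  moreover have "(\<lambda>x. (u x + v x) * cnj (u x + v x)) = (\<lambda>x. (u x * cnj (u x) + u x * cnj (v x)) + (v x * cnj (u x) + v x * cnj (v x)))"
    by (simp add: algebra_simps)
  ultimately show ?thesis
    unfolding finite_form_space_def using u v by (simp add: integrable_form integrable_product)
qed

lemma FFS_scale:
  assumes u: "u \<in> FFS"
  shows "(\<lambda>x. c * u x) \<in> FFS"
proof -
  note [measurable] = FFS_measurable[OF u]
  have "form_integrand A s m (\<lambda>x. c * u x) (\<lambda>x. c * u x) = (\<lambda>z. c * cnj c * form_integrand A s m u u z)"
    by (simp add: form_integrand_eq[abs_def] D_scale mult_ac)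
  moreover have "(\<lambda>x. c * u x * cnj (c * u x)) = (\<lambda>x. c * cnj c * (u x * cnj (u x)))"
    by (simp add: mult_ac)
  ultimately show ?thesis
    unfolding finite_form_space_def using u by (simp add: integrable_form integrable_product)
qed

lemma ip_add:
  assumes "u \<in> FFS" "v \<in> FFS" "w \<in> FFS"
  shows "ip (\<lambda>x. u x + v x) w = ip u w + ip v w"
proof -
  have "form_integrand A s m (\<lambda>x. u x + v x) w = (\<lambda>z. form_integrand A s m u w z + form_integrand A s m v w z)"
    by (simp add: form_integrand_eq[abs_def] D_add algebra_simps)
  then have "form_nonlocal A s m (\<lambda>x. u x + v x) w = form_nonlocal A s m u w + form_nonlocal A s m v w"
    unfolding form_nonlocal_def using assms by (simp add: integrable_form)
  moreover have "(\<integral>x. (u x + v x) * cnj (w x) \<partial>lebesgue) = (\<integral>x. u x * cnj (w x) \<partial>lebesgue) + (\<integral>x. v x * cnj (w x) \<partial>lebesgue)"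
    using assms by (simp add: distrib_right integrable_product)
  ultimately show ?thesis by (simp add: ip_eq algebra_simps)
qed

lemma ip_scale: "ip (\<lambda>x. of_real c * u x) v = c * ip u v"
proof -
  have "form_integrand A s m (\<lambda>x. of_real c * u x) v = (\<lambda>z. of_real c * form_integrand A s m u v z)"
    by (simp add: form_integrand_eq[abs_def] D_scale algebra_simps)
  then have "form_nonlocal A s m (\<lambda>x. of_real c * u x) v = c * form_nonlocal A s m u v"
    unfolding form_nonlocal_def by simp
  then show ?thesis by (simp add: ip_eq mult.assoc algebra_simps)
qed

lemma ip_sym: "ip u v = ip v u"
proof -
  have "form_integrand A s m u v = (\<lambda>z. cnj (form_integrand A s m v u z))"
    by (simp add: form_integrand_eq[abs_def] algebra_simps)
  then have "form_nonlocal A s m u v = form_nonlocal A s m v u"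
    unfolding form_nonlocal_def by simp
  moreover have "(\<integral>x. u x * cnj (v x) \<partial>lebesgue) = cnj (\<integral>x. v x * cnj (u x) \<partial>lebesgue)"
    by (subst Bochner_Integration.integral_cnj[symmetric]) (simp add: mult.commute)
  ultimately show ?thesis by (simp add: ip_eq)
qed

lemma ip_nonneg: "u \<in> FFS \<Longrightarrow> 0 \<le> ip u u"
  using c1_pos c2_pos by (simp add: ip_energy)

sublocale FFS: function_hilbert FFS ip
  by unfold_locales (use FFS_add FFS_scale ip_add ip_scale ip_sym ip_nonneg in auto)

lemma null_iff_AE_zero:
  assumes u: "u \<in> FFS" and "ip u u = 0"
  shows "AE x in lebesgue. u x = 0"
proof -
  note [measurable] = FFS_measurable[OF u]
  have "mass u = 0"
    using energy_le(2)[OF u, of 0] assms by simp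
  moreover have "(\<lambda>x. esq (u x)) \<in> borel_measurable lebesgue" by measurable
  ultimately have "AE x in lebesgue. esq (u x) = 0"
    unfolding mass_def by (simp only: nn_integral_0_iff_AE)
  then show ?thesis by eventually_elim (simp add: ennreal_eq_0_iff)
qed

lemma ip_cong_AE:
  assumes "u \<in> FFS" "AE x in lebesgue. u x = u' x" "v \<in> FFS"
  shows "ip u v = ip u' v"
proof -
  have u': "u' \<in> FFS" using assms FFS_cong_AE by blast
  have "form_nonlocal A s m u v = form_nonlocal A s m u' v"
    unfolding form_nonlocal_def
    by (intro arg_cong[of _ _ Re] integral_cong_AE form_integrand_measurable FFS_measurable u' assms
          eventually_mono[OF AE_lebesgue_fst_snd[OF assms(2)]])
       (simp add: form_integrand_eq magnetic_diff_def)
  moreover have "(\<integral>x. u x * cnj (v x) \<partial>lebesgue) = (\<integral>x. u' x * cnj (v x) \<partial>lebesgue)"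
  proof (rule integral_cong_AE)
    note [measurable] = FFS_measurable[OF assms(1)] FFS_measurable[OF u'] FFS_measurable[OF assms(3)]
    show "(\<lambda>x. u x * cnj (v x)) \<in> borel_measurable lebesgue" "(\<lambda>x. u' x * cnj (v x)) \<in> borel_measurable lebesgue"
      by measurable
    show "AE x in lebesgue. u x * cnj (v x) = u' x * cnj (v x)"
      using assms(2) by eventually_elim simp
  qed
  ultimately show ?thesis by (simp add: ip_eq)
qed

text \<open>The Riesz-Fischer argument: a fast subsequence converges almost everywhere, and Fatou's lemma passes to the
limit in both parts of the energy. The limit is described by a formula at every point, so that
pointwise symmetries of the sequence carry over to it.\<close>

lemma form_complete:
  assumes u: "\<And>n. u n \<in> FFS"
    and cauchy: "\<And>e. 0 < e \<Longrightarrow> \<exists>N. \<forall>i\<ge>N. \<forall>j\<ge>N. dist2 (u i) (u j) < e"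
  obtains r l where "strict_mono (r :: nat \<Rightarrow> nat)" "l \<in> FFS"
    "(\<lambda>n. dist2 (u n) l) \<longlonglongrightarrow> 0"
    "\<And>x. l x = (if convergent (\<lambda>n. u (r n) x) then lim (\<lambda>n. u (r n) x) else 0)"
proof -
  have "\<forall>n. \<exists>N. \<forall>i\<ge>N. \<forall>j\<ge>N. dist2 (u i) (u j) < (1 / 4) ^ n"
    using cauchy by simp
  from choice[OF this] obtain f where f: "\<And>n i j. f n \<le> i \<Longrightarrow> f n \<le> j \<Longrightarrow> dist2 (u i) (u j) < (1 / 4) ^ n"
    by blast
  \<comment> \<open>Partial sums dominate \<open>f\<close> and, with \<open>n\<close> added, increase strictly.\<close>
  define r where "r n = (\<Sum>i\<le>n. f i) + n" for n
  have r: "strict_mono r" by (auto simp: strict_mono_Suc_iff r_def)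
  have fr: "f n \<le> r k" if "n \<le> k" for n k
  proof -
    have "f n \<le> (\<Sum>i\<le>k. f i)" using that by (intro member_le_sum) auto
    then show ?thesis by (simp add: r_def)
  qed
  note um [measurable] = FFS_measurable[OF u]
  define l where "l x = (if convergent (\<lambda>n. u (r n) x) then lim (\<lambda>n. u (r n) x) else 0)" for x
  have conv: "AE x in lebesgue. convergent (\<lambda>n. u (r n) x)"
  proof (rule AE_convergent_if_fast_L2)
    show "(\<integral>\<^sup>+x. esq (u (r (Suc n)) x - u (r n) x) \<partial>lebesgue) \<le> ennreal (1 / c2 * (1 / 4) ^ n)" for n
    proof -
      have "ip (\<lambda>x. u (r (Suc n)) x - u (r n) x) (\<lambda>x. u (r (Suc n)) x - u (r n) x) \<le> (1 / 4) ^ n"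
        using f[of n "r (Suc n)" "r n"] fr[of n] by simp
      from energy_le(2)[OF FFS.diff_closed[OF u u] this] show ?thesis
        by (simp add: mass_def)
    qed
  qed (use c2_pos in auto)
  then have lim: "AE x in lebesgue. (\<lambda>n. u (r n) x) \<longlonglongrightarrow> l x"
    by eventually_elim (simp add: l_def convergent_LIMSEQ_iff)
  have lm [measurable]: "l \<in> borel_measurable lebesgue"
  proof -
    have "Measurable.pred lebesgue (\<lambda>x. convergent (\<lambda>n. u (r n) x))"
      unfolding Cauchy_convergent_iff[symmetric] by measurable
    moreover have "(\<lambda>x. lim (\<lambda>n. u (r n) x)) \<in> borel_measurable lebesgue"
      by (rule borel_measurable_lim_metric) measurable
    ultimately show ?thesis unfolding l_def[abs_def] by measurable
  qed
  have key: "(\<lambda>x. u i x - l x) \<in> FFS \<and> dist2 (u i) l \<le> 2 * (1 / 4) ^ n" if i: "f n \<le> i" for n i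
  proof -
    have le: "dist2 (u i) (u (r k)) \<le> (1 / 4) ^ n" if "n \<le> k" for k
      using f[of n i "r k"] fr[OF that] i by simp
    have 1: "nonlocal (\<lambda>x. u i x - l x) \<le> ennreal ((1 / 4) ^ n / c1)"
      unfolding nonlocal_def
    proof (rule nn_integral_fatou_bound)
      show "(\<lambda>z. density (\<lambda>x. u i x - u (r k) x) z) \<in> borel_measurable lebesgue" for k
        by (rule nonlocal_integrand_measurable) measurable
      show "AE z in lebesgue. (\<lambda>k. density (\<lambda>x. u i x - u (r k) x) z)
         \<longlonglongrightarrow> density (\<lambda>x. u i x - l x) z"
        using AE_lebesgue_fst_snd[OF lim]
      proof eventually_elim
        case (elim z)
        then have "(\<lambda>k. D (\<lambda>x. u i x - u (r k) x) (fst z) (snd z)) \<longlonglongrightarrow> D (\<lambda>x. u i x - l x) (fst z) (snd z)"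
          unfolding magnetic_diff_def by (intro tendsto_intros) auto
        then show ?case by (intro tendsto_intros)
      qed
      show "(\<integral>\<^sup>+z. density (\<lambda>x. u i x - u (r k) x) z \<partial>lebesgue) \<le> ennreal ((1 / 4) ^ n / c1)" if "n \<le> k" for k
        using energy_le(1)[OF FFS.diff_closed[OF u u] le[OF that]] by (simp add: nonlocal_def)
    qed
    have 2: "mass (\<lambda>x. u i x - l x) \<le> ennreal ((1 / 4) ^ n / c2)"
      unfolding mass_def
    proof (rule nn_integral_fatou_bound)
      show "AE x in lebesgue. (\<lambda>k. esq (u i x - u (r k) x)) \<longlonglongrightarrow> esq (u i x - l x)"
        using lim by eventually_elim (intro tendsto_intros)
      show "(\<integral>\<^sup>+x. esq (u i x - u (r k) x) \<partial>lebesgue) \<le> ennreal ((1 / 4) ^ n / c2)" if "n \<le> k" for k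
        using energy_le(2)[OF FFS.diff_closed[OF u u] le[OF that]] by (simp add: mass_def)
    qed measurable
    have "(\<lambda>x. u i x - l x) \<in> FFS"
      using le_less_trans[OF 1] le_less_trans[OF 2] by (simp add: FFS_iff)
    from this energy_ge[OF this 1 2] show ?thesis
      using c1_pos c2_pos by simp
  qed
  have lF: "l \<in> FFS"
    using FFS.diff_closed[OF u[of "f 0"] conjunct1[OF key[of 0 "f 0"]]] by simp
  have "(\<lambda>n. dist2 (u n) l) \<longlonglongrightarrow> 0"
  proof (rule LIMSEQ_I)
    fix e :: real assume "0 < e"
    then obtain n where "(1 / 4) ^ n < e / 2"
      using real_arch_pow_inv[of "e / 2" "1 / 4"] by auto
    then have "norm (dist2 (u i) l - 0) < e" if "f n \<le> i" for i
      using key[OF that] ip_nonneg[of "\<lambda>x. u i x - l x"] by simp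
    then show "\<exists>N. \<forall>i\<ge>N. norm (dist2 (u i) l - 0) < e" by blast
  qed
  with r lF l_def that show ?thesis by blast
qed

end

section \<open>Level sets and large values\<close>

definition ball_vol :: real where "ball_vol = unit_ball_vol 3"

lemma ball_vol_pos: "0 < ball_vol"
  by (simp add: ball_vol_def)

lemma emeasure_ball_R3: "0 \<le> r \<Longrightarrow> emeasure lborel (ball (x :: R3) r) = ennreal (ball_vol * r ^ 3)"
  by (subst emeasure_ball) (simp_all add: ball_vol_def)

text \<open>The exponent \<open>q\<close> solves \<open>q = 2 + \<theta> * q\<close>, so the bound \<open>M * 2 powr (- q * j)\<close> reproduces itself under the
recursion as soon as \<open>K * 2 powr q * M powr \<theta> \<le> M\<close>. For \<open>\<theta> = 2 * s / 3\<close> it is the critical Sobolev exponent.\<close>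

lemma level_recursion_decay:
  fixes \<theta> K T :: real
  assumes \<theta>: "0 < \<theta>" "\<theta> < 1" and K: "0 \<le> K"
  defines "q \<equiv> 2 / (1 - \<theta>)"
  obtains M where "0 \<le> M" "\<And>b :: nat \<Rightarrow> real. (\<And>j. 0 \<le> b j) \<Longrightarrow> b 0 \<le> T \<Longrightarrow>
     (\<And>j. b (Suc j) \<le> K * (1 / 4) ^ j * b j powr \<theta>) \<Longrightarrow> (\<And>j. b j \<le> M * 2 powr (- q * real j))"
proof -
  define K' where "K' = K * 2 powr q + 1"
  define M where "M = max T (K' powr (1 / (1 - \<theta>)))"
  have K': "1 \<le> K'" using K by (simp add: K'_def)
  have M: "0 < M" using K' by (simp add: M_def less_max_iff_disj)
  have "(K' powr (1 / (1 - \<theta>))) powr (1 - \<theta>) \<le> M powr (1 - \<theta>)"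
    using \<theta> by (intro powr_mono2) (auto simp: M_def)
  then have "K' \<le> M powr (1 - \<theta>)" using K' \<theta> by (simp add: powr_powr)
  then have "K * 2 powr q \<le> M powr (1 - \<theta>)" by (simp add: K'_def)
  then have "K * 2 powr q * M powr \<theta> \<le> M powr (1 - \<theta>) * M powr \<theta>"
    by (intro mult_right_mono) auto
  also have "\<dots> = M" using M by (simp add: powr_add[symmetric])
  finally have MK: "K * 2 powr q * M powr \<theta> \<le> M" .
  have qe: "2 + q * \<theta> = q" using \<theta> by (simp add: q_def field_simps)
  show ?thesis
  proof (rule that[of M])
    fix b :: "nat \<Rightarrow> real" and j
    assume b: "\<And>j. 0 \<le> b j" "b 0 \<le> T" "\<And>j. b (Suc j) \<le> K * (1 / 4) ^ j * b j powr \<theta>"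
    show "b j \<le> M * 2 powr (- q * real j)"
    proof (induction j)
      case 0 then show ?case using b(2) by (simp add: M_def le_max_iff_disj)
    next
      case (Suc j)
      have "b j powr \<theta> \<le> (M * 2 powr (- q * real j)) powr \<theta>"
        using b(1) \<theta> Suc by (intro powr_mono2) auto
      also have "\<dots> = M powr \<theta> * 2 powr (- q * \<theta> * real j)"
        using M by (simp add: powr_mult powr_powr mult_ac)
      finally have "b (Suc j) \<le> K * (1 / 4) ^ j * (M powr \<theta> * 2 powr (- q * \<theta> * real j))"
        using b(3)[of j] K by (meson mult_left_mono mult_nonneg_nonneg order_trans zero_le_divide_1_iff zero_le_numeral zero_le_power)
      also have "(1 / 4 :: real) ^ j = 2 powr (- 2 * real j)"
      proof -
        have "(1 / 4 :: real) = 2 powr (- 2)" by (simp add: powr_minus_divide)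
        then have "(1 / 4 :: real) ^ j = (2 powr (- 2)) powr real j" by (simp only: powr_realpow[of "2 powr (- 2)"] powr_gt_zero)
        then show ?thesis by (simp only: powr_powr)
      qed
      also have "K * 2 powr (- 2 * real j) * (M powr \<theta> * 2 powr (- q * \<theta> * real j)) = (K * 2 powr q * M powr \<theta>) * 2 powr (- q * real (Suc j))"
      proof -
        have "2 powr (- 2 * real j) * 2 powr (- q * \<theta> * real j) = 2 powr q * (2 powr (- q * real (Suc j)) :: real)"
        proof -
          have "- 2 * real j + - q * \<theta> * real j = - (2 + q * \<theta>) * real j" by (simp add: algebra_simps)
          also have "\<dots> = q + - q * real (Suc j)" unfolding qe by (simp add: algebra_simps)
          finally show ?thesis by (simp only: powr_add[symmetric])
        qed
        then show ?thesis by (simp add: mult_ac)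
      qed
      also have "\<dots> \<le> M * 2 powr (- q * real (Suc j))"
        using MK by (intro mult_right_mono) auto
      finally show ?case .
    qed
  qed (use M in simp)
qed

context magnetic begin

text \<open>The phase factor has modulus 1.\<close>

lemma diamagnetic: "\<bar>cmod (u x) - cmod (u y)\<bar> \<le> cmod (D u x y)"
proof -
  have "cmod (exp (- (\<i> * of_real ((x - y) \<bullet> A (midpoint x y)))) * u x) = cmod (u x)"
    by (simp add: norm_mult norm_exp_eq_Re)
  then show ?thesis
    unfolding magnetic_diff_def by (metis norm_triangle_ineq3)
qed

lemma D_diag: "D u x x = 0"
  by (simp add: magnetic_diff_def)

lemma nonlocal_iterated:
  assumes [measurable]: "u \<in> borel_measurable borel"
  shows "nonlocal u = (\<integral>\<^sup>+x. \<integral>\<^sup>+y. ennreal ((cmod (D u x y))\<^sup>2 * \<kappa> (x - y)) \<partial>lborel \<partial>lborel)"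
proof -
  note [measurable] = D_borel_measurable[OF assms] \<kappa>_measurable_borel
  have "nonlocal u = (\<integral>\<^sup>+z. density u z \<partial>(lborel \<Otimes>\<^sub>M lborel))"
    unfolding nonlocal_def nn_integral_completion lborel_prod ..
  also have "\<dots> = (\<integral>\<^sup>+x. \<integral>\<^sup>+y. ennreal ((cmod (D u x y))\<^sup>2 * \<kappa> (x - y)) \<partial>lborel \<partial>lborel)"
    by (subst lborel.nn_integral_fst[symmetric]) simp_all
  finally show ?thesis .
qed

lemma D_borel_measurable2 [measurable (raw)]:
  assumes u: "u \<in> borel_measurable borel" and [measurable]: "f \<in> M \<rightarrow>\<^sub>M borel" "g \<in> M \<rightarrow>\<^sub>M borel"
  shows "(\<lambda>z. D u (f z) (g z)) \<in> borel_measurable M"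
  using measurable_compose[OF _ D_borel_measurable[OF u], of "\<lambda>z. (f z, g z)" M] by simp

text \<open>At distance less than \<open>r\<close> the kernel is at least a multiple of \<open>r powr (- (3 + 2 * s))\<close>. On the diagonal,
where the kernel is not controlled, the magnetic difference vanishes.\<close>

lemma near_diagonal_energy:
  assumes "0 < \<rho>"
  obtains C where "0 < C" "\<And>u r. u \<in> borel_measurable borel \<Longrightarrow> 0 < r \<Longrightarrow> r \<le> \<rho> \<Longrightarrow>
    (\<integral>\<^sup>+x. (\<integral>\<^sup>+y\<in>ball x r. esq (D u x y) \<partial>lborel) \<partial>lborel) \<le> ennreal (C * r powr (3 + 2 * s)) * nonlocal u"
proof -
  obtain c where c: "0 < c" "\<And>z r. z \<noteq> 0 \<Longrightarrow> norm z < r \<Longrightarrow> r \<le> \<rho> \<Longrightarrow> c * r powr (- (3 + 2 * s)) \<le> \<kappa> z"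
    using bessel_kernel_lower[OF s_pos m_pos assms] by metis
  show ?thesis
  proof (rule that[of "1 / c"])
    fix u :: "R3 \<Rightarrow> complex" and r assume u [measurable]: "u \<in> borel_measurable borel" and r: "0 < r" "r \<le> \<rho>"
    have "esq (D u x y) * indicator (ball x r) y \<le> ennreal (1 / c * r powr (3 + 2 * s)) * ennreal ((cmod (D u x y))\<^sup>2 * \<kappa> (x - y))" for x y
    proof (cases "y \<in> ball x r \<and> x \<noteq> y")
      case False then show ?thesis by (auto simp: D_diag)
    next
      case True
      have "c * r powr (- (3 + 2 * s)) \<le> \<kappa> (x - y)"
        using True r by (intro c(2)) (auto simp: dist_norm)
      then have "1 \<le> 1 / c * r powr (3 + 2 * s) * \<kappa> (x - y)"
        using c(1) r unfolding powr_minus_divide by (simp add: field_simps)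
      then have "(cmod (D u x y))\<^sup>2 * 1 \<le> (cmod (D u x y))\<^sup>2 * (1 / c * r powr (3 + 2 * s) * \<kappa> (x - y))"
        by (rule mult_left_mono) simp
      then have "esq (D u x y) \<le> ennreal ((1 / c * r powr (3 + 2 * s)) * ((cmod (D u x y))\<^sup>2 * \<kappa> (x - y)))"
        by (intro ennreal_leI) (simp add: mult_ac)
      also have "\<dots> = ennreal (1 / c * r powr (3 + 2 * s)) * ennreal ((cmod (D u x y))\<^sup>2 * \<kappa> (x - y))"
        using c(1) by (intro ennreal_mult') simp
      finally show ?thesis using True by simp
    qed
    then have "(\<integral>\<^sup>+x. (\<integral>\<^sup>+y\<in>ball x r. esq (D u x y) \<partial>lborel) \<partial>lborel)
       \<le> (\<integral>\<^sup>+x. \<integral>\<^sup>+y. ennreal (1 / c * r powr (3 + 2 * s)) * ennreal ((cmod (D u x y))\<^sup>2 * \<kappa> (x - y)) \<partial>lborel \<partial>lborel)"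
      by (intro nn_integral_mono)
    also have "\<dots> = ennreal (1 / c * r powr (3 + 2 * s)) * nonlocal u"
      unfolding nonlocal_iterated[OF u] by (simp add: nn_integral_cmult)
    finally show "(\<integral>\<^sup>+x. (\<integral>\<^sup>+y\<in>ball x r. esq (D u x y) \<partial>lborel) \<partial>lborel) \<le> ennreal (1 / c * r powr (3 + 2 * s)) * nonlocal u" .
  qed (use c in simp)
qed

lemma mass_borel: "mass u = (\<integral>\<^sup>+x. esq (u x) \<partial>lborel)"
  unfolding mass_def nn_integral_completion ..

text \<open>Around a point of \<open>G\<close> at least half of the ball consists of points \<open>y\<close> with \<open>|u y| \<le> \<mu>\<close>, and there
\<open>|D u x y| \<ge> |u x| - |u y| \<ge> |u x| / 2\<close>. The volume \<open>r ^ 3\<close> of the ball cancels against \<open>r powr (3 + 2 * s)\<close> from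
\<open>near_diagonal_energy\<close>.\<close>

lemma sparse_level_set_bound:
  assumes "0 < \<rho>"
  obtains C where "0 < C" "\<And>u r \<mu> G. u \<in> borel_measurable borel \<Longrightarrow> 0 < r \<Longrightarrow> r \<le> \<rho> \<Longrightarrow> 0 \<le> \<mu> \<Longrightarrow> G \<in> sets borel \<Longrightarrow>
     (\<And>x. x \<in> G \<Longrightarrow> 2 * \<mu> < cmod (u x)) \<Longrightarrow>
     (\<And>x. x \<in> G \<Longrightarrow> emeasure lborel (ball x r \<inter> {y. \<mu> < cmod (u y)}) \<le> ennreal (ball_vol * r ^ 3 / 2)) \<Longrightarrow>
     (\<integral>\<^sup>+x\<in>G. esq (u x) \<partial>lborel) \<le> ennreal (C * r powr (2 * s)) * nonlocal u"
proof -
  obtain C where C: "0 < C" "\<And>u r. u \<in> borel_measurable borel \<Longrightarrow> 0 < r \<Longrightarrow> r \<le> \<rho> \<Longrightarrow>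
    (\<integral>\<^sup>+x. (\<integral>\<^sup>+y\<in>ball x r. esq (D u x y) \<partial>lborel) \<partial>lborel) \<le> ennreal (C * r powr (3 + 2 * s)) * nonlocal u"
    using near_diagonal_energy[OF assms] by blast
  show ?thesis
  proof (rule that[of "C * 8 / ball_vol"])
    fix u :: "R3 \<Rightarrow> complex" and r \<mu> :: real and G
    assume u [measurable]: "u \<in> borel_measurable borel" and r: "0 < r" "r \<le> \<rho>" and \<mu>: "0 \<le> \<mu>"
      and G [measurable]: "G \<in> sets borel"
      and big: "\<And>x. x \<in> G \<Longrightarrow> 2 * \<mu> < cmod (u x)"
      and sparse: "\<And>x. x \<in> G \<Longrightarrow> emeasure lborel (ball x r \<inter> {y. \<mu> < cmod (u y)}) \<le> ennreal (ball_vol * r ^ 3 / 2)"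
    let ?b = "ball_vol * r ^ 3"
    have b: "0 < ?b" using ball_vol_pos r by simp
    have pt: "ennreal (?b / 8) * (esq (u x) * indicator G x) \<le> (\<integral>\<^sup>+y\<in>ball x r. esq (D u x y) \<partial>lborel)" for x
    proof (cases "x \<in> G")
      case False then show ?thesis by simp
    next
      case True
      let ?L = "ball x r \<inter> {y. cmod (u y) \<le> \<mu>}" and ?U = "ball x r \<inter> {y. \<mu> < cmod (u y)}"
      have [measurable]: "?L \<in> sets borel" "?U \<in> sets borel" by measurable
      have half: "ennreal (?b / 2) \<le> emeasure lborel ?L"
      proof -
        have "?L \<union> ?U = ball x r" by auto
        then have sum: "emeasure lborel ?L + emeasure lborel ?U = ennreal ?b"
          using r emeasure_ball_R3[of r x] by (subst plus_emeasure) auto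
        have "ennreal (?b / 2) + ennreal (?b / 2) = ennreal ?b"
          using b by (subst ennreal_plus[symmetric]) auto
        also have "\<dots> \<le> emeasure lborel ?L + ennreal (?b / 2)"
          unfolding sum[symmetric] using sparse[OF True] by (intro add_left_mono)
        finally show ?thesis
          by (simp add: ennreal_add_left_cancel_le add.commute)
      qed
      have "ennreal (?b / 8) * esq (u x) = ennreal ((cmod (u x))\<^sup>2 / 4) * ennreal (?b / 2)"
        using b by (subst (1 2) ennreal_mult'[symmetric]) (auto simp: field_simps)
      also have "\<dots> \<le> ennreal ((cmod (u x))\<^sup>2 / 4) * emeasure lborel ?L"
        by (intro mult_left_mono half) simp
      also have "\<dots> = (\<integral>\<^sup>+y\<in>?L. ennreal ((cmod (u x))\<^sup>2 / 4) \<partial>lborel)"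
        by (subst nn_integral_cmult_indicator) auto
      also have "\<dots> \<le> (\<integral>\<^sup>+y\<in>ball x r. esq (D u x y) \<partial>lborel)"
      proof (intro nn_integral_mono)
        fix y
        have "(cmod (u x))\<^sup>2 / 4 \<le> (cmod (D u x y))\<^sup>2" if "y \<in> ?L"
        proof -
          have "cmod (u x) / 2 \<le> cmod (D u x y)"
            using diamagnetic[of u x y] big[OF True] that by auto
          then have "(cmod (u x) / 2)\<^sup>2 \<le> (cmod (D u x y))\<^sup>2"
            by (intro power_mono) auto
          then show ?thesis by (simp add: power_divide)
        qed
        then show "ennreal ((cmod (u x))\<^sup>2 / 4) * indicator ?L y \<le> esq (D u x y) * indicator (ball x r) y"
          by (auto simp: indicator_def intro!: ennreal_leI)
      qed
      finally show ?thesis using True by simp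
    qed
    have "ennreal (?b / 8) * (\<integral>\<^sup>+x\<in>G. esq (u x) \<partial>lborel)
       = (\<integral>\<^sup>+x. ennreal (?b / 8) * (esq (u x) * indicator G x) \<partial>lborel)"
      by (rule nn_integral_cmult[symmetric]) measurable
    also have "\<dots> \<le> (\<integral>\<^sup>+x. (\<integral>\<^sup>+y\<in>ball x r. esq (D u x y) \<partial>lborel) \<partial>lborel)"
      by (intro nn_integral_mono pt)
    also have "\<dots> \<le> ennreal (C * r powr (3 + 2 * s)) * nonlocal u"
      by (rule C(2)[OF u r])
    finally have le: "ennreal (?b / 8) * (\<integral>\<^sup>+x\<in>G. esq (u x) \<partial>lborel) \<le> ennreal (C * r powr (3 + 2 * s)) * nonlocal u" .
    have "C * r powr (3 + 2 * s) / (?b / 8) = C * 8 / ball_vol * r powr (2 * s)"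
    proof -
      have "r powr (3 + 2 * s) = r ^ 3 * r powr (2 * s)"
        using r by (simp add: powr_add)
      then show ?thesis using r ball_vol_pos by (simp add: field_simps)
    qed
    with ennreal_le_divideI[OF _ _ le] b C(1)
    show "(\<integral>\<^sup>+x\<in>G. esq (u x) \<partial>lborel) \<le> ennreal (C * 8 / ball_vol * r powr (2 * s)) * nonlocal u"
      by simp
  qed (use C ball_vol_pos in simp)
qed

lemma chebyshev_mass:
  assumes [measurable]: "u \<in> borel_measurable borel" and "0 < \<mu>"
  shows "ennreal (\<mu>\<^sup>2) * emeasure lborel {x. \<mu> < cmod (u x)} \<le> mass u"
proof -
  have "ennreal (\<mu>\<^sup>2) * emeasure lborel {x. \<mu> < cmod (u x)} = (\<integral>\<^sup>+x. ennreal (\<mu>\<^sup>2) * indicator {x. \<mu> < cmod (u x)} x \<partial>lborel)"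
    by (subst nn_integral_cmult_indicator) auto
  also have "\<dots> \<le> mass u"
    unfolding mass_borel using assms(2)
    by (intro nn_integral_mono) (auto simp: indicator_def intro!: ennreal_leI power_mono)
  finally show ?thesis .
qed

text \<open>The radius is chosen so that the ball has twice the volume of \<open>{|u| > 2 ^ j}\<close>. Then that set is sparse in
every ball of this radius, and \<open>sparse_level_set_bound\<close> together with Chebyshev's inequality yields the recursion of
\<open>level_recursion_decay\<close>.\<close>

lemma level_sets_decay:
  fixes T :: real
  assumes T: "0 < T"
  obtains M where "0 \<le> M" "\<And>u j. u \<in> borel_measurable borel \<Longrightarrow> nonlocal u \<le> ennreal T \<Longrightarrow> mass u \<le> ennreal T \<Longrightarrow>
     emeasure lborel {x. 2 ^ j < cmod (u x)} \<le> ennreal (M * 2 powr (- (6 / (3 - 2 * s)) * real j))"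
proof -
  \<comment> \<open>A ball of this radius has volume \<open>2 * T\<close>, and no level set that occurs has measure above \<open>T\<close>.\<close>
  define \<rho> where "\<rho> = (2 * T / ball_vol) powr (1 / 3)"
  have \<rho>: "0 < \<rho>" using T ball_vol_pos by (simp add: \<rho>_def)
  obtain C where C: "0 < C" "\<And>u r \<mu> G. u \<in> borel_measurable borel \<Longrightarrow> 0 < r \<Longrightarrow> r \<le> \<rho> \<Longrightarrow> 0 \<le> \<mu> \<Longrightarrow> G \<in> sets borel \<Longrightarrow>
     (\<And>x. x \<in> G \<Longrightarrow> 2 * \<mu> < cmod (u x)) \<Longrightarrow>
     (\<And>x. x \<in> G \<Longrightarrow> emeasure lborel (ball x r \<inter> {y. \<mu> < cmod (u y)}) \<le> ennreal (ball_vol * r ^ 3 / 2)) \<Longrightarrow>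
     (\<integral>\<^sup>+x\<in>G. esq (u x) \<partial>lborel) \<le> ennreal (C * r powr (2 * s)) * nonlocal u"
    using sparse_level_set_bound[OF \<rho>] by blast
  define \<theta> where "\<theta> = 2 * s / 3"
  define K where "K = C * (2 / ball_vol) powr \<theta> * T / 4"
  have \<theta>: "0 < \<theta>" "\<theta> < 1" using s_pos s_less_1 by (auto simp: \<theta>_def)
  have K: "0 \<le> K" using C(1) T by (simp add: K_def)
  have q: "2 / (1 - \<theta>) = 6 / (3 - 2 * s)" using s_less_1 by (simp add: \<theta>_def field_simps)
  obtain M where M: "0 \<le> M" "\<And>b :: nat \<Rightarrow> real. \<And>j. (\<And>j. 0 \<le> b j) \<Longrightarrow> b 0 \<le> T \<Longrightarrow>
     (\<And>j. b (Suc j) \<le> K * (1 / 4) ^ j * b j powr \<theta>) \<Longrightarrow> b j \<le> M * 2 powr (- (6 / (3 - 2 * s)) * real j)"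
    using level_recursion_decay[OF \<theta> K, of T] unfolding q by blast
  show ?thesis
  proof (rule that[of M])
    fix u :: "R3 \<Rightarrow> complex" and j
    assume u [measurable]: "u \<in> borel_measurable borel" and nl: "nonlocal u \<le> ennreal T" and ms: "mass u \<le> ennreal T"
    define S where "S j = {x. 2 ^ j < cmod (u x)}" for j :: nat
    have [measurable]: "S j \<in> sets borel" for j unfolding S_def by measurable
    define b where "b j = measure lborel (S j)" for j
    have cheb: "ennreal (4 ^ j) * emeasure lborel (S j) \<le> ennreal T" for j
      using order_trans[OF chebyshev_mass[OF u, of "2 ^ j"] ms] by (simp add: S_def power_mult[symmetric] mult.commute[of j] power_mult)
    have fin: "emeasure lborel (S j) < \<infinity>" for j
    proof (rule ccontr)
      assume "\<not> emeasure lborel (S j) < \<infinity>"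
      then have "emeasure lborel (S j) = \<infinity>" by (simp only: less_top[symmetric] not_not infinity_ennreal_def)
      then show False using cheb[of j] by (simp add: ennreal_mult_top top_unique)
    qed
    then have em: "emeasure lborel (S j) = ennreal (b j)" for j
      using fin[of j] by (subst emeasure_eq_ennreal_measure) (auto simp: b_def less_top)
    have b_nonneg: "0 \<le> b j" for j by (simp add: b_def)
    have b_le: "b j \<le> T" for j
    proof -
      have "4 ^ j * b j \<le> T" using cheb[of j] b_nonneg T unfolding em by (simp add: ennreal_mult'[symmetric])
      moreover have "1 * b j \<le> 4 ^ j * b j" by (intro mult_right_mono b_nonneg) simp
      ultimately show ?thesis by simp
    qed
    have rec: "b (Suc j) \<le> K * (1 / 4) ^ j * b j powr \<theta>" for j
    proof (cases "b j = 0")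
      case True
      have "S (Suc j) \<subseteq> S j"
      proof
        fix x assume "x \<in> S (Suc j)"
        moreover have "(2 :: real) ^ j \<le> 2 ^ Suc j" by simp
        ultimately show "x \<in> S j" unfolding S_def mem_Collect_eq by linarith
      qed
      then have "b (Suc j) \<le> b j"
        unfolding b_def using fin[of j] by (intro measure_mono_fmeasurable) (auto simp: fmeasurable_def)
      then show ?thesis using True b_nonneg[of "Suc j"] by simp
    next
      case False
      then have bj: "0 < b j" using b_nonneg[of j] by simp
      define r where "r = (2 * b j / ball_vol) powr (1 / 3)"
      have r: "0 < r" using bj ball_vol_pos by (simp add: r_def)
      have r3: "r ^ 3 = 2 * b j / ball_vol"
        using bj ball_vol_pos by (simp add: r_def powr_power)
      have "r \<le> \<rho>"
        unfolding r_def \<rho>_def using b_le[of j] b_nonneg[of j] ball_vol_pos 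
        by (intro powr_mono2 divide_right_mono) auto
      have "(\<integral>\<^sup>+x\<in>(S (Suc j)). esq (u x) \<partial>lborel) \<le> ennreal (C * r powr (2 * s)) * nonlocal u"
      proof (rule C(2)[OF u r \<open>r \<le> \<rho>\<close>, of "2 ^ j"])
        fix x assume "x \<in> S (Suc j)"
        show "emeasure lborel (ball x r \<inter> {y. 2 ^ j < cmod (u y)}) \<le> ennreal (ball_vol * r ^ 3 / 2)"
        proof -
          have "emeasure lborel (ball x r \<inter> {y. 2 ^ j < cmod (u y)}) \<le> emeasure lborel (S j)"
            by (intro emeasure_mono) (auto simp: S_def)
          also have "\<dots> = ennreal (ball_vol * r ^ 3 / 2)"
            using ball_vol_pos by (simp add: em r3)
          finally show ?thesis .
        qed
      qed (auto simp: S_def)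
      also have "\<dots> \<le> ennreal (C * r powr (2 * s)) * ennreal T"
        by (intro mult_left_mono nl) simp
      also have "\<dots> = ennreal (C * r powr (2 * s) * T)"
        using C(1) by (intro ennreal_mult'[symmetric]) simp
      also have "r powr (2 * s) = (2 / ball_vol) powr \<theta> * b j powr \<theta>"
      proof -
        have "r powr (2 * s) = (2 / ball_vol * b j) powr \<theta>"
          by (simp add: r_def powr_powr \<theta>_def)
        then show ?thesis by (simp only: powr_mult)
      qed
      finally have 1: "(\<integral>\<^sup>+x\<in>(S (Suc j)). esq (u x) \<partial>lborel) \<le> ennreal (4 * K * b j powr \<theta>)"
        by (simp add: K_def mult_ac)
      have "ennreal (4 ^ Suc j) * ennreal (b (Suc j)) = (\<integral>\<^sup>+x\<in>(S (Suc j)). ennreal (4 ^ Suc j) \<partial>lborel)"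
        by (subst nn_integral_cmult_indicator) (auto simp: em)
      also have "\<dots> \<le> (\<integral>\<^sup>+x\<in>(S (Suc j)). esq (u x) \<partial>lborel)"
      proof (intro nn_integral_mono)
        fix x
        have "4 ^ Suc j \<le> (cmod (u x))\<^sup>2" if "x \<in> S (Suc j)"
        proof -
          have "(2 ^ Suc j)\<^sup>2 \<le> (cmod (u x))\<^sup>2"
            using that by (intro power_mono) (auto simp: S_def)
          moreover have "(2 ^ Suc j)\<^sup>2 = (4 ^ Suc j :: real)"
            by (simp only: power2_eq_square power_mult_distrib[symmetric]) simp
          ultimately show ?thesis by simp
        qed
        then show "ennreal (4 ^ Suc j) * indicator (S (Suc j)) x \<le> esq (u x) * indicator (S (Suc j)) x"
          by (auto simp: indicator_def intro!: ennreal_leI)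
      qed
      also note 1
      finally have "ennreal (4 ^ Suc j * b (Suc j)) \<le> ennreal (4 * K * b j powr \<theta>)"
        using b_nonneg by (simp add: ennreal_mult')
      then have "4 ^ Suc j * b (Suc j) \<le> 4 * K * b j powr \<theta>"
        using K by (subst (asm) ennreal_le_iff) auto
      then have "4 ^ j * b (Suc j) \<le> K * b j powr \<theta>" by simp
      then show ?thesis by (simp add: power_divide field_simps)
    qed
    have "b j \<le> M * 2 powr (- (6 / (3 - 2 * s)) * real j)"
      by (rule M(2)[OF b_nonneg b_le rec])
    then show "emeasure lborel {x. 2 ^ j < cmod (u x)} \<le> ennreal (M * 2 powr (- (6 / (3 - 2 * s)) * real j))"
      using em[of j] by (simp add: S_def ennreal_leI)
  qed (rule M(1))
qed

lemma ennreal_le_suminf: "f i \<le> (\<Sum>i. f i)" for f :: "nat \<Rightarrow> ennreal"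
  using sum_le_suminf[of f "{i}"] by simp

text \<open>A dyadic majorant: a value \<open>a\<close> above \<open>2 ^ J\<close> lies between two consecutive powers of 2, and the corresponding
term of the series is already at least \<open>a powr p\<close>.\<close>

lemma power_tail_series:
  fixes p a :: real
  assumes "0 < p" "0 \<le> a"
  shows "ennreal (a powr p) * indicator {2 ^ J<..} a \<le> (\<Sum>i. ennreal (2 powr (p * (real (J + i) + 1))) * indicator {2 ^ (J + i)<..} a)"
proof (cases "2 ^ J < a")
  case False then show ?thesis by simp
next
  case True
  obtain n where "a \<le> 2 ^ n" using real_arch_pow[of 2 a] by (auto intro: less_imp_le)
  then have ex: "\<exists>i. a \<le> 2 ^ (J + i + 1)"
    by (intro exI[of _ n]) (rule order_trans, assumption, rule power_increasing, auto)
  define i where "i = (LEAST i. a \<le> 2 ^ (J + i + 1))"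
  have up: "a \<le> 2 ^ (J + i + 1)" unfolding i_def using ex by (rule LeastI_ex)
  have low: "2 ^ (J + i) < a"
  proof (cases i)
    case 0 then show ?thesis using True by simp
  next
    case (Suc k)
    then have "\<not> a \<le> 2 ^ (J + k + 1)"
      unfolding i_def using not_less_Least[of k "\<lambda>i. a \<le> 2 ^ (J + i + 1)"] by simp
    then show ?thesis using Suc by simp
  qed
  have "a powr p \<le> (2 ^ (J + i + 1)) powr p"
    using assms up by (intro powr_mono2) auto
  also have "\<dots> = 2 powr (p * (real (J + i) + 1))"
    by (subst powr_realpow[symmetric]) (simp_all add: powr_powr mult.commute add_ac)
  finally have "ennreal (a powr p) * indicator {2 ^ J<..} a \<le> ennreal (2 powr (p * (real (J + i) + 1))) * indicator {2 ^ (J + i)<..} a"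
    using low True by (simp add: ennreal_leI)
  also have "\<dots> \<le> (\<Sum>i. ennreal (2 powr (p * (real (J + i) + 1))) * indicator {2 ^ (J + i)<..} a)"
    by (rule ennreal_le_suminf)
  finally show ?thesis .
qed

lemma unit_ball_bound:
  obtains T where "0 < T" "\<And>u. u \<in> FFS \<Longrightarrow> ip u u \<le> 1 \<Longrightarrow> nonlocal u \<le> ennreal T \<and> mass u \<le> ennreal T"
proof (rule that[of "max (1 / c1) (1 / c2)"])
  fix u assume "u \<in> FFS" "ip u u \<le> 1"
  from energy_le[OF this] have "nonlocal u \<le> ennreal (1 / c1)" "mass u \<le> ennreal (1 / c2)" .
  moreover have "ennreal (1 / c1) \<le> ennreal (max (1 / c1) (1 / c2))" "ennreal (1 / c2) \<le> ennreal (max (1 / c1) (1 / c2))"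
    by (intro ennreal_leI; simp)+
  ultimately show "nonlocal u \<le> ennreal (max (1 / c1) (1 / c2)) \<and> mass u \<le> ennreal (max (1 / c1) (1 / c2))"
    by (meson order_trans)
qed (use c1_pos in \<open>simp add: less_max_iff_disj\<close>)

abbreviation upper_tail :: "real \<Rightarrow> real \<Rightarrow> (R3 \<Rightarrow> complex) \<Rightarrow> ennreal" where
  "upper_tail p \<Lambda> u \<equiv> (\<integral>\<^sup>+x. ennreal (cmod (u x) powr p) * indicator {\<Lambda><..} (cmod (u x)) \<partial>lebesgue)"

abbreviation outer_tail :: "real \<Rightarrow> real \<Rightarrow> (R3 \<Rightarrow> complex) \<Rightarrow> ennreal" where
  "outer_tail p b u \<equiv> (\<integral>\<^sup>+x\<in>{x. b \<le> norm x}. ennreal (cmod (u x) powr p) \<partial>lebesgue)"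

text \<open>The subcritical Sobolev embedding in a form that excludes concentration. The dyadic series is geometric
with ratio \<open>2 powr (p - 6 / (3 - 2 * s))\<close>.\<close>

lemma uniform_tail:
  fixes p \<epsilon> :: real
  assumes p: "2 < p" "p < 6 / (3 - 2 * s)" and \<epsilon>: "0 < \<epsilon>"
  obtains \<Lambda> where "1 \<le> \<Lambda>" "\<And>u. u \<in> FFS \<Longrightarrow> ip u u \<le> 1 \<Longrightarrow>
    upper_tail p \<Lambda> u \<le> ennreal \<epsilon>"
proof -
  obtain T where T: "0 < T" "\<And>u. u \<in> FFS \<Longrightarrow> ip u u \<le> 1 \<Longrightarrow> nonlocal u \<le> ennreal T \<and> mass u \<le> ennreal T"
    using unit_ball_bound by blast
  obtain M where M: "0 \<le> M" "\<And>u j. u \<in> borel_measurable borel \<Longrightarrow> nonlocal u \<le> ennreal T \<Longrightarrow> mass u \<le> ennreal T \<Longrightarrow>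
     emeasure lborel {x. 2 ^ j < cmod (u x)} \<le> ennreal (M * 2 powr (- (6 / (3 - 2 * s)) * real j))"
    using level_sets_decay[OF T(1)] by blast
  define \<delta> where "\<delta> = 6 / (3 - 2 * s) - p"
  have \<delta>: "0 < \<delta>" using p by (simp add: \<delta>_def)
  define z where "z = (2 :: real) powr (- \<delta>)"
  have z: "0 < z" "z < 1" using \<delta> by (auto simp: z_def powr_less_one)
  define B where "B = M * 2 powr p / (1 - z)"
  have B: "0 \<le> B" using M(1) z by (simp add: B_def)
  have "(\<lambda>J. B * z ^ J) \<longlonglongrightarrow> B * 0"
    using z by (intro tendsto_mult tendsto_const LIMSEQ_power_zero) auto
  then have "\<forall>\<^sub>F J in sequentially. B * z ^ J < \<epsilon>"
    using \<epsilon> by (intro order_tendstoD(2)) auto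
  then obtain J where J: "B * z ^ J < \<epsilon>" by (auto simp: eventually_sequentially)
  show ?thesis
  proof (rule that[of "2 ^ J"])
    fix u assume u: "u \<in> FFS" "ip u u \<le> 1"
    obtain u' where u' [measurable]: "u' \<in> borel_measurable borel" and ae: "AE x in lebesgue. u x = u' x"
      using borel_representative[OF FFS_measurable[OF u(1)]] .
    have nm: "nonlocal u' \<le> ennreal T" "mass u' \<le> ennreal T"
      using T(2)[OF u] nonlocal_cong_AE[OF ae] mass_cong_AE[OF ae] by auto
    have "(\<integral>\<^sup>+x. ennreal (cmod (u x) powr p) * indicator {2 ^ J<..} (cmod (u x)) \<partial>lebesgue)
       = (\<integral>\<^sup>+x. ennreal (cmod (u' x) powr p) * indicator {2 ^ J<..} (cmod (u' x)) \<partial>lebesgue)"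
      by (intro nn_integral_cong_AE eventually_mono[OF ae]) simp
    also have "\<dots> = (\<integral>\<^sup>+x. ennreal (cmod (u' x) powr p) * indicator {2 ^ J<..} (cmod (u' x)) \<partial>lborel)"
      by (rule nn_integral_completion)
    also have "\<dots> \<le> (\<integral>\<^sup>+x. (\<Sum>i. ennreal (2 powr (p * (real (J + i) + 1))) * indicator {2 ^ (J + i)<..} (cmod (u' x))) \<partial>lborel)"
      using p by (intro nn_integral_mono power_tail_series) auto
    also have "\<dots> = (\<Sum>i. \<integral>\<^sup>+x. ennreal (2 powr (p * (real (J + i) + 1))) * indicator {2 ^ (J + i)<..} (cmod (u' x)) \<partial>lborel)"
      by (rule nn_integral_suminf) measurable
    also have "\<dots> \<le> (\<Sum>i. ennreal (M * 2 powr p * z ^ J * z ^ i))"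
    proof (intro suminf_le)
      fix i
      have "(\<integral>\<^sup>+x. ennreal (2 powr (p * (real (J + i) + 1))) * indicator {2 ^ (J + i)<..} (cmod (u' x)) \<partial>lborel)
        = (\<integral>\<^sup>+x. ennreal (2 powr (p * (real (J + i) + 1))) * indicator {x. 2 ^ (J + i) < cmod (u' x)} x \<partial>lborel)"
        by (intro nn_integral_cong) (simp add: indicator_def)
      also have "\<dots> = ennreal (2 powr (p * (real (J + i) + 1))) * emeasure lborel {x. 2 ^ (J + i) < cmod (u' x)}"
        by (subst nn_integral_cmult_indicator) auto
      also have "\<dots> \<le> ennreal (2 powr (p * (real (J + i) + 1))) * ennreal (M * 2 powr (- (6 / (3 - 2 * s)) * real (J + i)))"
        by (intro mult_left_mono M(2) u' nm) simp
      also have "\<dots> = ennreal (M * (2 powr (p * (real (J + i) + 1)) * 2 powr (- (6 / (3 - 2 * s)) * real (J + i))))"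
        by (subst ennreal_mult'[symmetric]) (auto simp: mult_ac)
      also have "2 powr (p * (real (J + i) + 1)) * 2 powr (- (6 / (3 - 2 * s)) * real (J + i)) = 2 powr p * (z ^ J * z ^ i)"
      proof -
        have e: "p * (real (J + i) + 1) + - (6 / (3 - 2 * s)) * real (J + i) = p + - \<delta> * real (J + i)"
          by (simp add: \<delta>_def algebra_simps)
        have "z ^ J * z ^ i = z powr real (J + i)"
          using z by (simp only: power_add[symmetric] powr_realpow)
        also have "\<dots> = 2 powr (- \<delta> * real (J + i))" by (simp only: z_def powr_powr)
        finally show ?thesis by (simp only: powr_add[symmetric] e)
      qed
      finally show "(\<integral>\<^sup>+x. ennreal (2 powr (p * (real (J + i) + 1))) * indicator {2 ^ (J + i)<..} (cmod (u' x)) \<partial>lborel)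
         \<le> ennreal (M * 2 powr p * z ^ J * z ^ i)" by (simp only: mult.assoc)
    qed auto
    also have "\<dots> = ennreal (\<Sum>i. M * 2 powr p * z ^ J * z ^ i)"
      using z M(1) by (intro suminf_ennreal2 summable_mult summable_geometric) auto
    also have "(\<Sum>i. M * 2 powr p * z ^ J * z ^ i) = B * z ^ J"
      using z by (subst suminf_mult) (auto simp: suminf_geometric B_def summable_geometric)
    also have "ennreal (B * z ^ J) \<le> ennreal \<epsilon>" using J by (intro ennreal_leI) simp
    finally show "(\<integral>\<^sup>+x. ennreal (cmod (u x) powr p) * indicator {2 ^ J<..} (cmod (u x)) \<partial>lebesgue) \<le> ennreal \<epsilon>" .
  qed simp
qed

end

section \<open>The power functional and its derivative\<close>

text \<open>Young's inequality for \<open>a\<close> and \<open>r powr (p - 1)\<close> with the exponents \<open>p\<close> and \<open>p / (p - 1)\<close>.\<close>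

lemma powr_above_tangent:
  fixes a r p :: real
  assumes "0 \<le> a" "0 \<le> r" "1 < p"
  shows "r powr p + p * r powr (p - 1) * (a - r) \<le> a powr p"
proof (cases "r = 0")
  case True then show ?thesis by simp
next
  case False
  then have r: "0 < r" using assms by simp
  define q where "q = p / (p - 1)"
  have q: "1 < q" "1 / p + 1 / q = 1" using assms by (simp_all add: q_def field_simps)
  have "a * r powr (p - 1) \<le> a powr p / p + (r powr (p - 1)) powr q / q"
    using assms q by (intro Youngs_inequality) auto
  also have "(r powr (p - 1)) powr q = r powr p"
    using assms by (simp add: powr_powr q_def)
  finally have "p * (a * r powr (p - 1)) \<le> p * (a powr p / p + r powr p / q)"
    using assms by (intro mult_left_mono) auto
  also have "\<dots> = a powr p + (p - 1) * r powr p"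
    using assms by (simp add: q_def field_simps)
  finally have le: "p * (a * r powr (p - 1)) \<le> a powr p + (p - 1) * r powr p" .
  have rr: "r powr (p - 1) * r = r powr p"
    using r by (simp add: powr_diff)
  have "p * r powr (p - 1) * (a - r) = p * (a * r powr (p - 1)) - p * (r powr (p - 1) * r)"
    by (simp only: ring_distribs) (simp only: mult_ac)
  moreover have "(p - 1) * r powr p = p * r powr p - r powr p"
    by (simp add: left_diff_distrib)
  ultimately show ?thesis using le unfolding rr by linarith
qed

lemma powr_convex_combination:
  fixes x y t p :: real
  assumes "0 \<le> x" "0 \<le> y" "0 \<le> t" "t \<le> 1" "1 < p"
  shows "(t * x + (1 - t) * y) powr p \<le> t * x powr p + (1 - t) * y powr p"
proof -
  let ?z = "t * x + (1 - t) * y"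
  have z: "0 \<le> ?z" using assms by simp
  have "t * (?z powr p + p * ?z powr (p - 1) * (x - ?z)) + (1 - t) * (?z powr p + p * ?z powr (p - 1) * (y - ?z))
    \<le> t * x powr p + (1 - t) * y powr p"
    using assms z by (intro add_mono mult_left_mono powr_above_tangent) auto
  moreover have "t * (?z powr p + p * ?z powr (p - 1) * (x - ?z)) + (1 - t) * (?z powr p + p * ?z powr (p - 1) * (y - ?z)) = ?z powr p"
    by (simp add: algebra_simps)
  ultimately show ?thesis by simp
qed

text \<open>Convexity of the power, applied to \<open>a / (1 - t)\<close> and \<open>b / t\<close> with weights \<open>1 - t\<close> and \<open>t\<close>.\<close>

lemma cmod_add_powr_le:
  fixes a b :: complex and t p :: real
  assumes t: "0 < t" "t < 1" and p: "1 < p"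
  shows "cmod (a + b) powr p \<le> (1 - t) powr (1 - p) * cmod a powr p + t powr (1 - p) * cmod b powr p"
proof -
  have "cmod (a + b) powr p \<le> (cmod a + cmod b) powr p"
    using p norm_triangle_ineq by (intro powr_mono2) auto
  also have "cmod a + cmod b = t * (cmod b / t) + (1 - t) * (cmod a / (1 - t))"
    using t by simp
  also have "\<dots> powr p \<le> t * (cmod b / t) powr p + (1 - t) * (cmod a / (1 - t)) powr p"
    using t p by (intro powr_convex_combination) auto
  also have "\<dots> = (1 - t) powr (1 - p) * cmod a powr p + t powr (1 - p) * cmod b powr p"
    using t by (simp add: powr_divide powr_diff)
  finally show ?thesis .
qed

text \<open>The projection of \<open>a + b\<close> onto the direction of \<open>a\<close> has length \<open>|a| + Re (a * cnj b) / |a|\<close>; the tangent of the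
power at \<open>|a|\<close> bounds its \<open>p\<close>-th power from below. This estimate makes the derivative of \<open>Q\<close>
accessible without differentiation under the integral.\<close>

lemma cmod_add_powr_ge:
  fixes a b :: complex and p :: real
  assumes p: "1 < p"
  shows "cmod a powr p + p * Re (of_real (cmod a powr (p - 2)) * a * cnj b) \<le> cmod (a + b) powr p"
proof (cases "a = 0")
  case True then show ?thesis by simp
next
  case False
  define r where "r = cmod a"
  have r: "0 < r" using False by (simp add: r_def)
  define c where "c = Re (a * cnj b) / r"
  have 1: "r + c \<le> cmod (a + b)"
  proof -
    have "Re ((a + b) * cnj a) \<le> cmod ((a + b) * cnj a)" by (rule complex_Re_le_cmod)
    also have "\<dots> = cmod (a + b) * r" by (simp add: norm_mult r_def)
    also have "Re ((a + b) * cnj a) = r * r + Re (a * cnj b)"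
      by (simp add: r_def cmod_def algebra_simps flip: power2_eq_square)
    finally show ?thesis using r by (simp add: c_def field_simps)
  qed
  have e: "p * Re (of_real (cmod a powr (p - 2)) * a * cnj b) = p * r powr (p - 1) * c"
  proof -
    have "r powr (p - 1) = r powr (p - 2) * r"
      using r by (simp add: powr_diff power2_eq_square)
    then show ?thesis using r by (simp add: c_def r_def[symmetric] mult.assoc)
  qed
  have "r powr p + p * r powr (p - 1) * c \<le> cmod (a + b) powr p"
  proof (cases "0 \<le> r + c")
    case True
    have "r powr p + p * r powr (p - 1) * ((r + c) - r) \<le> (r + c) powr p"
      using True r p by (intro powr_above_tangent) auto
    also have "\<dots> \<le> cmod (a + b) powr p"
      using True p 1 by (intro powr_mono2) auto
    finally show ?thesis by simp
  next
    case False
    then have "p * r powr (p - 1) * c \<le> p * r powr (p - 1) * (- r)"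
      using p by (intro mult_left_mono) auto
    also have "\<dots> = - p * r powr p" using r by (simp add: powr_diff)
    also have "\<dots> \<le> - 1 * r powr p" using p by (intro mult_right_mono) auto
    finally have "r powr p + p * r powr (p - 1) * c \<le> 0" by simp
    then show ?thesis by (rule order_trans) simp
  qed
  then show ?thesis unfolding e by (simp add: r_def)
qed

lemma powr_mult_le_sum:
  fixes a b p :: real
  assumes "0 \<le> a" "0 \<le> b" "1 < p"
  shows "a powr (p - 1) * b \<le> a powr p + b powr p"
proof (cases "a \<le> b")
  case True
  have "a powr (p - 1) * b \<le> b powr (p - 1) * b"
    using True assms by (intro mult_right_mono powr_mono2) auto
  also have "\<dots> = b powr p" using assms by (cases "b = 0") (simp_all add: powr_diff)
  finally show ?thesis by (simp add: add_increasing)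
next
  case False
  then have "a powr (p - 1) * b \<le> a powr (p - 1) * a"
    by (intro mult_left_mono) auto
  also have "\<dots> = a powr p" using assms by (cases "a = 0") (simp_all add: powr_diff)
  finally show ?thesis by (simp add: add_increasing2)
qed

locale magnetic_power = magnetic +
  fixes p :: real
  assumes p_gt_2: "2 < p" and p_subcritical: "p < 6 / (3 - 2 * s)"
begin

definition Qn :: "(R3 \<Rightarrow> complex) \<Rightarrow> ennreal" where
  "Qn u = (\<integral>\<^sup>+x. ennreal (cmod (u x) powr p) \<partial>lebesgue)"

definition Q :: "(R3 \<Rightarrow> complex) \<Rightarrow> real" where "Q u = enn2real (Qn u)"

text \<open>The derivative of \<open>Q\<close> at \<open>u\<close> in the direction \<open>v\<close> is \<open>p * R u v\<close>.\<close>

definition R :: "(R3 \<Rightarrow> complex) \<Rightarrow> (R3 \<Rightarrow> complex) \<Rightarrow> real" where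
  "R u v = Re (\<integral>x. of_real (cmod (u x) powr (p - 2)) * u x * cnj (v x) \<partial>lebesgue)"

lemma p_gt_1: "1 < p" using p_gt_2 by simp

lemma powr_le_below_level:
  assumes "0 \<le> a" "a \<le> \<Lambda>"
  shows "a powr p \<le> \<Lambda> powr (p - 2) * a\<^sup>2"
proof (cases "a = 0")
  case False
  then have a: "0 < a" using assms by simp
  have "a powr p = a powr (p - 2) * a\<^sup>2" using a by (simp add: powr_diff)
  also have "\<dots> \<le> \<Lambda> powr (p - 2) * a\<^sup>2"
    using assms p_gt_2 by (intro mult_right_mono powr_mono2) auto
  finally show ?thesis .
qed simp

lemma Qn_scale: "u \<in> borel_measurable lebesgue \<Longrightarrow> Qn (\<lambda>x. c * u x) = ennreal (cmod c powr p) * Qn u"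
  unfolding Qn_def by (subst nn_integral_cmult[symmetric]) (auto simp: norm_mult powr_mult ennreal_mult')

lemma Qn_unit_bound:
  obtains K where "0 < K" "\<And>u. u \<in> FFS \<Longrightarrow> ip u u \<le> 1 \<Longrightarrow> Qn u \<le> ennreal K"
proof -
  obtain T where T: "0 < T" "\<And>u. u \<in> FFS \<Longrightarrow> ip u u \<le> 1 \<Longrightarrow> nonlocal u \<le> ennreal T \<and> mass u \<le> ennreal T"
    using unit_ball_bound by blast
  obtain \<Lambda> where \<Lambda>: "1 \<le> \<Lambda>" "\<And>u. u \<in> FFS \<Longrightarrow> ip u u \<le> 1 \<Longrightarrow>
    upper_tail p \<Lambda> u \<le> ennreal 1"
    using uniform_tail[OF p_gt_2 p_subcritical, of 1] by auto
  show ?thesis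
  proof (rule that[of "\<Lambda> powr (p - 2) * T + 1"])
    fix u assume u: "u \<in> FFS" "ip u u \<le> 1"
    note [measurable] = FFS_measurable[OF u(1)]
    have "Qn u \<le> (\<integral>\<^sup>+x. ennreal (\<Lambda> powr (p - 2)) * esq (u x) + ennreal (cmod (u x) powr p) * indicator {\<Lambda><..} (cmod (u x)) \<partial>lebesgue)"
      unfolding Qn_def
    proof (intro nn_integral_mono)
      fix x
      show "ennreal (cmod (u x) powr p) \<le> ennreal (\<Lambda> powr (p - 2)) * esq (u x) + ennreal (cmod (u x) powr p) * indicator {\<Lambda><..} (cmod (u x))"
      proof (cases "\<Lambda> < cmod (u x)")
        case False
        then have "ennreal (cmod (u x) powr p) \<le> ennreal (\<Lambda> powr (p - 2) * (cmod (u x))\<^sup>2)"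
          by (intro ennreal_leI powr_le_below_level) auto
        then show ?thesis using False by (simp add: ennreal_mult')
      qed simp
    qed
    also have "\<dots> = ennreal (\<Lambda> powr (p - 2)) * mass u + upper_tail p \<Lambda> u"
      unfolding mass_def by (subst nn_integral_add) (auto simp: nn_integral_cmult)
    also have "\<dots> \<le> ennreal (\<Lambda> powr (p - 2)) * ennreal T + ennreal 1"
      using T(2)[OF u] \<Lambda>(2)[OF u] by (intro add_mono mult_left_mono) auto
    also have "\<dots> = ennreal (\<Lambda> powr (p - 2) * T + 1)"
      using T(1) by (simp add: ennreal_mult')
    finally show "Qn u \<le> ennreal (\<Lambda> powr (p - 2) * T + 1)" .
  qed (use T in \<open>simp add: add_nonneg_pos\<close>)
qed

lemma Qn_bound:
  obtains K where "0 < K" "\<And>u e. u \<in> FFS \<Longrightarrow> 0 < e \<Longrightarrow> ip u u \<le> e\<^sup>2 \<Longrightarrow> Qn u \<le> ennreal (K * e powr p)"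
proof -
  obtain K where K: "0 < K" "\<And>u. u \<in> FFS \<Longrightarrow> ip u u \<le> 1 \<Longrightarrow> Qn u \<le> ennreal K"
    using Qn_unit_bound by blast
  show ?thesis
  proof (rule that[OF K(1)])
    fix u and e :: real assume u: "u \<in> FFS" and e: "0 < e" "ip u u \<le> e\<^sup>2"
    let ?v = "\<lambda>x. of_real (1 / e) * u x"
    have v: "?v \<in> FFS" by (rule FFS_scale[OF u])
    have "ip ?v ?v \<le> 1"
      using e FFS.nrm2_scale[OF u, of "1 / e"] by (simp add: power_divide)
    then have le: "Qn ?v \<le> ennreal K" using K(2)[OF v] by simp
    have "u = (\<lambda>x. of_real e * ?v x)" using e by (simp add: fun_eq_iff)
    then have "Qn u = ennreal (cmod (of_real e) powr p) * Qn ?v"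
      using Qn_scale[OF FFS_measurable[OF v], of "of_real e"] by simp
    also have "\<dots> \<le> ennreal (e powr p) * ennreal K"
      using e by (intro mult_mono le) auto
    also have "\<dots> = ennreal (K * e powr p)"
      by (subst ennreal_mult'[symmetric]) (auto simp: mult.commute)
    finally show "Qn u \<le> ennreal (K * e powr p)" .
  qed
qed

lemma Qn_finite:
  assumes u: "u \<in> FFS"
  shows "Qn u < \<infinity>"
proof -
  obtain K where K: "0 < K" "\<And>u e. u \<in> FFS \<Longrightarrow> 0 < e \<Longrightarrow> ip u u \<le> e\<^sup>2 \<Longrightarrow> Qn u \<le> ennreal (K * e powr p)"
    using Qn_bound by blast
  have "Qn u \<le> ennreal (K * (sqrt (ip u u) + 1) powr p)"
    using ip_nonneg[OF u] by (intro K(2)[OF u]) (auto simp: power2_sum add_nonneg_pos)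
  then show ?thesis using le_less_trans by fastforce
qed

lemma Qn_eq: "u \<in> FFS \<Longrightarrow> Qn u = ennreal (Q u)"
  using Qn_finite[of u] by (simp add: Q_def)

lemma Q_nonneg: "0 \<le> Q u" by (simp add: Q_def)

lemma Q_bound:
  obtains K where "0 < K" "\<And>u e. u \<in> FFS \<Longrightarrow> 0 < e \<Longrightarrow> ip u u \<le> e\<^sup>2 \<Longrightarrow> Q u \<le> K * e powr p"
proof -
  obtain K where K: "0 < K" "\<And>u e. u \<in> FFS \<Longrightarrow> 0 < e \<Longrightarrow> ip u u \<le> e\<^sup>2 \<Longrightarrow> Qn u \<le> ennreal (K * e powr p)"
    using Qn_bound by blast
  show ?thesis
    by (rule that[OF K(1)]) (use K in \<open>auto simp: Qn_eq\<close>)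
qed

lemma Q_scale: "u \<in> FFS \<Longrightarrow> Q (\<lambda>x. c * u x) = cmod c powr p * Q u"
  using Qn_scale[OF FFS_measurable, of u c] by (simp add: Q_def enn2real_mult)

lemma integrable_powr:
  assumes u: "u \<in> FFS"
  shows "integrable lebesgue (\<lambda>x. cmod (u x) powr p)"
proof -
  note [measurable] = FFS_measurable[OF u]
  show ?thesis
    using Qn_finite[OF u] unfolding Qn_def by (intro integrableI_nonneg) auto
qed

lemma Q_integral:
  assumes u: "u \<in> FFS"
  shows "Q u = (\<integral>x. cmod (u x) powr p \<partial>lebesgue)"
proof -
  note [measurable] = FFS_measurable[OF u]
  show ?thesis
    unfolding Q_def Qn_def by (rule integral_eq_nn_integral[symmetric]) auto
qed

lemma Q_add_le:
  assumes u: "u \<in> FFS" and v: "v \<in> FFS" and t: "0 < t" "t < 1"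
  shows "Q (\<lambda>x. u x + v x) \<le> (1 - t) powr (1 - p) * Q u + t powr (1 - p) * Q v"
proof -
  have "Q (\<lambda>x. u x + v x) \<le> (\<integral>x. (1 - t) powr (1 - p) * cmod (u x) powr p + t powr (1 - p) * cmod (v x) powr p \<partial>lebesgue)"
    unfolding Q_integral[OF FFS_add[OF u v]]
    using t p_gt_1 by (intro integral_mono integrable_powr FFS_add u v Bochner_Integration.integrable_add integrable_mult_right cmod_add_powr_le) auto
  also have "\<dots> = (1 - t) powr (1 - p) * Q u + t powr (1 - p) * Q v"
    unfolding Q_integral[OF u] Q_integral[OF v]
    by (subst Bochner_Integration.integral_add) (auto intro!: integrable_mult_right integrable_powr u v)
  finally show ?thesis .
qed

text \<open>In \<open>Q_add_le\<close> the factor of \<open>Q u\<close> tends to 1 as \<open>t\<close> tends to 0, uniformly for bounded \<open>Q u\<close>; then \<open>Q v\<close> has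
to be small against the other factor.\<close>

lemma Q_perturb:
  assumes "0 < e" "0 \<le> K"
  obtains \<delta> where "0 < \<delta>" "\<And>u v. u \<in> FFS \<Longrightarrow> v \<in> FFS \<Longrightarrow> Q u \<le> K \<Longrightarrow> Q v \<le> \<delta> \<Longrightarrow> Q (\<lambda>x. u x + v x) \<le> Q u + e"
proof -
  have "((\<lambda>t. ((1 - t) powr (1 - p) - 1) * K) \<longlongrightarrow> ((1 - 0) powr (1 - p) - 1) * K) (at_right 0)"
    by (intro tendsto_intros) auto
  then have "\<forall>\<^sub>F t in at_right 0. ((1 - t) powr (1 - p) - 1) * K < e / 2"
    using assms by (intro order_tendstoD(2)) auto
  moreover have "\<forall>\<^sub>F t in at_right 0. (t :: real) < 1"
    by (rule eventually_at_right_real[THEN eventually_mono, of 0 1]) auto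
  moreover have "\<forall>\<^sub>F t in at_right 0. (0 :: real) < t"
    by (rule eventually_at_right_less)
  ultimately have "\<forall>\<^sub>F t in at_right 0. ((1 - t) powr (1 - p) - 1) * K < e / 2 \<and> t < 1 \<and> 0 < t"
    by eventually_elim auto
  then obtain t where t: "((1 - t) powr (1 - p) - 1) * K < e / 2" "t < 1" "0 < t"
    using eventually_happens[of _ "at_right (0::real)"] by (auto simp: trivial_limit_at_right_real)
  define \<delta> where "\<delta> = e / (2 * t powr (1 - p))"
  show ?thesis
  proof (rule that[of \<delta>])
    show "0 < \<delta>" using assms t by (simp add: \<delta>_def)
    fix u v assume uv: "u \<in> FFS" "v \<in> FFS" and Qu: "Q u \<le> K" and Qv: "Q v \<le> \<delta>"
    have c: "0 \<le> (1 - t) powr (1 - p) - 1"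
    proof -
      have "1 powr (1 - p) \<le> (1 - t) powr (1 - p)"
        using t p_gt_1 by (intro powr_mono2') auto
      then show ?thesis by simp
    qed
    have "((1 - t) powr (1 - p) - 1) * Q u \<le> ((1 - t) powr (1 - p) - 1) * K"
      using c Qu by (intro mult_left_mono)
    moreover have "t powr (1 - p) * Q v \<le> t powr (1 - p) * \<delta>"
      using Qv by (intro mult_left_mono) auto
    moreover have "t powr (1 - p) * \<delta> = e / 2"
      using t by (simp add: \<delta>_def)
    ultimately show "Q (\<lambda>x. u x + v x) \<le> Q u + e"
      using Q_add_le[OF uv t(3,2)] t(1) by (simp add: left_diff_distrib)
  qed
qed

lemma Q_continuous:
  assumes u: "\<And>n. u n \<in> FFS" and l: "l \<in> FFS" and lim: "(\<lambda>n. Q (\<lambda>x. u n x - l x)) \<longlonglongrightarrow> 0"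
  shows "(\<lambda>n. Q (u n)) \<longlonglongrightarrow> Q l"
proof (rule LIMSEQ_I)
  fix r :: real assume r: "0 < r"
  define e where "e = min (r / 2) 1"
  have e: "0 < e" "e < r" "e \<le> 1" using r by (auto simp: e_def)
  have K0: "0 \<le> Q l + 1" using Q_nonneg[of l] by simp
  obtain \<delta> where \<delta>: "0 < \<delta>" "\<And>u v. u \<in> FFS \<Longrightarrow> v \<in> FFS \<Longrightarrow> Q u \<le> Q l + 1 \<Longrightarrow> Q v \<le> \<delta> \<Longrightarrow> Q (\<lambda>x. u x + v x) \<le> Q u + e"
    using Q_perturb[OF e(1) K0] by blast
  obtain N where N: "\<And>n. N \<le> n \<Longrightarrow> Q (\<lambda>x. u n x - l x) < \<delta>"
    using order_tendstoD(2)[OF lim \<delta>(1)] by (auto simp: eventually_sequentially)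
  have "norm (Q (u n) - Q l) < r" if n: "N \<le> n" for n
  proof -
    have d: "(\<lambda>x. u n x - l x) \<in> FFS" "(\<lambda>x. l x - u n x) \<in> FFS"
      using u l by (auto intro: FFS.diff_closed)
    have "Q (\<lambda>x. l x - u n x) = Q (\<lambda>x. u n x - l x)"
      using Q_scale[OF d(1), of "-1"] by simp
    then have small: "Q (\<lambda>x. l x - u n x) \<le> \<delta>" "Q (\<lambda>x. u n x - l x) \<le> \<delta>" using N[OF n] by auto
    have 1: "Q (u n) \<le> Q l + e"
      using \<delta>(2)[OF l d(1) _ small(2)] by simp
    then have "Q l \<le> Q (u n) + e"
      using \<delta>(2)[OF u[of n] d(2) _ small(1)] e by simp
    with 1 e show ?thesis by simp
  qed
  then show "\<exists>N. \<forall>n\<ge>N. norm (Q (u n) - Q l) < r" by blast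
qed

lemma Q_tendsto_0:
  assumes u: "\<And>n. u n \<in> FFS" and lim: "(\<lambda>n. ip (u n) (u n)) \<longlonglongrightarrow> 0"
  shows "(\<lambda>n. Q (u n)) \<longlonglongrightarrow> 0"
proof (rule LIMSEQ_I)
  obtain K where K: "0 < K" "\<And>u e. u \<in> FFS \<Longrightarrow> 0 < e \<Longrightarrow> ip u u \<le> e\<^sup>2 \<Longrightarrow> Q u \<le> K * e powr p"
    using Q_bound by blast
  fix r :: real assume r: "0 < r"
  define e where "e = (r / (2 * K)) powr (1 / p)"
  have e: "0 < e" using r K by (simp add: e_def)
  have "K * e powr p = r / 2"
    using r K p_gt_1 by (simp add: e_def powr_powr)
  moreover obtain N where N: "\<And>n. N \<le> n \<Longrightarrow> ip (u n) (u n) < e\<^sup>2"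
    using order_tendstoD(2)[OF lim, of "e\<^sup>2"] e by (auto simp: eventually_sequentially)
  ultimately have "norm (Q (u n) - 0) < r" if "N \<le> n" for n
    using K(2)[OF u e less_imp_le[OF N[OF that]]] Q_nonneg[of "u n"] r by simp
  then show "\<exists>N. \<forall>n\<ge>N. norm (Q (u n) - 0) < r" by blast
qed

lemma R_integrable:
  assumes u: "u \<in> FFS" and v: "v \<in> FFS"
  shows "integrable lebesgue (\<lambda>x. of_real (cmod (u x) powr (p - 2)) * u x * cnj (v x))"
proof (rule Bochner_Integration.integrable_bound)
  note [measurable] = FFS_measurable[OF u] FFS_measurable[OF v]
  show "integrable lebesgue (\<lambda>x. cmod (u x) powr p + cmod (v x) powr p)"
    by (intro Bochner_Integration.integrable_add integrable_powr u v)
  show "(\<lambda>x. of_real (cmod (u x) powr (p - 2)) * u x * cnj (v x)) \<in> borel_measurable lebesgue"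
    by measurable
  show "AE x in lebesgue. norm (of_real (cmod (u x) powr (p - 2)) * u x * cnj (v x)) \<le> norm (cmod (u x) powr p + cmod (v x) powr p)"
  proof (rule AE_I2)
    fix x
    have "cmod (u x) powr (p - 2) * cmod (u x) = cmod (u x) powr (p - 1)"
      by (cases "u x = 0") (simp_all add: powr_diff power2_eq_square)
    then have "norm (of_real (cmod (u x) powr (p - 2)) * u x * cnj (v x)) = cmod (u x) powr (p - 1) * cmod (v x)"
      by (simp add: norm_mult)
    also have "\<dots> \<le> cmod (u x) powr p + cmod (v x) powr p"
      using p_gt_1 by (intro powr_mult_le_sum) auto
    finally show "norm (of_real (cmod (u x) powr (p - 2)) * u x * cnj (v x)) \<le> norm (cmod (u x) powr p + cmod (v x) powr p)"
      by simp
  qed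
qed

lemma R_lin:
  assumes u: "u \<in> FFS" and v: "v \<in> FFS" and w: "w \<in> FFS"
  shows "R u (\<lambda>x. of_real a * v x + of_real b * w x) = a * R u v + b * R u w"
proof -
  have "(\<integral>x. of_real (cmod (u x) powr (p - 2)) * u x * cnj (of_real a * v x + of_real b * w x) \<partial>lebesgue)
    = (\<integral>x. of_real a * (of_real (cmod (u x) powr (p - 2)) * u x * cnj (v x)) + of_real b * (of_real (cmod (u x) powr (p - 2)) * u x * cnj (w x)) \<partial>lebesgue)"
    by (intro Bochner_Integration.integral_cong refl) (simp add: algebra_simps)
  also have "\<dots> = of_real a * (\<integral>x. of_real (cmod (u x) powr (p - 2)) * u x * cnj (v x) \<partial>lebesgue) + of_real b * (\<integral>x. of_real (cmod (u x) powr (p - 2)) * u x * cnj (w x) \<partial>lebesgue)"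
    using R_integrable[OF u v] R_integrable[OF u w] by (subst Bochner_Integration.integral_add) auto
  finally show ?thesis by (simp add: R_def)
qed

lemma Q_below:
  assumes u: "u \<in> FFS" and v: "v \<in> FFS"
  shows "Q u + t * (p * R u v) \<le> Q (\<lambda>x. u x + of_real t * v x)"
proof -
  have tv: "(\<lambda>x. of_real t * v x) \<in> FFS" using v by (rule FFS_scale)
  define f where "f x = of_real (cmod (u x) powr (p - 2)) * u x * cnj (of_real t * v x)" for x
  have f: "integrable lebesgue f" unfolding f_def by (rule R_integrable[OF u tv])
  have "Q u + p * R u (\<lambda>x. of_real t * v x) = (\<integral>x. cmod (u x) powr p \<partial>lebesgue) + p * (\<integral>x. Re (f x) \<partial>lebesgue)"
    unfolding Q_integral[OF u] R_def f_def[symmetric] using f by (simp add: integral_Re)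
  also have "\<dots> = (\<integral>x. cmod (u x) powr p + p * Re (f x) \<partial>lebesgue)"
    using f integrable_powr[OF u]
    by (subst Bochner_Integration.integral_add) (auto intro!: integrable_mult_right)
  also have "\<dots> \<le> (\<integral>x. cmod (u x + of_real t * v x) powr p \<partial>lebesgue)"
  proof (rule integral_mono)
    show "integrable lebesgue (\<lambda>x. cmod (u x) powr p + p * Re (f x))"
      using f by (intro Bochner_Integration.integrable_add integrable_powr u integrable_mult_right integrable_Re)
    show "integrable lebesgue (\<lambda>x. cmod (u x + of_real t * v x) powr p)"
      by (intro integrable_powr FFS_add u tv)
    show "cmod (u x) powr p + p * Re (f x) \<le> cmod (u x + of_real t * v x) powr p" for x
      unfolding f_def by (rule cmod_add_powr_ge[OF p_gt_1])
  qed
  also have "\<dots> = Q (\<lambda>x. u x + of_real t * v x)"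
    by (rule Q_integral[symmetric]) (intro FFS_add u tv)
  finally show ?thesis using R_lin[OF u v v, of t 0] by (simp add: mult_ac)
qed

lemma R_scale_left:
  assumes "0 < c"
  shows "R (\<lambda>x. of_real c * u x) v = c powr (p - 1) * R u v"
proof -
  have "of_real (cmod (of_real c * u x) powr (p - 2)) * (of_real c * u x) * cnj (v x)
     = of_real (c powr (p - 1)) * (of_real (cmod (u x) powr (p - 2)) * u x * cnj (v x))" for x
  proof -
    have "c powr (p - 1) = c powr (p - 2) * c" using assms by (simp add: powr_diff power2_eq_square)
    moreover have "cmod (of_real c * u x) powr (p - 2) = c powr (p - 2) * cmod (u x) powr (p - 2)"
      using assms by (simp add: norm_mult powr_mult)
    ultimately show ?thesis by (simp only: of_real_mult mult_ac)
  qed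
  then have "(\<integral>x. of_real (cmod (of_real c * u x) powr (p - 2)) * (of_real c * u x) * cnj (v x) \<partial>lebesgue)
    = (\<integral>x. of_real (c powr (p - 1)) * (of_real (cmod (u x) powr (p - 2)) * u x * cnj (v x)) \<partial>lebesgue)"
    by (intro Bochner_Integration.integral_cong refl)
  then show ?thesis by (simp add: R_def)
qed

end

section \<open>Rotations, test functions and completeness\<close>

text \<open>The preimage of a Borel null set is a null set, so measurability extends to the completion.\<close>

lemma measure_preserving_lebesgue:
  fixes f :: "'a::euclidean_space \<Rightarrow> 'a"
  assumes f [measurable]: "f \<in> borel_measurable borel" and distr: "distr lborel borel f = lborel"
  shows "f \<in> lebesgue \<rightarrow>\<^sub>M lebesgue" "distr lebesgue lebesgue f = lebesgue"
proof -
  have fm: "f \<in> lebesgue \<rightarrow>\<^sub>M lborel" by (intro measurable_completion) simp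
  have d: "distr lebesgue lborel f = lborel"
  proof -
    have "distr lebesgue lborel f = distr lborel lborel f"
      by (rule distr_completion) simp
    also have "\<dots> = distr lborel borel f" by (rule distr_cong) auto
    finally show ?thesis using distr by simp
  qed
  show "f \<in> lebesgue \<rightarrow>\<^sub>M lebesgue"
    by (rule completion.measurable_completion2[OF fm]) (simp add: d)
  show "distr lebesgue lebesgue f = lebesgue"
    using completion.completion_distr_eq[OF fm] by (simp add: d)
qed

lemma orthogonal_measurable: "orthogonal_transformation (g :: R3 \<Rightarrow> R3) \<Longrightarrow> g \<in> borel_measurable borel"
  by (intro borel_measurable_continuous_onI linear_continuous_on orthogonal_transformation_linear[THEN linear_conv_bounded_linear[THEN iffD1]])

lemma distr_orthogonal:
  fixes g :: "R3 \<Rightarrow> R3"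
  assumes g: "orthogonal_transformation g"
  shows "distr lborel borel g = lborel"
proof (rule sym, rule lborel_eqI)
  note [measurable] = orthogonal_measurable[OF g]
  fix l u :: R3 assume le: "\<And>b. b \<in> Basis \<Longrightarrow> l \<bullet> b \<le> u \<bullet> b"
  have inv: "orthogonal_transformation (inv g)" using g by (rule orthogonal_transformation_inv)
  have vim: "g -` box l u = inv g ` box l u"
    using bij_vimage_eq_inv_image[OF orthogonal_transformation_bij[OF g]] .
  have bm: "box l u \<in> lmeasurable" by simp
  have 1: "inv g ` box l u \<in> lmeasurable" "measure lebesgue (inv g ` box l u) = measure lebesgue (box l u)"
    using measurable_orthogonal_image[OF inv bm] measure_orthogonal_image[OF inv bm] by auto
  have sb: "g -` box l u \<in> sets borel" using measurable_sets[OF orthogonal_measurable[OF g], of "box l u"] by simp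
  have "emeasure (distr lborel borel g) (box l u) = emeasure lborel (g -` box l u)"
    by (subst emeasure_distr) auto
  also have "\<dots> = emeasure lebesgue (inv g ` box l u)"
    using sb by (simp add: vim)
  also have "\<dots> = ennreal (measure lebesgue (box l u))"
    using 1 by (simp add: emeasure_eq_measure2)
  also have "\<dots> = emeasure lborel (box l u)"
    using bm by (subst emeasure_eq_measure2[symmetric]) auto
  also have "\<dots> = (\<Prod>b\<in>Basis. (u - l) \<bullet> b)"
    using le by (simp add: emeasure_lborel_box)
  finally show "emeasure (distr lborel borel g) (box l u) = (\<Prod>b\<in>Basis. (u - l) \<bullet> b)" .
qed simp

lemma distr_orthogonal_pair:
  fixes g :: "R3 \<Rightarrow> R3"
  assumes g: "orthogonal_transformation g"
  shows "distr lborel borel (\<lambda>(x, y). (g x, g y)) = (lborel :: (R3 \<times> R3) measure)"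
proof -
  note [measurable] = orthogonal_measurable[OF g]
  have "distr lborel borel g \<Otimes>\<^sub>M distr lborel borel g = distr (lborel \<Otimes>\<^sub>M lborel) (borel \<Otimes>\<^sub>M borel) (\<lambda>(x, y). (g x, g y))"
    by (rule pair_measure_distr) (auto simp: distr_orthogonal[OF g] lborel.sigma_finite_measure_axioms)
  then show ?thesis
    unfolding distr_orthogonal[OF g] lborel_prod borel_prod by simp
qed

lemma
  fixes g :: "R3 \<Rightarrow> R3"
  assumes g: "orthogonal_transformation g"
  shows orthogonal_measurable_lebesgue: "g \<in> lebesgue \<rightarrow>\<^sub>M lebesgue"
    and distr_orthogonal_lebesgue: "distr lebesgue lebesgue g = lebesgue"
    and orthogonal_pair_measurable_lebesgue: "(\<lambda>(x, y). (g x, g y)) \<in> lebesgue \<rightarrow>\<^sub>M lebesgue"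
    and distr_orthogonal_pair_lebesgue: "distr lebesgue lebesgue (\<lambda>(x, y). (g x, g y)) = lebesgue"
proof -
  show "g \<in> lebesgue \<rightarrow>\<^sub>M lebesgue" "distr lebesgue lebesgue g = lebesgue"
    using measure_preserving_lebesgue[OF orthogonal_measurable[OF g] distr_orthogonal[OF g]] by auto
  have "(\<lambda>(x, y). (g x, g y)) \<in> borel_measurable borel"
    using orthogonal_measurable[OF g] unfolding borel_prod[symmetric] by measurable
  from measure_preserving_lebesgue[OF this distr_orthogonal_pair[OF g]]
  show "(\<lambda>(x, y). (g x, g y)) \<in> lebesgue \<rightarrow>\<^sub>M lebesgue" "distr lebesgue lebesgue (\<lambda>(x, y). (g x, g y)) = lebesgue" by auto
qed

lemma C_k_lin:
  "C_k k f \<Longrightarrow> C_k k h \<Longrightarrow> C_k k (\<lambda>x. of_real a * f x + of_real b * h x)"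
proof (induction k arbitrary: f h)
  case 0
  then show ?case by (auto intro!: continuous_intros)
next
  case (Suc k)
  have d: "((\<lambda>x. of_real a * f x + of_real b * h x) has_derivative
      (\<lambda>v. of_real a * frechet_derivative f (at x) v + of_real b * frechet_derivative h (at x) v)) (at x)" for x
    using Suc.prems by (auto intro!: derivative_intros simp: differentiable_on_def frechet_derivative_works[symmetric])
  then have e: "frechet_derivative (\<lambda>x. of_real a * f x + of_real b * h x) (at x) =
     (\<lambda>v. of_real a * frechet_derivative f (at x) v + of_real b * frechet_derivative h (at x) v)" for x
    by (rule frechet_derivative_at[symmetric])
  show ?case
    using Suc d unfolding C_k.simps e by (auto simp: differentiable_on_def differentiable_def)
qed

lemma C_k_compose_linear:
  assumes g: "bounded_linear g"
  shows "C_k k f \<Longrightarrow> C_k k (\<lambda>x. f (g x))"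
proof (induction k arbitrary: f)
  case 0
  then show ?case
    using continuous_on_compose2[of UNIV f UNIV g] linear_continuous_on[OF g] by simp
next
  case (Suc k)
  have d: "((\<lambda>x. f (g x)) has_derivative (\<lambda>v. frechet_derivative f (at (g x)) (g v))) (at x)" for x
    using diff_chain_at[OF bounded_linear_imp_has_derivative[OF g], of f "frechet_derivative f (at (g x))" x] Suc.prems
    by (simp add: o_def differentiable_on_def frechet_derivative_works[symmetric])
  then have e: "frechet_derivative (\<lambda>x. f (g x)) (at x) = (\<lambda>v. frechet_derivative f (at (g x)) (g v))" for x
    by (rule frechet_derivative_at[symmetric])
  have "C_k k (\<lambda>x. frechet_derivative f (at (g x)) (g v))" for v
    using Suc.prems by (intro Suc.IH[of "\<lambda>y. frechet_derivative f (at y) (g v)"]) simp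
  then show ?case
    using d unfolding C_k.simps e by (auto simp: differentiable_on_def differentiable_def)
qed

lemma test_functions_iff: "\<phi> \<in> test_functions \<longleftrightarrow> (\<forall>k. C_k k \<phi>) \<and> bounded {x. \<phi> x \<noteq> 0}"
  by (simp add: test_functions_def)

lemma test_functions_lin:
  assumes "\<phi> \<in> test_functions" "\<psi> \<in> test_functions"
  shows "(\<lambda>x. of_real a * \<phi> x + of_real b * \<psi> x) \<in> test_functions"
proof -
  have "bounded {x. of_real a * \<phi> x + of_real b * \<psi> x \<noteq> 0}"
    by (rule bounded_subset[of "{x. \<phi> x \<noteq> 0} \<union> {x. \<psi> x \<noteq> 0}"]) (use assms in \<open>auto simp: test_functions_iff\<close>)
  then show ?thesis using assms by (auto simp: test_functions_iff C_k_lin)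
qed

lemma test_functions_rotate:
  assumes g: "orthogonal_transformation g" and \<phi>: "\<phi> \<in> test_functions"
  shows "(\<lambda>x. \<phi> (g x)) \<in> test_functions"
proof -
  obtain B where "\<And>x. \<phi> x \<noteq> 0 \<Longrightarrow> norm x \<le> B"
    using \<phi> by (auto simp: test_functions_iff bounded_iff)
  then have "norm x \<le> B" if "\<phi> (g x) \<noteq> 0" for x
    using that orthogonal_transformation_norm[OF g, of x] by force
  then have "bounded {x. \<phi> (g x) \<noteq> 0}" by (auto simp: bounded_iff)
  moreover have "bounded_linear g"
    using orthogonal_transformation_linear[OF g] by (simp add: linear_conv_bounded_linear)
  then have "C_k k (\<lambda>x. \<phi> (g x))" for k
    using \<phi> by (intro C_k_compose_linear[of g k \<phi>]) (simp_all add: test_functions_iff)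
  ultimately show ?thesis by (simp add: test_functions_iff)
qed

context magnetic begin

abbreviation HA where "HA \<equiv> H_As A s m"

lemma HA_iff: "u \<in> HA \<longleftrightarrow> u \<in> FFS \<and> (\<forall>\<epsilon>>0. \<exists>\<phi>\<in>test_functions \<inter> FFS. sqrt (dist2 u \<phi>) < \<epsilon>)"
  by (simp add: H_As_def norm_As_def)

lemma HA_FFS: "u \<in> HA \<Longrightarrow> u \<in> FFS" by (simp add: HA_iff)

lemma HA_approx:
  assumes "u \<in> HA" "0 < \<epsilon>"
  shows "\<exists>\<phi>. \<phi> \<in> test_functions \<and> \<phi> \<in> FFS \<and> sqrt (dist2 u \<phi>) < \<epsilon>"
  using assms unfolding HA_iff by auto

lemma HA_add:
  assumes u: "u \<in> HA" and v: "v \<in> HA"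
  shows "(\<lambda>x. u x + v x) \<in> HA"
  unfolding HA_iff
proof (intro conjI allI impI)
  show "(\<lambda>x. u x + v x) \<in> FFS" using u v by (intro FFS_add HA_FFS)
  fix \<epsilon> :: real assume \<epsilon>: "0 < \<epsilon>"
  obtain \<phi> where \<phi>: "\<phi> \<in> test_functions" "\<phi> \<in> FFS" "sqrt (dist2 u \<phi>) < \<epsilon> / 2"
    using HA_approx[OF u half_gt_zero[OF \<epsilon>]] by blast
  obtain \<psi> where \<psi>: "\<psi> \<in> test_functions" "\<psi> \<in> FFS" "sqrt (dist2 v \<psi>) < \<epsilon> / 2"
    using HA_approx[OF v half_gt_zero[OF \<epsilon>]] by blast
  have t: "(\<lambda>x. \<phi> x + \<psi> x) \<in> test_functions"
    using test_functions_lin[OF \<phi>(1) \<psi>(1), of 1 1] by simp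
  have "(\<lambda>x. u x + v x - (\<phi> x + \<psi> x)) = (\<lambda>x. (u x - \<phi> x) + (v x - \<psi> x))" by auto
  then have "sqrt (ip (\<lambda>x. u x + v x - (\<phi> x + \<psi> x)) (\<lambda>x. u x + v x - (\<phi> x + \<psi> x))) < \<epsilon>"
    using FFS.triangle[OF FFS.diff_closed[OF HA_FFS[OF u] \<phi>(2)] FFS.diff_closed[OF HA_FFS[OF v] \<psi>(2)]] \<phi>(3) \<psi>(3) by simp
  then show "\<exists>\<phi>\<in>test_functions \<inter> FFS. sqrt (ip (\<lambda>x. u x + v x - \<phi> x) (\<lambda>x. u x + v x - \<phi> x)) < \<epsilon>"
    using t FFS_add[OF \<phi>(2) \<psi>(2)] by (intro bexI[of _ "\<lambda>x. \<phi> x + \<psi> x"]) auto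
qed

lemma HA_scale:
  assumes u: "u \<in> HA"
  shows "(\<lambda>x. of_real c * u x) \<in> HA"
  unfolding HA_iff
proof (intro conjI allI impI)
  show "(\<lambda>x. of_real c * u x) \<in> FFS" using u by (intro FFS_scale HA_FFS)
  fix \<epsilon> :: real assume \<epsilon>: "0 < \<epsilon>"
  then have "0 < \<epsilon> / (\<bar>c\<bar> + 1)" by (simp add: add_nonneg_pos)
  then obtain \<phi> where \<phi>: "\<phi> \<in> test_functions" "\<phi> \<in> FFS" "sqrt (dist2 u \<phi>) < \<epsilon> / (\<bar>c\<bar> + 1)"
    using HA_approx[OF u] by blast
  have t: "(\<lambda>x. of_real c * \<phi> x) \<in> test_functions"
    using test_functions_lin[OF \<phi>(1) \<phi>(1), of c 0] by simp
  have "(\<lambda>x. of_real c * u x - of_real c * \<phi> x) = (\<lambda>x. of_real c * (u x - \<phi> x))" by (auto simp: algebra_simps)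
  then have "sqrt (ip (\<lambda>x. of_real c * u x - of_real c * \<phi> x) (\<lambda>x. of_real c * u x - of_real c * \<phi> x)) = \<bar>c\<bar> * sqrt (dist2 u \<phi>)"
    using FFS.nrm2_scale[OF FFS.diff_closed[OF HA_FFS[OF u] \<phi>(2)], of c] by (simp add: real_sqrt_mult)
  also have "\<dots> \<le> \<bar>c\<bar> * (\<epsilon> / (\<bar>c\<bar> + 1))"
    using \<phi>(3) by (intro mult_left_mono) auto
  also have "\<dots> < \<epsilon>" using \<epsilon> by (simp add: field_simps add_nonneg_pos)
  finally show "\<exists>\<phi>\<in>test_functions \<inter> FFS. sqrt (ip (\<lambda>x. of_real c * u x - \<phi> x) (\<lambda>x. of_real c * u x - \<phi> x)) < \<epsilon>"
    using t FFS_scale[OF \<phi>(2)] by (intro bexI[of _ "\<lambda>x. of_real c * \<phi> x"]) auto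
qed

lemma HA_cong_AE:
  assumes u: "u \<in> HA" and ae: "AE x in lebesgue. u x = v x"
  shows "v \<in> HA"
  unfolding HA_iff
proof (intro conjI allI impI)
  show v: "v \<in> FFS" using FFS_cong_AE[OF HA_FFS[OF u] ae] .
  fix \<epsilon> :: real assume \<epsilon>: "0 < \<epsilon>"
  then obtain \<phi> where \<phi>: "\<phi> \<in> test_functions" "\<phi> \<in> FFS" "sqrt (dist2 u \<phi>) < \<epsilon>"
    using HA_approx[OF u] by blast
  have d: "(\<lambda>x. u x - \<phi> x) \<in> FFS" "(\<lambda>x. v x - \<phi> x) \<in> FFS"
    using FFS.diff_closed[OF HA_FFS[OF u] \<phi>(2)] FFS.diff_closed[OF v \<phi>(2)] .
  have ae': "AE x in lebesgue. u x - \<phi> x = v x - \<phi> x" using ae by eventually_elim simp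
  have "dist2 u \<phi> = dist2 v \<phi>"
    using ip_cong_AE[OF d(1) ae' d(1)] ip_cong_AE[OF d(1) ae' d(2)] ip_sym[of "\<lambda>x. v x - \<phi> x" "\<lambda>x. u x - \<phi> x"] by simp
  then show "\<exists>\<phi>\<in>test_functions \<inter> FFS. sqrt (dist2 v \<phi>) < \<epsilon>"
    using \<phi> by (intro bexI[of _ \<phi>]) auto
qed

sublocale HA: function_hilbert HA ip
  by unfold_locales (use HA_add HA_scale HA_FFS ip_add ip_scale ip_sym ip_nonneg in auto)

lemma HA_complete_limit:
  assumes u: "\<And>n. u n \<in> HA" and l: "l \<in> FFS" and lim: "(\<lambda>n. dist2 (u n) l) \<longlonglongrightarrow> 0"
  shows "l \<in> HA"
  unfolding HA_iff
proof (intro conjI allI impI l)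
  fix \<epsilon> :: real assume \<epsilon>: "0 < \<epsilon>"
  have "\<forall>\<^sub>F n in sequentially. sqrt (dist2 (u n) l) < \<epsilon> / 2"
    using tendsto_real_sqrt[OF lim] \<epsilon> by (intro order_tendstoD(2)[of _ 0]) auto
  then obtain n where n: "sqrt (dist2 (u n) l) < \<epsilon> / 2"
    by (auto simp: eventually_sequentially)
  obtain \<phi> where \<phi>: "\<phi> \<in> test_functions" "\<phi> \<in> FFS" "sqrt (dist2 (u n) \<phi>) < \<epsilon> / 2"
    using HA_approx[OF u[of n] half_gt_zero[OF \<epsilon>]] by blast
  have "sqrt (dist2 l \<phi>) < \<epsilon>"
    using FFS.triangle_diff[OF l HA_FFS[OF u[of n]] \<phi>(2)] n \<phi>(3) FFS.nrm2_minus_commute[OF l HA_FFS[OF u[of n]]] by simp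
  then show "\<exists>\<phi>\<in>test_functions \<inter> FFS. sqrt (dist2 l \<phi>) < \<epsilon>"
    using \<phi> by blast
qed

lemma HA_nrm_complete: "HA.nrm_complete"
  unfolding HA.nrm_complete_def
proof (intro allI impI)
  fix u :: "nat \<Rightarrow> R3 \<Rightarrow> complex" assume "(\<forall>n. u n \<in> HA) \<and> (\<forall>e>0. \<exists>N. \<forall>i\<ge>N. \<forall>j\<ge>N. dist2 (u i) (u j) < e)"
  then have u: "\<And>n. u n \<in> HA" and c: "\<And>e. 0 < e \<Longrightarrow> \<exists>N. \<forall>i\<ge>N. \<forall>j\<ge>N. dist2 (u i) (u j) < e"
    by auto
  obtain l where "l \<in> FFS" "(\<lambda>n. dist2 (u n) l) \<longlonglongrightarrow> 0"
    by (rule form_complete[OF HA_FFS[OF u] c])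
  with HA_complete_limit[of u l] u show "\<exists>l\<in>HA. (\<lambda>n. dist2 (u n) l) \<longlonglongrightarrow> 0"
    by blast
qed

abbreviation HR where "HR \<equiv> H_As_rad A s m"

lemma HR_iff: "u \<in> HR \<longleftrightarrow> u \<in> HA \<and> radially_symmetric u"
  by (simp add: H_As_rad_def)

lemma radially_symmetric_lin:
  "radially_symmetric u \<Longrightarrow> radially_symmetric v \<Longrightarrow> radially_symmetric (\<lambda>x. a * u x + b * v x)"
  unfolding radially_symmetric_def by metis

lemma HR_add: "u \<in> HR \<Longrightarrow> v \<in> HR \<Longrightarrow> (\<lambda>x. u x + v x) \<in> HR"
  using radially_symmetric_lin[of u v 1 1] by (simp add: HR_iff HA_add)

lemma HR_scale: "u \<in> HR \<Longrightarrow> (\<lambda>x. of_real c * u x) \<in> HR"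
  using radially_symmetric_lin[of u u "of_real c" 0] by (simp add: HR_iff HA_scale)

lemma HR_FFS: "u \<in> HR \<Longrightarrow> u \<in> FFS" by (simp add: HR_iff HA_FFS)

sublocale HR: function_hilbert HR ip
  by unfold_locales (use HR_add HR_scale HR_FFS ip_add ip_scale ip_sym ip_nonneg in auto)

text \<open>The limit produced by \<open>form_complete\<close> takes equal values at points where all members of the sequence
do, so it is radially symmetric at every point.\<close>

lemma HR_nrm_complete: "HR.nrm_complete"
  unfolding HR.nrm_complete_def
proof (intro allI impI)
  fix u :: "nat \<Rightarrow> R3 \<Rightarrow> complex" assume "(\<forall>n. u n \<in> HR) \<and> (\<forall>e>0. \<exists>N. \<forall>i\<ge>N. \<forall>j\<ge>N. dist2 (u i) (u j) < e)"
  then have u: "\<And>n. u n \<in> HR" and c: "\<And>e. 0 < e \<Longrightarrow> \<exists>N. \<forall>i\<ge>N. \<forall>j\<ge>N. dist2 (u i) (u j) < e"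
    by auto
  have "\<exists>l r. l \<in> FFS \<and> (\<lambda>n. dist2 (u n) l) \<longlonglongrightarrow> 0
      \<and> (\<forall>x. l x = (if convergent (\<lambda>n. u (r n) x) then lim (\<lambda>n. u (r n) x) else 0))"
  proof (rule form_complete[of u])
    show "u n \<in> FFS" for n using HR_FFS[OF u] .
    show "\<exists>N. \<forall>i\<ge>N. \<forall>j\<ge>N. dist2 (u i) (u j) < e" if "0 < e" for e
      using c[OF that] .
  qed blast
  then obtain l r where l: "l \<in> FFS" "(\<lambda>n. dist2 (u n) l) \<longlonglongrightarrow> 0"
    and eq: "\<And>x. l x = (if convergent (\<lambda>n. u (r n) x) then lim (\<lambda>n. u (r n) x) else 0)"
    by blast
  have "radially_symmetric l"
    unfolding radially_symmetric_def
  proof (intro allI impI)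
    fix x y :: R3 assume "norm x = norm y"
    then have "u n x = u n y" for n
      using u[of n] unfolding HR_iff radially_symmetric_def by blast
    then show "l x = l y" unfolding eq by simp
  qed
  moreover have "l \<in> HA" using HA_complete_limit[of u l] u l by (auto simp: HR_iff)
  ultimately show "\<exists>l\<in>HR. (\<lambda>n. dist2 (u n) l) \<longlonglongrightarrow> 0"
    using l by (auto simp: HR_iff)
qed

end

locale magnetic_radial = magnetic_power +
  assumes equivariant: "\<And>(g :: real ^ 3 ^ 3) x y. orthogonal_matrix g \<Longrightarrow>
           (g *v (x - y)) \<bullet> A (g *v midpoint x y) = (x - y) \<bullet> A (midpoint x y)"
begin

text \<open>The hypothesis on \<open>A\<close> says that the phase does not change when both points are rotated.\<close>

lemma D_rotate:
  assumes g: "orthogonal_transformation g"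
  shows "D (\<lambda>x. u (g x)) x y = D u (g x) (g y)"
proof -
  have lin: "linear g" and om: "orthogonal_matrix (matrix g)"
    using g by (auto simp: orthogonal_transformation_matrix)
  have gm: "matrix g *v x = g x" for x using fun_cong[OF matrix_vector_mul(2)[OF lin]] .
  have "(g x - g y) \<bullet> A (midpoint (g x) (g y)) = (x - y) \<bullet> A (midpoint x y)"
    using equivariant[OF om, of x y] lin
    by (simp add: gm linear_diff linear_add linear_scale midpoint_def)
  then show ?thesis by (simp add: magnetic_diff_def)
qed

lemma form_integrand_rotate:
  assumes g: "orthogonal_transformation g"
  shows "form_integrand A s m (\<lambda>x. u (g x)) (\<lambda>x. v (g x)) z = form_integrand A s m u v (g (fst z), g (snd z))"
proof -
  have "norm (g (fst z) - g (snd z)) = norm (fst z - snd z)"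
    using orthogonal_transformation_norm[OF g, of "fst z - snd z"] linear_diff[OF orthogonal_transformation_linear[OF g]] by simp
  then show ?thesis by (simp add: form_integrand_eq D_rotate[OF g] bessel_kernel_def)
qed

lemma measurable_rotate:
  fixes g :: "R3 \<Rightarrow> R3"
  assumes g: "orthogonal_transformation g" and u: "u \<in> borel_measurable lebesgue"
  shows "(\<lambda>x. u (g x)) \<in> borel_measurable (lebesgue :: R3 measure)"
  using measurable_compose[OF orthogonal_measurable_lebesgue[OF g] u] .

lemma integral_rotate:
  fixes f :: "R3 \<Rightarrow> complex" and g :: "R3 \<Rightarrow> R3"
  assumes g: "orthogonal_transformation g" and f: "f \<in> borel_measurable lebesgue"
  shows "(\<integral>x. f (g x) \<partial>lebesgue) = (\<integral>x. f x \<partial>lebesgue)"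
  using integral_distr[OF orthogonal_measurable_lebesgue[OF g] f] distr_orthogonal_lebesgue[OF g] by simp

lemma ip_rotate:
  assumes g: "orthogonal_transformation g" and u: "u \<in> borel_measurable lebesgue" and v: "v \<in> borel_measurable lebesgue"
  shows "ip (\<lambda>x. u (g x)) (\<lambda>x. v (g x)) = ip u v"
proof -
  note [measurable] = u v
  have "form_nonlocal A s m (\<lambda>x. u (g x)) (\<lambda>x. v (g x)) = form_nonlocal A s m u v"
    using integral_distr[OF orthogonal_pair_measurable_lebesgue[OF g] form_integrand_measurable[OF u v]] distr_orthogonal_pair_lebesgue[OF g]
    unfolding form_nonlocal_def form_integrand_rotate[OF g] by (simp add: split_beta)
  moreover have "(\<integral>x. u (g x) * cnj (v (g x)) \<partial>lebesgue) = (\<integral>x. u x * cnj (v x) \<partial>lebesgue)"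
    by (rule integral_rotate[OF g, of "\<lambda>x. u x * cnj (v x)"]) measurable
  ultimately show ?thesis by (simp add: ip_eq)
qed

lemma FFS_rotate:
  assumes g: "orthogonal_transformation g" and u: "u \<in> FFS"
  shows "(\<lambda>x. u (g x)) \<in> FFS"
proof -
  have "integrable (distr lebesgue lebesgue (\<lambda>(x, y). (g x, g y))) (form_integrand A s m u u)"
    using u by (simp add: distr_orthogonal_pair_lebesgue[OF g] finite_form_space_def)
  then have "integrable lebesgue (\<lambda>z. form_integrand A s m u u ((\<lambda>(x, y). (g x, g y)) z))"
    by (rule integrable_distr[OF orthogonal_pair_measurable_lebesgue[OF g]])
  then have 1: "integrable lebesgue (form_integrand A s m (\<lambda>x. u (g x)) (\<lambda>x. u (g x)))"
    by (simp add: form_integrand_rotate[OF g, abs_def] split_beta)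
  have "integrable (distr lebesgue lebesgue g) (\<lambda>x. u x * cnj (u x))"
    using u by (simp add: distr_orthogonal_lebesgue[OF g] finite_form_space_def)
  then have 2: "integrable lebesgue (\<lambda>x. u (g x) * cnj (u (g x)))"
    by (rule integrable_distr[OF orthogonal_measurable_lebesgue[OF g]])
  show ?thesis
    using 1 2 measurable_rotate[OF g FFS_measurable[OF u]] by (simp add: finite_form_space_def)
qed

lemma HA_rotate:
  assumes g: "orthogonal_transformation g" and u: "u \<in> HA"
  shows "(\<lambda>x. u (g x)) \<in> HA"
  unfolding HA_iff
proof (intro conjI allI impI)
  show "(\<lambda>x. u (g x)) \<in> FFS" using FFS_rotate[OF g HA_FFS[OF u]] .
  fix \<epsilon> :: real assume "0 < \<epsilon>"
  then obtain \<phi> where \<phi>: "\<phi> \<in> test_functions" "\<phi> \<in> FFS" "sqrt (dist2 u \<phi>) < \<epsilon>"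
    using HA_approx[OF u] by blast
  have dm: "(\<lambda>x. u x - \<phi> x) \<in> borel_measurable lebesgue"
    using FFS_measurable[OF FFS.diff_closed[OF HA_FFS[OF u] \<phi>(2)]] .
  show "\<exists>\<phi>\<in>test_functions \<inter> FFS. sqrt (ip (\<lambda>x. u (g x) - \<phi> x) (\<lambda>x. u (g x) - \<phi> x)) < \<epsilon>"
    using \<phi> ip_rotate[OF g dm dm] test_functions_rotate[OF g \<phi>(1)] FFS_rotate[OF g \<phi>(2)]
    by (intro bexI[of _ "\<lambda>x. \<phi> (g x)"]) auto
qed

lemma R_rotate:
  assumes g: "orthogonal_transformation g" and u: "u \<in> FFS" and v: "v \<in> FFS"
  shows "R (\<lambda>x. u (g x)) (\<lambda>x. v (g x)) = R u v"
  unfolding R_def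
  using integral_rotate[OF g borel_measurable_integrable[OF R_integrable[OF u v]]] by simp

end

section \<open>Sparse sets and local oscillation\<close>

lemma power2_cmod_add_le: "(cmod (a + b))\<^sup>2 \<le> 2 * (cmod a)\<^sup>2 + 2 * (cmod b)\<^sup>2"
proof -
  have "(cmod (a + b))\<^sup>2 \<le> (cmod a + cmod b)\<^sup>2"
    by (intro power_mono norm_triangle_ineq) auto
  also have "\<dots> \<le> 2 * (cmod a)\<^sup>2 + 2 * (cmod b)\<^sup>2"
    using sum_squares_bound[of "cmod a" "cmod b"] by (simp add: power2_sum)
  finally show ?thesis .
qed

lemma separated_directions:
  obtains P :: "R3 set" and \<delta> :: real
  where "finite P" "card P = N" "\<And>q. q \<in> P \<Longrightarrow> norm q = 1" "0 < \<delta>"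
    "\<And>q q'. q \<in> P \<Longrightarrow> q' \<in> P \<Longrightarrow> q \<noteq> q' \<Longrightarrow> \<delta> \<le> dist q q'"
proof -
  have "infinite (sphere (0 :: R3) 1)"
  proof
    assume "finite (sphere (0 :: R3) 1)"
    moreover have "connected (sphere (0 :: R3) 1)"
      by (intro connected_sphere) simp
    ultimately have "sphere (0 :: R3) 1 = {} \<or> (\<exists>a. sphere (0 :: R3) 1 = {a})"
      by (simp add: connected_finite_iff_sing)
    moreover have "axis 1 1 \<in> sphere (0 :: R3) 1" "- axis 1 1 \<in> sphere (0 :: R3) 1"
      by (auto simp: norm_axis_1)
    moreover have "axis 1 1 \<noteq> (- axis 1 1 :: R3)"
      by (auto simp: vec_eq_iff axis_def)
    ultimately show False by (metis singletonD empty_iff)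
  qed
  then obtain P :: "R3 set" where P: "finite P" "card P = N" "P \<subseteq> sphere 0 1"
    using infinite_arbitrarily_large by blast
  define E where "E = insert 1 ((\<lambda>(x, y). dist x y) ` {z \<in> P \<times> P. fst z \<noteq> snd z})"
  have fE: "finite E" using P(1) by (simp add: E_def)
  have "\<forall>e\<in>E. 0 < e" by (auto simp: E_def)
  then have "0 < Min E" using fE by (subst Min_gr_iff) (auto simp: E_def)
  moreover have "Min E \<le> dist q q'" if "q \<in> P" "q' \<in> P" "q \<noteq> q'" for q q'
    using that fE by (intro Min_le) (auto simp: E_def image_iff intro!: bexI[of _ "(q, q')"])
  ultimately show ?thesis
    using P by (intro that[of P "Min E"]) auto
qed

text \<open>Far from the origin a ball has \<open>N\<close> disjoint rotated copies. All of them meet \<open>S\<close> in sets of the same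
measure, so each carries at most one \<open>N\<close>-th of \<open>S\<close>.\<close>

lemma rotation_invariant_set_sparse_far_out:
  assumes "0 < r"
  obtains R0 where "0 < R0"
    "\<And>S x. S \<in> sets (lebesgue :: R3 measure) \<Longrightarrow> (\<And>y z. norm y = norm z \<Longrightarrow> y \<in> S \<longleftrightarrow> z \<in> S) \<Longrightarrow> R0 \<le> norm x \<Longrightarrow>
       of_nat N * emeasure lebesgue (ball x r \<inter> S) \<le> emeasure lebesgue S"
proof -
  obtain P :: "R3 set" and \<delta> where P: "finite P" "card P = N" "\<And>q. q \<in> P \<Longrightarrow> norm q = 1" "0 < \<delta>"
    "\<And>q q'. q \<in> P \<Longrightarrow> q' \<in> P \<Longrightarrow> q \<noteq> q' \<Longrightarrow> \<delta> \<le> dist q q'"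
    using separated_directions[of N] by blast
  show ?thesis
  proof (rule that[of "2 * r / \<delta>"])
    show "0 < 2 * r / \<delta>" using assms P(4) by simp
    fix S :: "R3 set" and x :: R3
    assume S [measurable]: "S \<in> sets lebesgue" and inv: "\<And>y z. norm y = norm z \<Longrightarrow> y \<in> S \<longleftrightarrow> z \<in> S"
      and x: "2 * r / \<delta> \<le> norm x"
    define B where "B q = ball (norm x *\<^sub>R q) r \<inter> S" for q
    have Bm [measurable]: "B q \<in> sets lebesgue" for q unfolding B_def by (intro sets.Int S) simp
    have eq: "emeasure lebesgue (B q) = emeasure lebesgue (ball x r \<inter> S)" if "q \<in> P" for q
    proof -
      have "norm (norm x *\<^sub>R q) = norm x" using P(3)[OF that] by simp
      then obtain g where g: "orthogonal_transformation g" "g (norm x *\<^sub>R q) = x"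
        using orthogonal_transformation_exists by blast
      have "g -` (ball x r \<inter> S) = B q"
      proof -
        have "dist x (g y) = dist (norm x *\<^sub>R q) y" for y
        proof -
          have "dist (g (norm x *\<^sub>R q)) (g y) = dist (norm x *\<^sub>R q) y"
            using g(1) by (simp add: orthogonal_transformation_isometry)
          then show ?thesis using g(2) by simp
        qed
        moreover have "g y \<in> S \<longleftrightarrow> y \<in> S" for y
          by (rule inv) (rule orthogonal_transformation_norm[OF g(1)])
        ultimately show ?thesis by (auto simp: B_def)
      qed
      moreover have "emeasure (distr lebesgue lebesgue g) (ball x r \<inter> S) = emeasure lebesgue (g -` (ball x r \<inter> S))"
        by (subst emeasure_distr[OF orthogonal_measurable_lebesgue[OF g(1)]]) auto
      ultimately show ?thesis by (simp add: distr_orthogonal_lebesgue[OF g(1)])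
    qed
    have disj: "disjoint_family_on B P"
      unfolding disjoint_family_on_def
    proof (intro ballI impI)
      fix q q' assume q: "q \<in> P" "q' \<in> P" "q \<noteq> q'"
      have "2 * r \<le> norm x * \<delta>" using x P(4) by (simp add: field_simps)
      also have "\<dots> \<le> norm x * dist q q'" using P(5)[OF q] by (intro mult_left_mono) auto
      also have "\<dots> = dist (norm x *\<^sub>R q) (norm x *\<^sub>R q')" by (simp add: dist_norm flip: scaleR_right_diff_distrib)
      finally have "ball (norm x *\<^sub>R q) r \<inter> ball (norm x *\<^sub>R q') r = {}"
        by (intro disjoint_ballI) simp
      then show "B q \<inter> B q' = {}" by (auto simp: B_def)
    qed
    have "of_nat N * emeasure lebesgue (ball x r \<inter> S) = (\<Sum>q\<in>P. emeasure lebesgue (B q))"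
      using eq P(2) by simp
    also have "\<dots> = emeasure lebesgue (\<Union>q\<in>P. B q)"
      using disj P(1) by (intro sum_emeasure) auto
    also have "\<dots> \<le> emeasure lebesgue S"
      by (intro emeasure_mono S) (auto simp: B_def)
    finally show "of_nat N * emeasure lebesgue (ball x r \<inter> S) \<le> emeasure lebesgue S" .
  qed
qed

text \<open>Expand the square \<open>|f x - f y|\<^sup>2\<close> and integrate first over \<open>y\<close>, then over \<open>x\<close>.\<close>

lemma (in finite_measure) variance_identity:
  fixes f :: "'a \<Rightarrow> complex"
  assumes [measurable]: "f \<in> borel_measurable M" and sq: "integrable M (\<lambda>x. (cmod (f x))\<^sup>2)"
  shows "integrable M f"
    and "(\<integral>x. \<integral>y. (cmod (f x - f y))\<^sup>2 \<partial>M \<partial>M) = 2 * measure M (space M) * (\<integral>x. (cmod (f x))\<^sup>2 \<partial>M) - 2 * (cmod (\<integral>x. f x \<partial>M))\<^sup>2"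
    and "integrable M (\<lambda>x. \<integral>y. (cmod (f x - f y))\<^sup>2 \<partial>M)"
    and "integrable M (\<lambda>y. (cmod (f x - f y))\<^sup>2)"
proof -
  show f: "integrable M f"
  proof (rule Bochner_Integration.integrable_bound)
    show "integrable M (\<lambda>x. 1 + (cmod (f x))\<^sup>2)" using sq by simp
    have "cmod a \<le> 1 + (cmod a)\<^sup>2" for a
    proof (cases "cmod a \<le> 1")
      case False
      then have "cmod a * 1 \<le> cmod a * cmod a" by (intro mult_left_mono) auto
      then show ?thesis by (simp add: power2_eq_square)
    qed (simp add: add_increasing2)
    then show "AE x in M. norm (f x) \<le> norm (1 + (cmod (f x))\<^sup>2)" by (simp add: abs_of_nonneg add_nonneg_nonneg)
  qed simp
  define F where "F = (\<integral>x. f x \<partial>M)"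
  define S where "S = (\<integral>x. (cmod (f x))\<^sup>2 \<partial>M)"
  define \<mu> where "\<mu> = measure M (space M)"
  have expand: "(cmod (a - b))\<^sup>2 = (cmod a)\<^sup>2 + (cmod b)\<^sup>2 - 2 * Re (cnj a * b)" for a b
    unfolding cmod_power2 by (simp add: power2_eq_square algebra_simps)
  have inner_int: "integrable M (\<lambda>y. (cmod (a - f y))\<^sup>2)" for a
    unfolding expand using f sq by (intro Bochner_Integration.integrable_diff Bochner_Integration.integrable_add integrable_mult_right integrable_Re) auto
  show "integrable M (\<lambda>y. (cmod (f x - f y))\<^sup>2)" by (rule inner_int)
  have inner: "(\<integral>y. (cmod (a - f y))\<^sup>2 \<partial>M) = \<mu> * (cmod a)\<^sup>2 + S - 2 * Re (cnj a * F)" for a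
  proof -
    have i: "integrable M (\<lambda>y. (cmod a)\<^sup>2 + (cmod (f y))\<^sup>2)" "integrable M (\<lambda>y. cnj a * f y)" using f sq by auto
    have "(\<integral>y. (cmod (a - f y))\<^sup>2 \<partial>M) = (\<integral>y. (cmod a)\<^sup>2 + (cmod (f y))\<^sup>2 \<partial>M) - (\<integral>y. 2 * Re (cnj a * f y) \<partial>M)"
      unfolding expand by (intro Bochner_Integration.integral_diff i integrable_mult_right integrable_Re)
    also have "(\<integral>y. (cmod a)\<^sup>2 + (cmod (f y))\<^sup>2 \<partial>M) = \<mu> * (cmod a)\<^sup>2 + S"
      using sq by (simp add: S_def \<mu>_def)
    also have "(\<integral>y. 2 * Re (cnj a * f y) \<partial>M) = 2 * Re (cnj a * F)"
      using integral_Re[OF i(2)] f by (simp add: F_def del: complex_cnj_cancel_iff times_complex.simps)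
    finally show ?thesis .
  qed
  have i2: "integrable M (\<lambda>x. \<mu> * (cmod (f x))\<^sup>2 + S)" "integrable M (\<lambda>x. cnj (f x) * F)" using f sq by auto
  show "integrable M (\<lambda>x. \<integral>y. (cmod (f x - f y))\<^sup>2 \<partial>M)"
    unfolding inner using i2 by (intro Bochner_Integration.integrable_diff integrable_mult_right integrable_Re)
  have "(\<integral>x. \<integral>y. (cmod (f x - f y))\<^sup>2 \<partial>M \<partial>M) = (\<integral>x. \<mu> * (cmod (f x))\<^sup>2 + S \<partial>M) - (\<integral>x. 2 * Re (cnj (f x) * F) \<partial>M)"
    unfolding inner using i2 by (intro Bochner_Integration.integral_diff integrable_mult_right integrable_Re)
  also have "(\<integral>x. \<mu> * (cmod (f x))\<^sup>2 + S \<partial>M) = \<mu> * S + \<mu> * S"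
    using sq by (simp add: S_def \<mu>_def)
  also have "(\<integral>x. 2 * Re (cnj (f x) * F) \<partial>M) = 2 * (\<integral>x. Re (cnj (f x) * F) \<partial>M)"
    by (rule integral_mult_right_zero)
  also have "(\<integral>x. Re (cnj (f x) * F) \<partial>M) = Re (\<integral>x. cnj (f x) * F \<partial>M)"
    by (rule integral_Re[OF i2(2)])
  also have "(\<integral>x. cnj (f x) * F \<partial>M) = cnj F * F"
    using f by (simp add: F_def)
  also have "Re (cnj F * F) = (cmod F)\<^sup>2"
    unfolding cmod_power2 by (simp add: power2_eq_square)
  finally show "(\<integral>x. \<integral>y. (cmod (f x - f y))\<^sup>2 \<partial>M \<partial>M) = 2 * measure M (space M) * (\<integral>x. (cmod (f x))\<^sup>2 \<partial>M) - 2 * (cmod (\<integral>x. f x \<partial>M))\<^sup>2"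
    by (simp add: F_def S_def \<mu>_def)
qed

lemma (in finite_measure) cmod_integral_square_le:
  fixes f :: "'a \<Rightarrow> complex"
  assumes "f \<in> borel_measurable M" "integrable M (\<lambda>x. (cmod (f x))\<^sup>2)"
  shows "(cmod (\<integral>x. f x \<partial>M))\<^sup>2 \<le> measure M (space M) * (\<integral>x. (cmod (f x))\<^sup>2 \<partial>M)"
proof -
  have "0 \<le> (\<integral>x. \<integral>y. (cmod (f x - f y))\<^sup>2 \<partial>M \<partial>M)" by (intro integral_nonneg_AE AE_I2) auto
  then show ?thesis unfolding variance_identity(2)[OF assms] by simp
qed

lemma finite_measure_restrict_lborel:
  assumes [measurable]: "B \<in> sets borel" and "emeasure lborel B < \<infinity>"
  shows "finite_measure (restrict_space lborel B)"
  by (rule finite_measureI) (use assms in \<open>simp add: emeasure_restrict_space space_restrict_space less_top\<close>)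

lemma cell_variance:
  fixes f :: "'a::euclidean_space \<Rightarrow> complex"
  assumes f [measurable]: "f \<in> borel_measurable borel" and B [measurable]: "B \<in> sets borel"
    and fin: "emeasure lborel B < \<infinity>"
    and sq: "(\<integral>\<^sup>+x\<in>B. esq (f x) \<partial>lborel) < \<infinity>"
  shows "2 * emeasure lborel B * (\<integral>\<^sup>+x\<in>B. esq (f x) \<partial>lborel)
    = (\<integral>\<^sup>+x\<in>B. (\<integral>\<^sup>+y\<in>B. esq (f x - f y) \<partial>lborel) \<partial>lborel)
      + ennreal (2 * (cmod (\<integral>x. indicator B x *\<^sub>R f x \<partial>lborel))\<^sup>2)"
    and "esq (\<integral>x. indicator B x *\<^sub>R f x \<partial>lborel) \<le> emeasure lborel B * (\<integral>\<^sup>+x\<in>B. esq (f x) \<partial>lborel)"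
    and "integrable lborel (\<lambda>x. indicator B x *\<^sub>R f x)"
proof -
  let ?M = "restrict_space lborel B"
  interpret finite_measure ?M by (rule finite_measure_restrict_lborel[OF B fin])
  have fM [measurable]: "f \<in> borel_measurable ?M" by (rule measurable_restrict_space1) simp
  have nnr: "(\<integral>\<^sup>+x. h x \<partial>?M) = (\<integral>\<^sup>+x\<in>B. h x \<partial>lborel)" for h :: "'a \<Rightarrow> ennreal"
    by (rule nn_integral_restrict_space) simp
  have sqM: "integrable ?M (\<lambda>x. (cmod (f x))\<^sup>2)"
    using sq by (intro integrableI_nonneg) (auto simp: nnr)
  note V = variance_identity[OF fM sqM]
  have S: "ennreal (\<integral>x. (cmod (f x))\<^sup>2 \<partial>?M) = (\<integral>\<^sup>+x\<in>B. esq (f x) \<partial>lborel)"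
    using nn_integral_eq_integral[OF sqM] by (simp add: nnr)
  have \<mu>: "ennreal (measure ?M (space ?M)) = emeasure lborel B"
    using emeasure_eq_measure[of "space ?M"] by (simp add: emeasure_restrict_space space_restrict_space)
  have F: "(\<integral>x. f x \<partial>?M) = (\<integral>x. indicator B x *\<^sub>R f x \<partial>lborel)"
    by (rule integral_restrict_space) simp
  have "ennreal (\<integral>x. \<integral>y. (cmod (f x - f y))\<^sup>2 \<partial>?M \<partial>?M) = (\<integral>\<^sup>+x. ennreal (\<integral>y. (cmod (f x - f y))\<^sup>2 \<partial>?M) \<partial>?M)"
    by (rule nn_integral_eq_integral[symmetric, OF V(3)]) (auto intro!: integral_nonneg_AE)
  also have "\<dots> = (\<integral>\<^sup>+x. (\<integral>\<^sup>+y\<in>B. esq (f x - f y) \<partial>lborel) \<partial>?M)"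
    by (intro nn_integral_cong, subst nn_integral_eq_integral[symmetric, OF V(4)]) (auto simp: nnr)
  finally have I: "ennreal (\<integral>x. \<integral>y. (cmod (f x - f y))\<^sup>2 \<partial>?M \<partial>?M)
     = (\<integral>\<^sup>+x\<in>B. (\<integral>\<^sup>+y\<in>B. esq (f x - f y) \<partial>lborel) \<partial>lborel)"
    by (simp add: nnr)
  have "2 * measure ?M (space ?M) * (\<integral>x. (cmod (f x))\<^sup>2 \<partial>?M) = (\<integral>x. \<integral>y. (cmod (f x - f y))\<^sup>2 \<partial>?M \<partial>?M) + 2 * (cmod (\<integral>x. f x \<partial>?M))\<^sup>2"
    using V(2) by simp
  then have "ennreal (2 * measure ?M (space ?M) * (\<integral>x. (cmod (f x))\<^sup>2 \<partial>?M)) = ennreal (\<integral>x. \<integral>y. (cmod (f x - f y))\<^sup>2 \<partial>?M \<partial>?M) + ennreal (2 * (cmod (\<integral>x. f x \<partial>?M))\<^sup>2)"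
    by (subst ennreal_plus[symmetric]) (auto intro!: integral_nonneg_AE)
  moreover have "ennreal (2 * measure ?M (space ?M) * (\<integral>x. (cmod (f x))\<^sup>2 \<partial>?M)) = 2 * emeasure lborel B * (\<integral>\<^sup>+x\<in>B. esq (f x) \<partial>lborel)"
    unfolding S[symmetric] \<mu>[symmetric] by (simp add: ennreal_mult')
  ultimately show "2 * emeasure lborel B * (\<integral>\<^sup>+x\<in>B. esq (f x) \<partial>lborel)
    = (\<integral>\<^sup>+x\<in>B. (\<integral>\<^sup>+y\<in>B. esq (f x - f y) \<partial>lborel) \<partial>lborel)
      + ennreal (2 * (cmod (\<integral>x. indicator B x *\<^sub>R f x \<partial>lborel))\<^sup>2)"
    by (simp only: I F)
  have "esq (\<integral>x. f x \<partial>?M) \<le> ennreal (measure ?M (space ?M) * (\<integral>x. (cmod (f x))\<^sup>2 \<partial>?M))"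
    by (intro ennreal_leI cmod_integral_square_le fM sqM)
  also have "\<dots> = emeasure lborel B * (\<integral>\<^sup>+x\<in>B. esq (f x) \<partial>lborel)"
    unfolding S[symmetric] \<mu>[symmetric] by (simp add: ennreal_mult')
  finally show "esq (\<integral>x. indicator B x *\<^sub>R f x \<partial>lborel) \<le> emeasure lborel B * (\<integral>\<^sup>+x\<in>B. esq (f x) \<partial>lborel)"
    by (simp only: F)
  show "integrable lborel (\<lambda>x. indicator B x *\<^sub>R f x)"
    using V(1) by (subst (asm) integrable_restrict_space) auto
qed

context magnetic begin

lemma phase_bound:
  assumes "norm (A (midpoint x y)) \<le> a"
  shows "cmod (exp (\<i> * of_real (- ((x - y) \<bullet> A (midpoint x y)))) - 1) \<le> dist x y * a"
proof -
  let ?\<theta> = "- ((x - y) \<bullet> A (midpoint x y))"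
  have "cmod (exp (\<i> * of_real ?\<theta>) - 1) \<le> \<bar>?\<theta>\<bar>"
    unfolding dist_exp_i_1 using abs_sin_x_le_abs_x[of "?\<theta> / 2"] by linarith
  also have "\<bar>?\<theta>\<bar> \<le> norm (x - y) * norm (A (midpoint x y))"
    using Cauchy_Schwarz_ineq2 by simp
  also have "\<dots> \<le> dist x y * a"
    using assms by (simp add: dist_norm mult_left_mono)
  finally show ?thesis .
qed

text \<open>The plain difference differs from the magnetic one by \<open>|u x|\<close> times the distance of the phase factor from 1,
which is of first order in \<open>|x - y|\<close> where \<open>A\<close> is bounded.\<close>

lemma D_oscillation:
  assumes "norm (A (midpoint x y)) \<le> a"
  shows "(cmod (u x - u y))\<^sup>2 \<le> 2 * (cmod (D u x y))\<^sup>2 + 2 * (dist x y * a)\<^sup>2 * (cmod (u x))\<^sup>2"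
proof -
  define \<theta> where "\<theta> = - ((x - y) \<bullet> A (midpoint x y))"
  have D: "D u x y = exp (\<i> * of_real \<theta>) * u x - u y"
    by (simp add: magnetic_diff_def \<theta>_def)
  have "cmod (exp (\<i> * of_real \<theta>) - 1) \<le> dist x y * a"
    unfolding \<theta>_def using assms by (rule phase_bound)
  then have e: "(cmod ((1 - exp (\<i> * of_real \<theta>)) * u x))\<^sup>2 \<le> (dist x y * a)\<^sup>2 * (cmod (u x))\<^sup>2"
    unfolding norm_mult power_mult_distrib[of "cmod (1 - exp (\<i> * of_real \<theta>))"]
    by (intro mult_right_mono power_mono) (auto simp: norm_minus_commute)
  have "u x - u y = D u x y + (1 - exp (\<i> * of_real \<theta>)) * u x"
    by (simp add: D algebra_simps)
  then have "(cmod (u x - u y))\<^sup>2 \<le> 2 * (cmod (D u x y))\<^sup>2 + 2 * (cmod ((1 - exp (\<i> * of_real \<theta>)) * u x))\<^sup>2"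
    using power2_cmod_add_le by metis
  with e show ?thesis by simp
qed

lemma A_bounded_on_ball:
  obtains a where "0 \<le> a" "\<And>x. norm x \<le> b \<Longrightarrow> norm (A x) \<le> a"
proof -
  have "compact (A ` cball 0 b)"
    using continuous_A by (intro compact_continuous_image) (auto intro: continuous_on_subset)
  then have "bounded (A ` cball 0 b)" by (rule compact_imp_bounded)
  then obtain a where "\<forall>y\<in>A ` cball 0 b. norm y \<le> a" by (auto simp: bounded_iff)
  then show ?thesis by (intro that[of "max a 0"]) (auto simp: le_max_iff_disj)
qed

text \<open>The first term in \<open>D_oscillation\<close> is bounded by the energy near the diagonal. The second contributes \<open>h ^ 5\<close> times
the mass, and \<open>h ^ 5 \<le> h powr (3 + 2 * s)\<close> since \<open>h \<le> 1\<close> and \<open>s < 1\<close>.\<close>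

lemma local_oscillation:
  fixes b T :: real
  assumes T: "0 < T"
  obtains C where "0 < C" "\<And>u h. u \<in> borel_measurable borel \<Longrightarrow> nonlocal u \<le> ennreal T \<Longrightarrow> mass u \<le> ennreal T \<Longrightarrow> 0 < h \<Longrightarrow> h \<le> 1 \<Longrightarrow>
    (\<integral>\<^sup>+x\<in>ball 0 b. (\<integral>\<^sup>+y\<in>ball x h. esq (u x - u y) \<partial>lborel) \<partial>lborel) \<le> ennreal (C * h powr (3 + 2 * s))"
proof -
  obtain a where a: "0 \<le> a" "\<And>x. norm x \<le> b + 1 \<Longrightarrow> norm (A x) \<le> a"
    using A_bounded_on_ball by blast
  obtain C where C: "0 < C" "\<And>u r. u \<in> borel_measurable borel \<Longrightarrow> 0 < r \<Longrightarrow> r \<le> 1 \<Longrightarrow>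
    (\<integral>\<^sup>+x. (\<integral>\<^sup>+y\<in>ball x r. esq (D u x y) \<partial>lborel) \<partial>lborel) \<le> ennreal (C * r powr (3 + 2 * s)) * nonlocal u"
    using near_diagonal_energy[of 1] by auto
  show ?thesis
  proof (rule that[of "2 * C * T + 2 * a\<^sup>2 * ball_vol * T"])
    show "0 < 2 * C * T + 2 * a\<^sup>2 * ball_vol * T"
      using C T ball_vol_pos by (intro add_pos_nonneg) auto
    fix u :: "R3 \<Rightarrow> complex" and h :: real
    assume u [measurable]: "u \<in> borel_measurable borel" and nl: "nonlocal u \<le> ennreal T" and ms: "mass u \<le> ennreal T"
      and h: "0 < h" "h \<le> 1"
    have pt: "esq (u x - u y) * indicator (ball x h) y * indicator (ball 0 b) x
        \<le> 2 * (esq (D u x y) * indicator (ball x h) y) + ennreal (2 * (h * a)\<^sup>2) * esq (u x) * indicator (ball x h) y" for x y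
    proof (cases "y \<in> ball x h \<and> x \<in> ball 0 b")
      case True
      have "midpoint x y = x + (1 / 2) *\<^sub>R (y - x)"
        by (simp add: vec_eq_iff midpoint_def field_simps)
      then have "norm (midpoint x y) \<le> norm x + norm ((1 / 2) *\<^sub>R (y - x))"
        by (metis norm_triangle_ineq)
      also have "\<dots> \<le> b + 1"
        using True h by (simp add: dist_norm norm_minus_commute)
      finally have "(cmod (u x - u y))\<^sup>2 \<le> 2 * (cmod (D u x y))\<^sup>2 + 2 * (dist x y * a)\<^sup>2 * (cmod (u x))\<^sup>2"
        by (intro D_oscillation a(2))
      also have "\<dots> \<le> 2 * (cmod (D u x y))\<^sup>2 + 2 * (h * a)\<^sup>2 * (cmod (u x))\<^sup>2"
        using True a(1) by (intro add_left_mono mult_right_mono mult_left_mono power_mono) auto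
      finally have "esq (u x - u y) \<le> ennreal (2 * (cmod (D u x y))\<^sup>2 + 2 * (h * a)\<^sup>2 * (cmod (u x))\<^sup>2)"
        by (rule ennreal_leI)
      also have "\<dots> = 2 * esq (D u x y) + ennreal (2 * (h * a)\<^sup>2) * esq (u x)"
        by (subst ennreal_plus) (auto simp: ennreal_mult)
      finally show ?thesis using True by simp
    qed auto
    have "(\<integral>\<^sup>+x\<in>ball 0 b. (\<integral>\<^sup>+y\<in>ball x h. esq (u x - u y) \<partial>lborel) \<partial>lborel)
      = (\<integral>\<^sup>+x. (\<integral>\<^sup>+y. esq (u x - u y) * indicator (ball x h) y * indicator (ball 0 b) x \<partial>lborel) \<partial>lborel)"
    proof (intro nn_integral_cong nn_integral_multc[symmetric])
      fix x :: R3
      note [measurable] = borel_open[OF open_ball, of x h]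
      show "(\<lambda>y. esq (u x - u y) * indicator (ball x h) y) \<in> borel_measurable lborel"
        by measurable
    qed
    also have "\<dots> \<le> (\<integral>\<^sup>+x. (\<integral>\<^sup>+y. 2 * (esq (D u x y) * indicator (ball x h) y) + ennreal (2 * (h * a)\<^sup>2) * esq (u x) * indicator (ball x h) y \<partial>lborel) \<partial>lborel)"
      by (intro nn_integral_mono pt)
    also have "\<dots> = (\<integral>\<^sup>+x. 2 * (\<integral>\<^sup>+y\<in>ball x h. esq (D u x y) \<partial>lborel) + ennreal (2 * (h * a)\<^sup>2) * esq (u x) * ennreal (ball_vol * h ^ 3) \<partial>lborel)"
    proof (intro nn_integral_cong)
      fix x
      note [measurable] = borel_open[OF open_ball, of x h]
      have [measurable]: "(\<lambda>y. esq (D u x y) * indicator (ball x h) y) \<in> borel_measurable borel" by measurable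
      show "(\<integral>\<^sup>+y. 2 * (esq (D u x y) * indicator (ball x h) y) + ennreal (2 * (h * a)\<^sup>2) * esq (u x) * indicator (ball x h) y \<partial>lborel)
        = 2 * (\<integral>\<^sup>+y\<in>ball x h. esq (D u x y) \<partial>lborel) + ennreal (2 * (h * a)\<^sup>2) * esq (u x) * ennreal (ball_vol * h ^ 3)"
        using h by (subst nn_integral_add) (auto simp: nn_integral_cmult nn_integral_cmult_indicator emeasure_ball_R3)
    qed
    also have "\<dots> = 2 * (\<integral>\<^sup>+x. (\<integral>\<^sup>+y\<in>ball x h. esq (D u x y) \<partial>lborel) \<partial>lborel) + ennreal (2 * (h * a)\<^sup>2) * mass u * ennreal (ball_vol * h ^ 3)"
    proof -
      have m: "(\<lambda>z. esq (D u (fst z) (snd z)) * indicator (ball (fst z) h) (snd z)) \<in> borel_measurable (lborel \<Otimes>\<^sub>M lborel)"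
        unfolding indicator_def ball_def mem_Collect_eq by measurable
      have [measurable]: "(\<lambda>x. \<integral>\<^sup>+y\<in>ball x h. esq (D u x y) \<partial>lborel) \<in> borel_measurable borel"
        using lborel.borel_measurable_nn_integral_fst[OF m] by simp
      show ?thesis
        unfolding mass_borel by (subst nn_integral_add) (auto simp: nn_integral_cmult nn_integral_multc)
    qed
    also have "\<dots> \<le> 2 * (ennreal (C * h powr (3 + 2 * s)) * ennreal T) + ennreal (2 * (h * a)\<^sup>2) * ennreal T * ennreal (ball_vol * h ^ 3)"
      using order_trans[OF C(2)[OF u h] mult_left_mono[OF nl]] ms
      by (intro add_mono mult_left_mono mult_right_mono) auto
    also have "\<dots> = ennreal (2 * (C * h powr (3 + 2 * s) * T) + 2 * (h * a)\<^sup>2 * T * (ball_vol * h ^ 3))"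
      using C(1) T ball_vol_pos h by (subst ennreal_plus) (auto simp: ennreal_mult)
    also have "\<dots> \<le> ennreal ((2 * C * T + 2 * a\<^sup>2 * ball_vol * T) * h powr (3 + 2 * s))"
    proof (intro ennreal_leI)
      have "h ^ 5 = h powr 5" using h by simp
      also have "h powr 5 \<le> h powr (3 + 2 * s)"
        using h s_less_1 by (intro powr_mono') auto
      finally have "2 * a\<^sup>2 * ball_vol * T * h ^ 5 \<le> 2 * a\<^sup>2 * ball_vol * T * h powr (3 + 2 * s)"
        using T ball_vol_pos by (intro mult_left_mono) auto
      moreover have "2 * (h * a)\<^sup>2 * T * (ball_vol * h ^ 3) = 2 * a\<^sup>2 * ball_vol * T * h ^ 5"
        by (simp add: power2_eq_square power3_eq_cube eval_nat_numeral)
      ultimately show "2 * (C * h powr (3 + 2 * s) * T) + 2 * (h * a)\<^sup>2 * T * (ball_vol * h ^ 3) \<le> (2 * C * T + 2 * a\<^sup>2 * ball_vol * T) * h powr (3 + 2 * s)"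
        by (simp add: algebra_simps)
    qed
    finally show "(\<integral>\<^sup>+x\<in>ball 0 b. (\<integral>\<^sup>+y\<in>ball x h. esq (u x - u y) \<partial>lborel) \<partial>lborel) \<le> ennreal ((2 * C * T + 2 * a\<^sup>2 * ball_vol * T) * h powr (3 + 2 * s))" .
  qed
qed

end

section \<open>Local compactness by averaging over cells\<close>

text \<open>The cells of scale \<open>n\<close> are half-open cubes of side \<open>1 / (3 * (n + 1))\<close>; the factor 3 keeps their diameter below
\<open>1 / (n + 1)\<close>. The scale is part of the index, so that the cells of all scales form one countable family.\<close>

definition cell_index :: "nat \<Rightarrow> R3 \<Rightarrow> nat \<times> int \<times> int \<times> int" where
  "cell_index n x = (n, \<lfloor>x $ 1 * (3 * (real n + 1))\<rfloor>, \<lfloor>x $ 2 * (3 * (real n + 1))\<rfloor>, \<lfloor>x $ 3 * (3 * (real n + 1))\<rfloor>)"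

definition cell :: "nat \<times> int \<times> int \<times> int \<Rightarrow> R3 set" where
  "cell k = {x. cell_index (fst k) x = k}"

lemma cell_borel [measurable]: "cell k \<in> sets borel"
proof -
  obtain n a b c where k: "k = (n, a, b, c)" by (cases k) auto
  have [measurable]: "(\<lambda>x :: R3. x $ i) \<in> borel_measurable borel" for i
    by (intro borel_measurable_continuous_onI continuous_intros)
  show ?thesis unfolding k cell_def cell_index_def by simp
qed

lemma floor_eq_if_in_cell:
  fixes t N :: real
  assumes "0 < N" "of_int a * (1 / N) < t" "t < of_int a * (1 / N) + 1 / N"
  shows "\<lfloor>t * N\<rfloor> = a"
  using assms by (intro floor_unique) (simp_all add: field_simps)

lemma emeasure_cell: "emeasure lborel (cell (n, a, b, c)) = ennreal ((1 / (3 * (real n + 1))) ^ 3)"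
proof (rule antisym)
  let ?h = "1 / (3 * (real n + 1))"
  define l :: R3 where "l = vector [of_int a * ?h, of_int b * ?h, of_int c * ?h]"
  define u :: R3 where "u = l + (\<chi> i. ?h)"
  have h: "0 < ?h" by simp
  have ul: "(u - l) \<bullet> v = ?h" if "v \<in> Basis" for v
    using that by (auto simp: u_def Basis_vec_def inner_axis)
  have lu: "l \<bullet> v \<le> u \<bullet> v" if "v \<in> Basis" for v
  proof -
    have "u \<bullet> v - l \<bullet> v = ?h" using ul[OF that] by (simp only: inner_diff_left)
    with h show ?thesis by linarith
  qed
  have prod: "(\<Prod>v\<in>(Basis :: R3 set). (u - l) \<bullet> v) = ?h ^ 3"
    using ul by simp
  have sub1: "box l u \<subseteq> cell (n, a, b, c)"
  proof
    fix x assume "x \<in> box l u"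
    then have "of_int a * ?h < x $ 1 \<and> x $ 1 < of_int a * ?h + ?h" "of_int b * ?h < x $ 2 \<and> x $ 2 < of_int b * ?h + ?h"
      "of_int c * ?h < x $ 3 \<and> x $ 3 < of_int c * ?h + ?h"
      unfolding mem_box_cart forall_3 u_def l_def by simp_all
    then have "\<lfloor>x $ 1 * (3 * (real n + 1))\<rfloor> = a" "\<lfloor>x $ 2 * (3 * (real n + 1))\<rfloor> = b" "\<lfloor>x $ 3 * (3 * (real n + 1))\<rfloor> = c"
      by (intro floor_eq_if_in_cell; simp)+
    then show "x \<in> cell (n, a, b, c)"
      by (simp add: cell_def cell_index_def)
  qed
  have sub2: "cell (n, a, b, c) \<subseteq> cbox l u"
  proof
    fix x assume "x \<in> cell (n, a, b, c)"
    then have e: "\<lfloor>x $ 1 * (3 * (real n + 1))\<rfloor> = a" "\<lfloor>x $ 2 * (3 * (real n + 1))\<rfloor> = b" "\<lfloor>x $ 3 * (3 * (real n + 1))\<rfloor> = c"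
      by (auto simp: cell_def cell_index_def)
    have "of_int \<lfloor>t * (3 * (real n + 1))\<rfloor> * ?h \<le> t \<and> t \<le> of_int \<lfloor>t * (3 * (real n + 1))\<rfloor> * ?h + ?h" for t
    proof -
      have "of_int \<lfloor>t * (3 * (real n + 1))\<rfloor> * ?h \<le> (t * (3 * (real n + 1))) * ?h"
        by (intro mult_right_mono) auto
      moreover have "(t * (3 * (real n + 1))) * ?h \<le> (of_int \<lfloor>t * (3 * (real n + 1))\<rfloor> + 1) * ?h"
        by (intro mult_right_mono) (auto intro: less_imp_le)
      moreover have "(t * (3 * (real n + 1))) * ?h = t" by simp
      moreover have "(of_int \<lfloor>t * (3 * (real n + 1))\<rfloor> + 1) * ?h = of_int \<lfloor>t * (3 * (real n + 1))\<rfloor> * ?h + ?h"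
        by (simp only: distrib_right mult_1)
      ultimately show ?thesis by linarith
    qed
    from this[of "x $ 1"] this[of "x $ 2"] this[of "x $ 3"] show "x \<in> cbox l u"
      unfolding mem_box_cart forall_3 u_def l_def e by simp
  qed
  show "emeasure lborel (cell (n, a, b, c)) \<le> ennreal (?h ^ 3)"
    using emeasure_mono[OF sub2, of lborel] lu by (simp add: emeasure_lborel_cbox prod del: of_nat_Suc)
  show "ennreal (?h ^ 3) \<le> emeasure lborel (cell (n, a, b, c))"
    using emeasure_mono[OF sub1, of lborel] lu by (simp add: emeasure_lborel_box prod del: of_nat_Suc)
qed

lemma cell_diameter:
  assumes "x \<in> cell (n, a, b, c)" "y \<in> cell (n, a, b, c)"
  shows "y \<in> ball x (1 / (real n + 1))"
proof -
  let ?c = "3 * (real n + 1)"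
  have diff: "\<bar>t - t'\<bar> < 1 / ?c" if "\<lfloor>t * ?c\<rfloor> = \<lfloor>t' * ?c\<rfloor>" for t t'
  proof -
    have "\<bar>t * ?c - t' * ?c\<bar> < 1"
      using that of_int_floor_le[of "t * ?c"] of_int_floor_le[of "t' * ?c"]
        floor_less_cancel real_of_int_floor_add_one_gt[of "t * ?c"] real_of_int_floor_add_one_gt[of "t' * ?c"] by linarith
    moreover have "\<bar>t * ?c - t' * ?c\<bar> = \<bar>t - t'\<bar> * ?c"
      by (simp only: left_diff_distrib[symmetric] abs_mult)
    ultimately show ?thesis by (simp add: field_simps)
  qed
  have "norm (x - y) \<le> (\<Sum>i\<in>UNIV. \<bar>(x - y) $ i\<bar>)" by (rule norm_le_l1_cart)
  also have "\<dots> = \<bar>x $ 1 - y $ 1\<bar> + \<bar>x $ 2 - y $ 2\<bar> + \<bar>x $ 3 - y $ 3\<bar>"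
    by (simp only: sum_3 vector_minus_component)
  also have "\<dots> < 1 / ?c + 1 / ?c + 1 / ?c"
    using assms by (intro add_strict_mono diff) (auto simp: cell_def cell_index_def)
  also have "\<dots> = 1 / (real n + 1)" by (simp add: field_simps)
  finally show ?thesis by (simp add: dist_norm)
qed

lemma finite_cells_of_ball: "finite (cell_index n ` ball 0 b)"
proof -
  let ?c = "3 * (real n + 1)"
  have "\<lfloor>x $ i * ?c\<rfloor> \<in> {\<lfloor>- (b * ?c)\<rfloor>..\<lfloor>b * ?c\<rfloor>}" if "x \<in> ball 0 b" for x :: R3 and i
  proof -
    have "\<bar>x $ i\<bar> \<le> b" using that component_le_norm_cart[of x i] by simp
    then have "\<bar>x $ i * ?c\<bar> \<le> b * ?c" unfolding abs_mult by (intro mult_mono) auto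
    then show ?thesis by (auto simp: abs_le_iff intro!: floor_mono)
  qed
  then have "cell_index n ` ball 0 b \<subseteq> {n} \<times> {\<lfloor>- (b * ?c)\<rfloor>..\<lfloor>b * ?c\<rfloor>} \<times> {\<lfloor>- (b * ?c)\<rfloor>..\<lfloor>b * ?c\<rfloor>} \<times> {\<lfloor>- (b * ?c)\<rfloor>..\<lfloor>b * ?c\<rfloor>}"
    by (auto simp: cell_index_def)
  then show ?thesis by (rule finite_subset) auto
qed

definition cell_integral :: "(R3 \<Rightarrow> complex) \<Rightarrow> nat \<times> int \<times> int \<times> int \<Rightarrow> complex" where
  "cell_integral f k = (\<integral>x. indicator (cell k) x *\<^sub>R f x \<partial>lborel)"

context magnetic begin

lemma cell_mass_finite:
  assumes "mass f \<le> ennreal T"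
  shows "(\<integral>\<^sup>+x\<in>B. esq (f x) \<partial>lborel) \<le> ennreal T"
proof -
  have "(\<integral>\<^sup>+x\<in>B. esq (f x) \<partial>lborel) \<le> mass f"
    unfolding mass_borel by (intro nn_integral_mono) (auto simp: indicator_def)
  then show ?thesis using assms by (rule order_trans)
qed

lemma cell_integral_bound:
  assumes f: "f \<in> borel_measurable borel" and T: "mass f \<le> ennreal T" "0 \<le> T"
  shows "cmod (cell_integral f k) \<le> sqrt T"
proof -
  obtain n a b c where k: "k = (n, a, b, c)" by (cases k) auto
  have fin: "emeasure lborel (cell k) < \<infinity>" by (simp add: k emeasure_cell)
  note le = cell_mass_finite[OF T(1), of "cell k"]
  have "esq (cell_integral f k) \<le> emeasure lborel (cell k) * (\<integral>\<^sup>+x\<in>cell k. esq (f x) \<partial>lborel)"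
    unfolding cell_integral_def using le by (intro cell_variance(2)[OF f cell_borel fin]) (simp add: le_less_trans)
  also have "\<dots> \<le> 1 * ennreal T"
  proof (intro mult_mono le)
    have "(1 / (3 * (real n + 1))) ^ 3 \<le> 1" by (intro power_le_one) auto
    then show "emeasure lborel (cell k) \<le> 1" by (simp only: k emeasure_cell ennreal_le_1)
  qed auto
  finally have "(cmod (cell_integral f k))\<^sup>2 \<le> T" using T(2) by simp
  then show ?thesis by (rule real_le_rsqrt)
qed

text \<open>Sum \<open>cell_variance\<close> over the finitely many cells that meet the ball. The double integrals over the
cells add up to at most the local oscillation at distance \<open>1 / (n + 1)\<close>, because the cells are disjoint and small.\<close>

lemma cell_estimate:
  fixes b T :: real
  assumes T: "0 < T"
  obtains C where "0 < C" "\<And>u n. u \<in> borel_measurable borel \<Longrightarrow> nonlocal u \<le> ennreal T \<Longrightarrow> mass u \<le> ennreal T \<Longrightarrow>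
    (\<integral>\<^sup>+x\<in>ball 0 b. esq (u x) \<partial>lborel) \<le>
      ennreal (C * (1 / (real n + 1)) powr (2 * s) + 27 * (real n + 1) ^ 3 * (\<Sum>k\<in>cell_index n ` ball 0 b. (cmod (cell_integral u k))\<^sup>2))"
proof -
  obtain C where C: "0 < C" "\<And>u h. u \<in> borel_measurable borel \<Longrightarrow> nonlocal u \<le> ennreal T \<Longrightarrow> mass u \<le> ennreal T \<Longrightarrow> 0 < h \<Longrightarrow> h \<le> 1 \<Longrightarrow>
    (\<integral>\<^sup>+x\<in>(ball 0 (b + 1)). (\<integral>\<^sup>+y\<in>ball x h. esq (u x - u y) \<partial>lborel) \<partial>lborel) \<le> ennreal (C * h powr (3 + 2 * s))"
    using local_oscillation[OF T, of "b + 1"] by blast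
  show ?thesis
  proof (rule that[of "27 / 2 * C"])
    show "0 < 27 / 2 * C" using C by simp
    fix u :: "R3 \<Rightarrow> complex" and n :: nat
    assume u [measurable]: "u \<in> borel_measurable borel" and nl: "nonlocal u \<le> ennreal T" and ms: "mass u \<le> ennreal T"
    define H where "H = 1 / (real n + 1)"
    define h where "h = 1 / (3 * (real n + 1))"
    have H: "0 < H" "H \<le> 1" by (auto simp: H_def)
    have h: "0 < h" by (simp add: h_def)
    define K where "K = cell_index n ` ball 0 b"
    have K: "finite K" unfolding K_def by (rule finite_cells_of_ball)
    have Kn: "\<exists>a b c. k = (n, a, b, c)" if "k \<in> K" for k
      using that by (auto simp: K_def cell_index_def)
    have ec: "emeasure lborel (cell k) = ennreal (h ^ 3)" if "k \<in> K" for k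
      using Kn[OF that] emeasure_cell by (auto simp: h_def)
    let ?osc = "\<lambda>k. (\<integral>\<^sup>+x\<in>cell k. (\<integral>\<^sup>+y\<in>cell k. esq (u x - u y) \<partial>lborel) \<partial>lborel)"
    let ?I = "\<lambda>k. (\<integral>\<^sup>+x\<in>cell k. esq (u x) \<partial>lborel)"
    have cv: "2 * ennreal (h ^ 3) * ?I k = ?osc k + ennreal (2 * (cmod (cell_integral u k))\<^sup>2)" if "k \<in> K" for k
    proof -
      have f: "emeasure lborel (cell k) < \<infinity>" using ec[OF that] by simp
      have g: "?I k < \<infinity>" using cell_mass_finite[OF ms, of "cell k"] by (simp add: le_less_trans)
      show ?thesis using cell_variance(1)[OF u cell_borel f g] unfolding ec[OF that] cell_integral_def .
    qed
    have osc: "(\<Sum>k\<in>K. ?osc k) \<le> ennreal (C * H powr (3 + 2 * s))"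
    proof -
      let ?J = "\<lambda>x. \<integral>\<^sup>+y\<in>ball x H. esq (u x - u y) \<partial>lborel"
      have m: "(\<lambda>z. esq (u (fst z) - u (snd z)) * indicator (ball (fst z) H) (snd z)) \<in> borel_measurable (lborel \<Otimes>\<^sub>M lborel)"
        unfolding indicator_def ball_def mem_Collect_eq by measurable
      have J [measurable]: "?J \<in> borel_measurable borel"
        using lborel.borel_measurable_nn_integral_fst[OF m] by simp
      have "(\<Sum>k\<in>K. ?osc k) \<le> (\<Sum>k\<in>K. \<integral>\<^sup>+x\<in>cell k. ?J x \<partial>lborel)"
      proof (intro sum_mono nn_integral_mono)
        fix k x assume k: "k \<in> K"
        show "(\<integral>\<^sup>+y\<in>cell k. esq (u x - u y) \<partial>lborel) * indicator (cell k) x \<le> ?J x * indicator (cell k) x"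
        proof (cases "x \<in> cell k")
          case True
          have "cell k \<subseteq> ball x H"
            using True Kn[OF k] cell_diameter by (auto simp: H_def)
          then have "(\<integral>\<^sup>+y\<in>cell k. esq (u x - u y) \<partial>lborel) \<le> ?J x"
            by (intro nn_integral_mono mult_left_mono) (auto simp: indicator_def)
          then show ?thesis using True by simp
        qed simp
      qed
      also have "\<dots> = (\<integral>\<^sup>+x. (\<Sum>k\<in>K. ?J x * indicator (cell k) x) \<partial>lborel)"
        by (rule nn_integral_sum[symmetric]) measurable
      also have "\<dots> \<le> (\<integral>\<^sup>+x\<in>(ball 0 (b + 1)). ?J x \<partial>lborel)"
      proof (intro nn_integral_mono)
        fix x
        have "(\<Sum>k\<in>K. ?J x * indicator (cell k) x) = ?J x * (\<Sum>k\<in>K. indicator (cell k) x)"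
          by (simp add: sum_distrib_left)
        also have "(\<Sum>k\<in>K. indicator (cell k) x :: ennreal) \<le> indicator (ball 0 (b + 1)) x"
        proof (cases "\<exists>k\<in>K. x \<in> cell k")
          case False
          then have "(\<Sum>k\<in>K. indicator (cell k) x :: ennreal) = 0" by (intro sum.neutral) auto
          then show ?thesis by simp
        next
          case True
          then obtain k where k: "k \<in> K" "x \<in> cell k" by blast
          have uniq: "k' = k" if "k' \<in> K" "x \<in> cell k'" for k'
          proof -
            have "fst k = n" "fst k' = n" using k(1) that(1) Kn by fastforce+
            then show ?thesis using k(2) that(2) by (simp add: cell_def)
          qed
          have "(\<Sum>k'\<in>K. indicator (cell k') x :: ennreal) = (\<Sum>k'\<in>K. if k' = k then 1 else 0)"
          proof (rule sum.cong[OF refl])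
            fix k' assume "k' \<in> K"
            then show "indicator (cell k') x = (if k' = k then 1 else 0 :: ennreal)"
              using uniq[of k'] k(2) by (cases "x \<in> cell k'") auto
          qed
          also have "\<dots> = 1" using k K by simp
          finally have one: "(\<Sum>k'\<in>K. indicator (cell k') x :: ennreal) = 1" .
          obtain y where y: "y \<in> ball 0 b" "k = cell_index n y" using k(1) by (auto simp: K_def)
          obtain a' b' c' where kk: "k = (n, a', b', c')" using Kn[OF k(1)] by blast
          have "y \<in> cell k" unfolding y(2) by (simp add: cell_def cell_index_def)
          then have "x \<in> ball y H"
            using cell_diameter[of y n a' b' c' x] k(2) by (simp add: H_def kk)
          then have "dist y x < H" by simp
          moreover have "norm y < b" using y(1) by simp
          moreover have "norm x \<le> norm y + dist y x"
            using norm_triangle_sub[of x y] by (simp add: dist_norm norm_minus_commute)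
          ultimately have "x \<in> ball 0 (b + 1)" using H by simp
          then show ?thesis using one by simp
        qed
        finally show "(\<Sum>k\<in>K. ?J x * indicator (cell k) x) \<le> ?J x * indicator (ball 0 (b + 1)) x"
          by (simp add: mult_left_mono)
      qed
      also have "\<dots> \<le> ennreal (C * H powr (3 + 2 * s))"
        by (rule C(2)[OF u nl ms H])
      finally show ?thesis .
    qed
    have cover: "(\<integral>\<^sup>+x\<in>ball 0 b. esq (u x) \<partial>lborel) \<le> (\<Sum>k\<in>K. ?I k)"
    proof -
      have "(\<Sum>k\<in>K. ?I k) = (\<integral>\<^sup>+x. (\<Sum>k\<in>K. esq (u x) * indicator (cell k) x) \<partial>lborel)"
        by (rule nn_integral_sum[symmetric]) measurable
      moreover have "esq (u x) * indicator (ball 0 b) x \<le> (\<Sum>k\<in>K. esq (u x) * indicator (cell k) x)" for x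
      proof (cases "x \<in> ball 0 b")
        case True
        then have "cell_index n x \<in> K" by (simp add: K_def)
        moreover have "x \<in> cell (cell_index n x)" by (simp add: cell_def cell_index_def)
        ultimately have "esq (u x) * indicator (ball 0 b) x \<le> esq (u x) * indicator (cell (cell_index n x)) x"
          by (auto simp: indicator_def)
        also have "\<dots> \<le> (\<Sum>k\<in>K. esq (u x) * indicator (cell k) x)"
          using K \<open>cell_index n x \<in> K\<close> by (intro member_le_sum) auto
        finally show ?thesis .
      qed simp
      ultimately show ?thesis by (simp add: nn_integral_mono)
    qed
    let ?X = "\<integral>\<^sup>+x\<in>ball 0 b. esq (u x) \<partial>lborel"
    let ?m = "\<Sum>k\<in>K. (cmod (cell_integral u k))\<^sup>2"
    have "ennreal (2 * h ^ 3) * ?X \<le> ennreal (2 * h ^ 3) * (\<Sum>k\<in>K. ?I k)"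
      by (intro mult_left_mono cover) simp
    also have "\<dots> = (\<Sum>k\<in>K. 2 * ennreal (h ^ 3) * ?I k)"
      using h by (simp add: sum_distrib_left ennreal_mult)
    also have "\<dots> = (\<Sum>k\<in>K. ?osc k + ennreal (2 * (cmod (cell_integral u k))\<^sup>2))"
      by (intro sum.cong refl cv)
    also have "\<dots> = (\<Sum>k\<in>K. ?osc k) + ennreal (2 * ?m)"
      by (simp add: sum.distrib sum_distrib_left sum_ennreal)
    also have "\<dots> \<le> ennreal (C * H powr (3 + 2 * s)) + ennreal (2 * ?m)"
      by (intro add_right_mono osc)
    also have "\<dots> = ennreal (C * H powr (3 + 2 * s) + 2 * ?m)"
      using C(1) by (intro ennreal_plus[symmetric]) (auto intro: sum_nonneg)
    finally have le: "ennreal (2 * h ^ 3) * ?X \<le> ennreal (C * H powr (3 + 2 * s) + 2 * ?m)" .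
    have "(C * H powr (3 + 2 * s) + 2 * ?m) / (2 * h ^ 3) = 27 / 2 * C * H powr (2 * s) + 27 * (real n + 1) ^ 3 * ?m"
    proof -
      have hH: "h = H / 3" by (simp add: h_def H_def)
      have h3: "X / (2 * h ^ 3) = 27 / 2 * X / H ^ 3" for X unfolding hH using H by (simp add: power_divide)
      have "H powr (3 + 2 * s) = H ^ 3 * H powr (2 * s)" using H by (simp add: powr_add)
      then have "C * H powr (3 + 2 * s) / (2 * h ^ 3) = 27 / 2 * C * H powr (2 * s)"
        unfolding h3 using H by simp
      moreover have "2 * ?m / (2 * h ^ 3) = 27 * (real n + 1) ^ 3 * ?m"
        unfolding h3 H_def by (simp add: power_divide)
      ultimately show ?thesis by (simp only: add_divide_distrib)
    qed
    moreover have "?X \<le> ennreal ((C * H powr (3 + 2 * s) + 2 * ?m) / (2 * h ^ 3))"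
      by (rule ennreal_le_divideI'[OF _ _ le]) (use h C(1) in \<open>auto intro!: add_nonneg_nonneg sum_nonneg\<close>)
    ultimately show "?X \<le> ennreal (27 / 2 * C * (1 / (real n + 1)) powr (2 * s) + 27 * (real n + 1) ^ 3 * (\<Sum>k\<in>cell_index n ` ball 0 b. (cmod (cell_integral u k))\<^sup>2))"
      unfolding H_def K_def by (simp only:)
  qed
qed

text \<open>Along a diagonal subsequence the integrals over all cells of all scales converge. By \<open>cell_estimate\<close> the
differences are then small in \<open>L\<^sup>2\<close> of a ball: first choose the scale for the oscillation term, then the indices for
the finitely many cell integrals.\<close>

lemma local_compactness:
  fixes u :: "nat \<Rightarrow> R3 \<Rightarrow> complex"
  assumes u: "\<And>n. u n \<in> FFS" and bound: "\<And>n. ip (u n) (u n) \<le> 1"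
  obtains r :: "nat \<Rightarrow> nat" where "strict_mono r"
    "\<And>b \<epsilon>. 0 < \<epsilon> \<Longrightarrow> \<exists>N. \<forall>i\<ge>N. \<forall>j\<ge>N. (\<integral>\<^sup>+x\<in>ball 0 b. esq (u (r i) x - u (r j) x) \<partial>lebesgue) \<le> ennreal \<epsilon>"
proof -
  have "\<forall>n. \<exists>u'. u' \<in> borel_measurable borel \<and> (AE x in lebesgue. u n x = u' x)"
    using borel_representative[OF FFS_measurable[OF u]] by metis
  from choice[OF this] obtain w where wm [measurable]: "\<And>n. w n \<in> borel_measurable borel"
    and ae: "\<And>n. AE x in lebesgue. u n x = w n x" by blast
  have w: "w n \<in> FFS" for n using FFS_cong_AE[OF u ae] .
  define T where "T = max (4 / c1) (4 / c2)"
  have T: "0 < T" using c1_pos by (simp add: T_def less_max_iff_disj)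
  have mw: "mass (w n) \<le> ennreal T" for n
  proof -
    have "mass (w n) \<le> ennreal (1 / c2)" using energy_le(2)[OF u bound, of n] mass_cong_AE[OF ae, of n] by simp
    also have "\<dots> \<le> ennreal T" using c2_pos by (intro ennreal_leI) (auto simp: T_def le_max_iff_disj divide_right_mono)
    finally show ?thesis .
  qed
  obtain r :: "nat \<Rightarrow> nat" where r: "strict_mono r" and conv: "\<And>k. \<exists>l. (\<lambda>n. cell_integral (w (r n)) k) \<longlonglongrightarrow> l"
  proof (rule function_convergent_subsequence[of "UNIV :: (nat \<times> int \<times> int \<times> int) set" "\<lambda>n. cell_integral (w n)" "sqrt T"])
    show "norm (cell_integral (w n) k) \<le> sqrt T" for n k
      using T by (intro cell_integral_bound wm mw) simp
  qed auto
  show ?thesis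
  proof (rule that[OF r])
    fix b \<epsilon> :: real assume \<epsilon>: "0 < \<epsilon>"
    obtain C where C: "0 < C" "\<And>u n. u \<in> borel_measurable borel \<Longrightarrow> nonlocal u \<le> ennreal T \<Longrightarrow> mass u \<le> ennreal T \<Longrightarrow>
      (\<integral>\<^sup>+x\<in>ball 0 b. esq (u x) \<partial>lborel) \<le>
      ennreal (C * (1 / (real n + 1)) powr (2 * s) + 27 * (real n + 1) ^ 3 * (\<Sum>k\<in>cell_index n ` ball 0 b. (cmod (cell_integral u k))\<^sup>2))"
      using cell_estimate[OF T, of b] by blast
    have "(\<lambda>n. C * (1 / (real n + 1)) powr (2 * s)) \<longlonglongrightarrow> C * 0"
    proof (intro tendsto_mult tendsto_const)
      have "(\<lambda>n. (1 / (real n + 1)) powr (2 * s)) \<longlonglongrightarrow> 0 powr (2 * s)"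
        using s_pos LIMSEQ_inverse_real_of_nat by (intro tendsto_powr') (auto simp: inverse_eq_divide add.commute)
      then show "(\<lambda>n. (1 / (real n + 1)) powr (2 * s)) \<longlonglongrightarrow> 0" using s_pos by simp
    qed
    then have "\<forall>\<^sub>F n in sequentially. C * (1 / (real n + 1)) powr (2 * s) < \<epsilon> / 2"
      using \<epsilon> by (intro order_tendstoD(2)) auto
    then obtain n where n: "C * (1 / (real n + 1)) powr (2 * s) < \<epsilon> / 2"
      by (auto simp: eventually_sequentially)
    define K where "K = cell_index n ` ball 0 b"
    have K: "finite K" unfolding K_def by (rule finite_cells_of_ball)
    define \<eta> where "\<eta> = \<epsilon> / 2 / (27 * (real n + 1) ^ 3) / (real (card K) + 1)"
    have \<eta>: "0 < \<eta>" using \<epsilon> by (simp add: \<eta>_def add_nonneg_pos)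
    have "\<forall>k\<in>K. \<exists>N. \<forall>i\<ge>N. \<forall>j\<ge>N. cmod (cell_integral (w (r i)) k - cell_integral (w (r j)) k) < sqrt \<eta>"
    proof
      fix k assume "k \<in> K"
      have "Cauchy (\<lambda>n. cell_integral (w (r n)) k)"
        using conv[of k] by (auto intro: LIMSEQ_imp_Cauchy)
      then show "\<exists>N. \<forall>i\<ge>N. \<forall>j\<ge>N. cmod (cell_integral (w (r i)) k - cell_integral (w (r j)) k) < sqrt \<eta>"
        using \<eta> by (auto simp: Cauchy_iff)
    qed
    from bchoice[OF this] obtain N0 where N0: "\<And>k i j. k \<in> K \<Longrightarrow> N0 k \<le> i \<Longrightarrow> N0 k \<le> j \<Longrightarrow> cmod (cell_integral (w (r i)) k - cell_integral (w (r j)) k) < sqrt \<eta>"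
      by blast
    define N where "N = (\<Sum>k\<in>K. N0 k)"
    have N0N: "N0 k \<le> N" if "k \<in> K" for k unfolding N_def using that K by (intro member_le_sum) auto
    have "(\<integral>\<^sup>+x\<in>ball 0 b. esq (u (r i) x - u (r j) x) \<partial>lebesgue) \<le> ennreal \<epsilon>" if ij: "N \<le> i" "N \<le> j" for i j
    proof -
      let ?d = "\<lambda>x. w (r i) x - w (r j) x"
      have dF: "?d \<in> FFS" using w by (intro FFS.diff_closed)
      have "ip (u (r i)) (u (r i)) = ip (w (r i)) (w (r i))" for i
        using ip_cong_AE[OF u ae u, of "r i" "r i"] ip_cong_AE[OF u ae w, of "r i" "r i"] ip_sym by metis
      then have wb: "ip (w (r i)) (w (r i)) \<le> 1" for i using bound by metis
      have "sqrt (ip ?d ?d) \<le> sqrt (ip (w (r i)) (w (r i))) + sqrt (ip (w (r j)) (w (r j)))"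
        using FFS.triangle[OF w FFS_scale[OF w, of "-1"], of "r i" "r j"] FFS.nrm2_scale[OF w, of "-1" "r j"] by simp
      also have "\<dots> \<le> 1 + 1" using wb by (intro add_mono) auto
      finally have "sqrt (ip ?d ?d) \<le> 2" by simp
      then have "ip ?d ?d \<le> 2\<^sup>2" by (rule sqrt_le_D)
      then have "ip ?d ?d \<le> 4" by simp
      from energy_le[OF dF this] have "nonlocal ?d \<le> ennreal (4 / c1)" "mass ?d \<le> ennreal (4 / c2)" .
      moreover have "ennreal (4 / c1) \<le> ennreal T" "ennreal (4 / c2) \<le> ennreal T"
        by (intro ennreal_leI; simp add: T_def)+
      ultimately have nm: "nonlocal ?d \<le> ennreal T" "mass ?d \<le> ennreal T" by (meson order_trans)+
      have ci: "cell_integral ?d k = cell_integral (w (r i)) k - cell_integral (w (r j)) k" for k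
      proof -
        obtain n' a' b' c' where k: "k = (n', a', b', c')" by (cases k) auto
        have fin: "emeasure lborel (cell k) < \<infinity>" by (simp add: k emeasure_cell)
        have int: "integrable lborel (\<lambda>x. indicator (cell k) x *\<^sub>R w n x)" for n
          using cell_mass_finite[OF mw, of n "cell k"] by (intro cell_variance(3)[OF wm cell_borel fin]) (simp add: le_less_trans)
        show ?thesis
          unfolding cell_integral_def using int by (simp add: scaleR_diff_right)
      qed
      have "(\<integral>\<^sup>+x\<in>ball 0 b. esq (u (r i) x - u (r j) x) \<partial>lebesgue)
        = (\<integral>\<^sup>+x\<in>ball 0 b. esq (?d x) \<partial>lebesgue)"
      proof (rule nn_integral_cong_AE)
        show "AE x in lebesgue. esq (u (r i) x - u (r j) x) * indicator (ball 0 b) x = esq (?d x) * indicator (ball 0 b) x"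
          using ae[of "r i"] ae[of "r j"] by eventually_elim simp
      qed
      also have "\<dots> = (\<integral>\<^sup>+x\<in>ball 0 b. esq (?d x) \<partial>lborel)"
        by (rule nn_integral_completion)
      also have "\<dots> \<le> ennreal (C * (1 / (real n + 1)) powr (2 * s) + 27 * (real n + 1) ^ 3 * (\<Sum>k\<in>K. (cmod (cell_integral ?d k))\<^sup>2))"
        unfolding K_def by (rule C(2)[OF _ nm]) measurable
      also have "\<dots> \<le> ennreal \<epsilon>"
      proof (intro ennreal_leI)
        have "(\<Sum>k\<in>K. (cmod (cell_integral ?d k))\<^sup>2) \<le> (\<Sum>k\<in>K. \<eta>)"
        proof (intro sum_mono)
          fix k assume k: "k \<in> K"
          have "cmod (cell_integral ?d k) < sqrt \<eta>"
            unfolding ci using N0N[OF k] ij by (intro N0 k) auto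
          then have "(cmod (cell_integral ?d k))\<^sup>2 \<le> (sqrt \<eta>)\<^sup>2" by (intro power_mono) auto
          then show "(cmod (cell_integral ?d k))\<^sup>2 \<le> \<eta>" using \<eta> by simp
        qed
        also have "\<dots> \<le> (real (card K) + 1) * \<eta>" using \<eta> by (simp add: mult_right_mono)
        also have "\<dots> = \<epsilon> / 2 / (27 * (real n + 1) ^ 3)" by (simp add: \<eta>_def add_nonneg_pos)
        finally have "27 * (real n + 1) ^ 3 * (\<Sum>k\<in>K. (cmod (cell_integral ?d k))\<^sup>2) \<le> 27 * (real n + 1) ^ 3 * (\<epsilon> / 2 / (27 * (real n + 1) ^ 3))"
          by (intro mult_left_mono) auto
        also have "\<dots> = \<epsilon> / 2" by simp
        finally show "C * (1 / (real n + 1)) powr (2 * s) + 27 * (real n + 1) ^ 3 * (\<Sum>k\<in>K. (cmod (cell_integral ?d k))\<^sup>2) \<le> \<epsilon>"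
          using n by linarith
      qed
      finally show ?thesis .
    qed
    then show "\<exists>N. \<forall>i\<ge>N. \<forall>j\<ge>N. (\<integral>\<^sup>+x\<in>ball 0 b. esq (u (r i) x - u (r j) x) \<partial>lebesgue) \<le> ennreal \<epsilon>"
      by blast
  qed
qed

end

section \<open>Compactness of radial sequences\<close>

context magnetic_power begin

text \<open>The values of \<open>|u|\<close> at far away points are split into small, intermediate and large ones. Large values are covered by
\<open>uniform_tail\<close>. For the intermediate ones the level set is rotation invariant, so it is sparse in balls far from
the origin and \<open>sparse_level_set_bound\<close> applies.\<close>

lemma radial_tail:
  fixes \<epsilon> :: real
  assumes \<epsilon>: "0 < \<epsilon>"
  obtains R0 where "0 < R0" "\<And>u. u \<in> FFS \<Longrightarrow> radially_symmetric u \<Longrightarrow> ip u u \<le> 1 \<Longrightarrow>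
    (\<integral>\<^sup>+x. ennreal (cmod (u x) powr p) * indicator {x. R0 \<le> norm x} x \<partial>lebesgue) \<le> ennreal \<epsilon>"
proof -
  obtain T where T: "0 < T" "\<And>u. u \<in> FFS \<Longrightarrow> ip u u \<le> 1 \<Longrightarrow> nonlocal u \<le> ennreal T \<and> mass u \<le> ennreal T"
    using unit_ball_bound by blast
  have \<epsilon>3: "0 < \<epsilon> / 3" using \<epsilon> by simp
  obtain \<Lambda> where \<Lambda>: "1 \<le> \<Lambda>" "\<And>u. u \<in> FFS \<Longrightarrow> ip u u \<le> 1 \<Longrightarrow>
    upper_tail p \<Lambda> u \<le> ennreal (\<epsilon> / 3)"
    using uniform_tail[OF p_gt_2 p_subcritical \<epsilon>3] by blast
  obtain C where C: "0 < C" "\<And>u r \<mu> G. u \<in> borel_measurable borel \<Longrightarrow> 0 < r \<Longrightarrow> r \<le> 1 \<Longrightarrow> 0 \<le> \<mu> \<Longrightarrow> G \<in> sets borel \<Longrightarrow>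
     (\<And>x. x \<in> G \<Longrightarrow> 2 * \<mu> < cmod (u x)) \<Longrightarrow>
     (\<And>x. x \<in> G \<Longrightarrow> emeasure lborel (ball x r \<inter> {y. \<mu> < cmod (u y)}) \<le> ennreal (ball_vol * r ^ 3 / 2)) \<Longrightarrow>
     (\<integral>\<^sup>+x\<in>G. esq (u x) \<partial>lborel) \<le> ennreal (C * r powr (2 * s)) * nonlocal u"
    using sparse_level_set_bound[of 1] by auto
  \<comment> \<open>Values up to \<open>2 * l\<close> are paid for by the mass alone.\<close>
  define l where "l = min (1 / 2) ((\<epsilon> / (3 * T)) powr (1 / (p - 2)) / 2)"
  have l: "0 < l" using \<epsilon> T(1) by (simp add: l_def)
  have l_small: "(2 * l) powr (p - 2) * T \<le> \<epsilon> / 3"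
  proof -
    have "(2 * l) powr (p - 2) \<le> ((\<epsilon> / (3 * T)) powr (1 / (p - 2))) powr (p - 2)"
      using l p_gt_2 by (intro powr_mono2) (auto simp: l_def)
    also have "\<dots> = \<epsilon> / (3 * T)" using \<epsilon> T(1) p_gt_2 by (simp add: powr_powr)
    finally show ?thesis using T(1) by (simp add: field_simps)
  qed
  have l\<Lambda>: "2 * l \<le> \<Lambda>" using \<Lambda>(1) by (simp add: l_def)
  \<comment> \<open>Values between \<open>2 * l\<close> and \<open>\<Lambda>\<close> are paid for by the energy on balls of radius \<open>r\<close>.
    The number \<open>N\<close> of disjoint rotated balls makes the level set occupy at most half of each ball.\<close>
  define a where "a = \<Lambda> powr (p - 2) * C * T"
  have a: "0 < a" using \<Lambda>(1) C(1) T(1) by (simp add: a_def)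
  define r where "r = min 1 ((\<epsilon> / (3 * a)) powr (1 / (2 * s)))"
  have r: "0 < r" "r \<le> 1" using \<epsilon> a by (auto simp: r_def)
  have r_small: "a * r powr (2 * s) \<le> \<epsilon> / 3"
  proof -
    have "r powr (2 * s) \<le> ((\<epsilon> / (3 * a)) powr (1 / (2 * s))) powr (2 * s)"
      using r s_pos by (intro powr_mono2) (auto simp: r_def)
    also have "\<dots> = \<epsilon> / (3 * a)" using \<epsilon> a s_pos by (simp add: powr_powr)
    finally show ?thesis using a by (simp add: field_simps)
  qed
  let ?b = "ball_vol * r ^ 3"
  have b: "0 < ?b" using ball_vol_pos r by simp
  obtain N where N: "T / l\<^sup>2 / (?b / 2) \<le> real N" using real_arch_simple by blast
  have N0: "0 < real N"
  proof -
    have "0 < T / l\<^sup>2 / (?b / 2)" using T(1) l b by simp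
    with N show ?thesis by linarith
  qed
  obtain R0 where R0: "0 < R0"
    "\<And>S x. S \<in> sets (lebesgue :: R3 measure) \<Longrightarrow> (\<And>y z. norm y = norm z \<Longrightarrow> y \<in> S \<longleftrightarrow> z \<in> S) \<Longrightarrow> R0 \<le> norm x \<Longrightarrow>
       of_nat N * emeasure lebesgue (ball x r \<inter> S) \<le> emeasure lebesgue S"
    using rotation_invariant_set_sparse_far_out[OF r(1), of N] by blast
  show ?thesis
  proof (rule that[OF R0(1)])
    fix u assume u: "u \<in> FFS" and rad: "radially_symmetric u" and le1: "ip u u \<le> 1"
    note [measurable] = FFS_measurable[OF u]
    obtain w where w [measurable]: "w \<in> borel_measurable borel" and ae: "AE x in lebesgue. u x = w x"
      using borel_representative[OF FFS_measurable[OF u]] .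
    have wF: "w \<in> FFS" using FFS_cong_AE[OF u ae] .
    have w1: "ip w w \<le> 1"
      using ip_cong_AE[OF u ae u] ip_cong_AE[OF u ae wF] ip_sym[of w u] le1 by simp
    have nm: "nonlocal w \<le> ennreal T" "mass w \<le> ennreal T" using T(2)[OF wF w1] by auto
    have sparse: "emeasure lborel (ball x r \<inter> {y. l < cmod (w y)}) \<le> ennreal (?b / 2)" if x: "R0 \<le> norm x" for x
    proof -
      have eqs: "emeasure lebesgue (B \<inter> {y. l < cmod (u y)}) = emeasure lborel (B \<inter> {y. l < cmod (w y)})" if [measurable]: "B \<in> sets borel" for B
      proof -
        have [measurable]: "B \<in> sets lebesgue" using that by (simp add: sets_completionI_sets)
        have S1: "B \<inter> {y. l < cmod (u y)} \<in> sets lebesgue"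
        proof -
          have "{y \<in> space lebesgue. l < cmod (u y)} \<in> sets lebesgue" by measurable
          then show ?thesis using \<open>B \<in> sets lebesgue\<close> by (auto intro: sets.Int)
        qed
        have S2: "B \<inter> {y. l < cmod (w y)} \<in> sets borel" by measurable
        have "emeasure lebesgue (B \<inter> {y. l < cmod (u y)}) = emeasure lebesgue (B \<inter> {y. l < cmod (w y)})"
          by (rule emeasure_eq_AE) (use ae S1 S2 in \<open>auto elim!: eventually_mono simp: sets_completionI_sets\<close>)
        then show ?thesis using S2 by simp
      qed
      define e where "e = measure lborel (ball x r \<inter> {y. l < cmod (w y)})"
      have e: "emeasure lborel (ball x r \<inter> {y. l < cmod (w y)}) = ennreal e"
      proof -
        have "emeasure lborel (ball x r \<inter> {y. l < cmod (w y)}) \<le> emeasure lborel (ball x r)"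
          by (intro emeasure_mono) auto
        also have "\<dots> < \<infinity>" by (rule emeasure_lborel_ball_finite)
        finally show ?thesis unfolding e_def by (intro emeasure_eq_ennreal_measure) simp
      qed
      have Sm: "{y. l < cmod (u y)} \<in> sets lebesgue"
      proof -
        have "{y \<in> space lebesgue. l < cmod (u y)} \<in> sets lebesgue" by measurable
        then show ?thesis by simp
      qed
      have "of_nat N * emeasure lebesgue (ball x r \<inter> {y. l < cmod (u y)}) \<le> emeasure lebesgue {y. l < cmod (u y)}"
      proof (rule R0(2)[OF Sm _ x])
        fix y z :: R3 assume "norm y = norm z"
        then have "u y = u z" using rad unfolding radially_symmetric_def by blast
        then show "y \<in> {y. l < cmod (u y)} \<longleftrightarrow> z \<in> {y. l < cmod (u y)}" by simp
      qed
      then have "of_nat N * ennreal e \<le> emeasure lborel {y. l < cmod (w y)}"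
        using eqs[of "ball x r"] eqs[of UNIV] e by simp
      then have "ennreal (l\<^sup>2) * (of_nat N * ennreal e) \<le> ennreal (l\<^sup>2) * emeasure lborel {y. l < cmod (w y)}"
        by (intro mult_left_mono) auto
      also have "\<dots> \<le> ennreal T" using order_trans[OF chebyshev_mass[OF w l] nm(2)] .
      finally have "ennreal (l\<^sup>2 * (real N * e)) \<le> ennreal T"
        by (simp add: ennreal_mult' e_def flip: ennreal_of_nat_eq_real_of_nat)
      then have "l\<^sup>2 * (real N * e) \<le> T" using T(1) by simp
      then have "e \<le> T / l\<^sup>2 / real N" using l N0 by (simp add: field_simps)
      also have "\<dots> \<le> ?b / 2"
      proof -
        have b2: "0 < ?b / 2" using b by simp
        have "T / l\<^sup>2 \<le> real N * (?b / 2)" using N unfolding pos_divide_le_eq[OF b2] .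
        then show ?thesis unfolding pos_divide_le_eq[OF N0] by (simp only: mult.commute)
      qed
      finally show ?thesis unfolding e by (rule ennreal_leI)
    qed
    define G where "G = {x. R0 \<le> norm x \<and> 2 * l < cmod (w x)}"
    have [measurable]: "G \<in> sets borel" unfolding G_def by measurable
    have mid: "(\<integral>\<^sup>+x\<in>G. esq (w x) \<partial>lborel) \<le> ennreal (C * r powr (2 * s)) * nonlocal w"
      by (rule C(2)[OF w r, of l]) (use l sparse in \<open>auto simp: G_def\<close>)
    have "(\<integral>\<^sup>+x. ennreal (cmod (u x) powr p) * indicator {x. R0 \<le> norm x} x \<partial>lebesgue)
       = (\<integral>\<^sup>+x. ennreal (cmod (w x) powr p) * indicator {x. R0 \<le> norm x} x \<partial>lebesgue)"
      by (intro nn_integral_cong_AE eventually_mono[OF ae]) simp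
    also have "\<dots> = (\<integral>\<^sup>+x. ennreal (cmod (w x) powr p) * indicator {x. R0 \<le> norm x} x \<partial>lborel)"
      by (rule nn_integral_completion)
    also have "\<dots> \<le> (\<integral>\<^sup>+x. ennreal ((2 * l) powr (p - 2)) * esq (w x)
        + ennreal (\<Lambda> powr (p - 2)) * (esq (w x) * indicator G x)
        + ennreal (cmod (w x) powr p) * indicator {\<Lambda><..} (cmod (w x)) \<partial>lborel)"
    proof (intro nn_integral_mono)
      fix x
      let ?A1 = "ennreal ((2 * l) powr (p - 2)) * esq (w x)"
      let ?A2 = "ennreal (\<Lambda> powr (p - 2)) * (esq (w x) * indicator G x)"
      let ?A3 = "ennreal (cmod (w x) powr p) * indicator {\<Lambda><..} (cmod (w x)) :: ennreal"
      consider "\<not> R0 \<le> norm x" | "\<Lambda> < cmod (w x)" | "cmod (w x) \<le> 2 * l" | "R0 \<le> norm x" "cmod (w x) \<le> \<Lambda>" "2 * l < cmod (w x)"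
        by linarith
      then show "ennreal (cmod (w x) powr p) * indicator {x. R0 \<le> norm x} x \<le> ?A1 + ?A2 + ?A3"
      proof cases
        case 1 then show ?thesis by simp
      next
        case 2
        then have "ennreal (cmod (w x) powr p) * indicator {x. R0 \<le> norm x} x \<le> ?A3" by (simp add: indicator_def)
        then show ?thesis by (rule order_trans) simp
      next
        case 3
        then have "ennreal (cmod (w x) powr p) \<le> ?A1"
          by (subst ennreal_mult'[symmetric]) (auto intro!: ennreal_leI powr_le_below_level)
        then have "ennreal (cmod (w x) powr p) * indicator {x. R0 \<le> norm x} x \<le> ?A1"
          by (auto simp: indicator_def)
        then show ?thesis by (rule order_trans) (simp add: add.assoc)
      next
        case 4
        then have "ennreal (cmod (w x) powr p) \<le> ennreal (\<Lambda> powr (p - 2)) * esq (w x)"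
          by (subst ennreal_mult'[symmetric]) (auto intro!: ennreal_leI powr_le_below_level)
        then have "ennreal (cmod (w x) powr p) * indicator {x. R0 \<le> norm x} x \<le> ?A2"
          using 4 by (simp add: G_def)
        then show ?thesis by (rule order_trans) (simp add: add.commute[of ?A1] add.assoc)
      qed
    qed
    also have "\<dots> = ennreal ((2 * l) powr (p - 2)) * mass w
        + ennreal (\<Lambda> powr (p - 2)) * (\<integral>\<^sup>+x\<in>G. esq (w x) \<partial>lborel)
        + (\<integral>\<^sup>+x. ennreal (cmod (w x) powr p) * indicator {\<Lambda><..} (cmod (w x)) \<partial>lborel)"
      unfolding mass_borel by (simp add: nn_integral_add nn_integral_cmult)
    also have "\<dots> \<le> ennreal ((2 * l) powr (p - 2)) * ennreal T + ennreal (\<Lambda> powr (p - 2)) * (ennreal (C * r powr (2 * s)) * ennreal T) + ennreal (\<epsilon> / 3)"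
      using \<Lambda>(2)[OF wF w1] unfolding nn_integral_completion
      by (intro add_mono mult_left_mono nm order_trans[OF mid]) auto
    also have "\<dots> = ennreal ((2 * l) powr (p - 2) * T + a * r powr (2 * s) + \<epsilon> / 3)"
      using T(1) C(1) a \<epsilon> by (simp add: ennreal_plus a_def ennreal_mult' ennreal_mult mult_ac)
    also have "\<dots> \<le> ennreal \<epsilon>"
      using l_small r_small by (intro ennreal_leI) linarith
    finally show "(\<integral>\<^sup>+x. ennreal (cmod (u x) powr p) * indicator {x. R0 \<le> norm x} x \<partial>lebesgue) \<le> ennreal \<epsilon>" .
  qed
qed

text \<open>Away from far points and large values, where \<open>radial_tail\<close> and \<open>uniform_tail\<close> apply, the \<open>p\<close>-th power is at most
a constant times the square, for which \<open>local_compactness\<close> is available. The factor 1/2 keeps the differences in the unit ball.\<close>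

lemma radial_compactness:
  fixes u :: "nat \<Rightarrow> R3 \<Rightarrow> complex"
  assumes u: "\<And>n. u n \<in> FFS" and rad: "\<And>n. radially_symmetric (u n)" and bound: "\<And>n. ip (u n) (u n) \<le> 1"
  obtains r :: "nat \<Rightarrow> nat" where "strict_mono r"
    "\<And>\<epsilon>. 0 < \<epsilon> \<Longrightarrow> \<exists>N. \<forall>i\<ge>N. \<forall>j\<ge>N. Q (\<lambda>x. of_real (1/2) * u (r i) x + of_real (- 1/2) * u (r j) x) \<le> \<epsilon>"
proof -
  obtain r :: "nat \<Rightarrow> nat" where r: "strict_mono r"
    and loc: "\<And>b \<epsilon>. 0 < \<epsilon> \<Longrightarrow> \<exists>N. \<forall>i\<ge>N. \<forall>j\<ge>N. (\<integral>\<^sup>+x\<in>ball 0 b. esq (u (r i) x - u (r j) x) \<partial>lebesgue) \<le> ennreal \<epsilon>"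
    using local_compactness[of u, OF u bound] by blast
  show ?thesis
  proof (rule that[OF r])
    fix \<epsilon> :: real assume \<epsilon>: "0 < \<epsilon>"
    then have \<epsilon>3: "0 < \<epsilon> / 3" by simp
    obtain \<Lambda> where \<Lambda>: "1 \<le> \<Lambda>" "\<And>u. u \<in> FFS \<Longrightarrow> ip u u \<le> 1 \<Longrightarrow>
      upper_tail p \<Lambda> u \<le> ennreal (\<epsilon> / 3)"
      using uniform_tail[OF p_gt_2 p_subcritical \<epsilon>3] by blast
    obtain R0 where R0: "0 < R0" "\<And>u. u \<in> FFS \<Longrightarrow> radially_symmetric u \<Longrightarrow> ip u u \<le> 1 \<Longrightarrow>
      (\<integral>\<^sup>+x. ennreal (cmod (u x) powr p) * indicator {x. R0 \<le> norm x} x \<partial>lebesgue) \<le> ennreal (\<epsilon> / 3)"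
      using radial_tail[OF \<epsilon>3] by blast
    define \<eta> where "\<eta> = \<epsilon> / 3 / \<Lambda> powr (p - 2)"
    have \<eta>: "0 < \<eta>" using \<epsilon> \<Lambda>(1) by (simp add: \<eta>_def)
    obtain N where N: "\<And>i j. N \<le> i \<Longrightarrow> N \<le> j \<Longrightarrow> (\<integral>\<^sup>+x\<in>ball 0 R0. esq (u (r i) x - u (r j) x) \<partial>lebesgue) \<le> ennreal \<eta>"
      using loc[OF \<eta>, of R0] by blast
    have "Q (\<lambda>x. of_real (1/2) * u (r i) x + of_real (- 1/2) * u (r j) x) \<le> \<epsilon>" if ij: "N \<le> i" "N \<le> j" for i j
    proof -
      define v where "v x = of_real (1/2) * u (r i) x + of_real (- 1/2) * u (r j) x" for x
      have v: "v \<in> FFS" unfolding v_def by (rule FFS.lin_closed[OF u u])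
      have vr: "radially_symmetric v" unfolding v_def by (rule radially_symmetric_lin[OF rad rad])
      have vd: "v = (\<lambda>x. of_real (1/2) * (u (r i) x - u (r j) x))" by (simp add: v_def fun_eq_iff algebra_simps)
      have v1: "ip v v \<le> 1"
      proof -
        have "ip v v = (1/2)\<^sup>2 * ip (u (r i)) (u (r i)) + 2 * (1/2) * (- 1/2) * ip (u (r i)) (u (r j)) + (- 1/2)\<^sup>2 * ip (u (r j)) (u (r j))"
          unfolding v_def by (rule FFS.nrm2_lin[OF u u])
        moreover have "\<bar>ip (u (r i)) (u (r j))\<bar> \<le> 1"
        proof -
          have "\<bar>ip (u (r i)) (u (r j))\<bar> \<le> sqrt (ip (u (r i)) (u (r i))) * sqrt (ip (u (r j)) (u (r j)))"
            by (rule FFS.cauchy_schwarz[OF u u])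
          also have "\<dots> \<le> 1 * 1" using bound ip_nonneg[OF u] by (intro mult_mono) auto
          finally show ?thesis by simp
        qed
        ultimately show ?thesis using bound[of "r i"] bound[of "r j"] by (simp add: power2_eq_square)
      qed
      note [measurable] = FFS_measurable[OF v]
      have bm: "ball 0 R0 \<in> sets (lebesgue :: R3 measure)" "{x. R0 \<le> norm x} \<in> sets (lebesgue :: R3 measure)"
        by (auto intro!: sets_completionI_sets simp: borel_closed closed_Collect_le continuous_on_norm_id)
      note [measurable] = bm
      have pt: "ennreal (cmod (v x) powr p) \<le> ennreal (\<Lambda> powr (p - 2)) * (esq (v x) * indicator (ball 0 R0) x)
          + ennreal (cmod (v x) powr p) * indicator {x. R0 \<le> norm x} x + ennreal (cmod (v x) powr p) * indicator {\<Lambda><..} (cmod (v x))" for x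
      proof -
        consider "R0 \<le> norm x" | "\<Lambda> < cmod (v x)" | "norm x < R0" "cmod (v x) \<le> \<Lambda>" by linarith
        then show ?thesis
        proof cases
          case 3
          then have "ennreal (cmod (v x) powr p) \<le> ennreal (\<Lambda> powr (p - 2)) * esq (v x)"
            by (subst ennreal_mult'[symmetric]) (auto intro!: ennreal_leI powr_le_below_level)
          then show ?thesis using 3 by simp
        qed (simp_all add: add_increasing add_increasing2)
      qed
      have "Qn v \<le> (\<integral>\<^sup>+x. ennreal (\<Lambda> powr (p - 2)) * (esq (v x) * indicator (ball 0 R0) x)
          + ennreal (cmod (v x) powr p) * indicator {x. R0 \<le> norm x} x + ennreal (cmod (v x) powr p) * indicator {\<Lambda><..} (cmod (v x)) \<partial>lebesgue)"
        unfolding Qn_def by (intro nn_integral_mono pt)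
      also have "\<dots> = ennreal (\<Lambda> powr (p - 2)) * (\<integral>\<^sup>+x\<in>ball 0 R0. esq (v x) \<partial>lebesgue)
          + (\<integral>\<^sup>+x. ennreal (cmod (v x) powr p) * indicator {x. R0 \<le> norm x} x \<partial>lebesgue)
          + upper_tail p \<Lambda> v"
        by (simp add: nn_integral_add nn_integral_cmult)
      also have "\<dots> \<le> ennreal (\<Lambda> powr (p - 2)) * ennreal \<eta> + ennreal (\<epsilon> / 3) + ennreal (\<epsilon> / 3)"
      proof (intro add_mono mult_left_mono R0(2) \<Lambda>(2) v vr v1)
        have "(cmod (v x))\<^sup>2 \<le> (cmod (u (r i) x - u (r j) x))\<^sup>2" for x
          unfolding vd by (intro power_mono) (auto simp: norm_mult)
        then have "(\<integral>\<^sup>+x\<in>ball 0 R0. esq (v x) \<partial>lebesgue)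
           \<le> (\<integral>\<^sup>+x\<in>ball 0 R0. esq (u (r i) x - u (r j) x) \<partial>lebesgue)"
          by (intro nn_integral_mono mult_right_mono ennreal_leI) auto
        also have "\<dots> \<le> ennreal \<eta>" by (rule N[OF ij])
        finally show "(\<integral>\<^sup>+x\<in>ball 0 R0. esq (v x) \<partial>lebesgue) \<le> ennreal \<eta>" .
      qed auto
      also have "\<dots> = ennreal (\<epsilon> / 3 + \<epsilon> / 3 + \<epsilon> / 3)"
      proof -
        have "ennreal (\<Lambda> powr (p - 2)) * ennreal \<eta> = ennreal (\<epsilon> / 3)"
          using \<Lambda>(1) by (subst ennreal_mult'[symmetric]) (auto simp: \<eta>_def)
        then show ?thesis using \<epsilon> by (simp add: ennreal_plus[symmetric] del: ennreal_plus)
      qed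
      finally have "Qn v \<le> ennreal \<epsilon>" by simp
      then have "Q v \<le> \<epsilon>" using \<epsilon> by (simp add: Qn_eq[OF v])
      then show ?thesis unfolding v_def .
    qed
    then show "\<exists>N. \<forall>i\<ge>N. \<forall>j\<ge>N. Q (\<lambda>x. of_real (1/2) * u (r i) x + of_real (- 1/2) * u (r j) x) \<le> \<epsilon>" by blast
  qed
qed

text \<open>Each member \<open>u\<^sub>i\<close> is the sum of the midpoint and half the difference; the latter is small in \<open>L\<^sup>p\<close>, so by
\<open>Q_perturb\<close> the value at the midpoint cannot be much smaller than \<open>Q u\<^sub>i\<close>.\<close>

lemma radial_quasi_concave:
  fixes u :: "nat \<Rightarrow> R3 \<Rightarrow> complex"
  assumes u: "\<And>n. u n \<in> HR \<and> ip (u n) (u n) \<le> 1"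
  shows "\<exists>r. strict_mono (r :: nat \<Rightarrow> nat) \<and>
       (\<forall>e>0. \<exists>N. \<forall>i\<ge>N. \<forall>j\<ge>N. min (Q (u (r i))) (Q (u (r j))) - e \<le> Q (\<lambda>x. of_real (1/2) * u (r i) x + of_real (1/2) * u (r j) x))"
proof -
  have uF: "u n \<in> FFS" and ur: "radially_symmetric (u n)" and u1: "ip (u n) (u n) \<le> 1" for n
    using u[of n] by (auto simp: HR_iff HA_FFS)
  obtain r :: "nat \<Rightarrow> nat" where r: "strict_mono r"
    and comp: "\<And>\<epsilon>. 0 < \<epsilon> \<Longrightarrow> \<exists>N. \<forall>i\<ge>N. \<forall>j\<ge>N. Q (\<lambda>x. of_real (1/2) * u (r i) x + of_real (- 1/2) * u (r j) x) \<le> \<epsilon>"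
    using radial_compactness[of u, OF uF ur u1] by blast
  obtain K where K: "0 < K" "\<And>u e. u \<in> FFS \<Longrightarrow> 0 < e \<Longrightarrow> ip u u \<le> e\<^sup>2 \<Longrightarrow> Q u \<le> K * e powr p"
    using Q_bound by blast
  have "\<exists>N. \<forall>i\<ge>N. \<forall>j\<ge>N. min (Q (u (r i))) (Q (u (r j))) - e \<le> Q (\<lambda>x. of_real (1/2) * u (r i) x + of_real (1/2) * u (r j) x)" if e: "0 < e" for e
  proof -
    obtain \<delta> where \<delta>: "0 < \<delta>" "\<And>u v. u \<in> FFS \<Longrightarrow> v \<in> FFS \<Longrightarrow> Q u \<le> K \<Longrightarrow> Q v \<le> \<delta> \<Longrightarrow> Q (\<lambda>x. u x + v x) \<le> Q u + e"
      using Q_perturb[OF e less_imp_le[OF K(1)]] by blast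
    obtain N where N: "\<And>i j. N \<le> i \<Longrightarrow> N \<le> j \<Longrightarrow> Q (\<lambda>x. of_real (1/2) * u (r i) x + of_real (- 1/2) * u (r j) x) \<le> \<delta>"
      using comp[OF \<delta>(1)] by blast
    have "min (Q (u (r i))) (Q (u (r j))) - e \<le> Q (\<lambda>x. of_real (1/2) * u (r i) x + of_real (1/2) * u (r j) x)" if ij: "N \<le> i" "N \<le> j" for i j
    proof -
      define c where "c x = of_real (1/2) * u (r i) x + of_real (1/2) * u (r j) x" for x
      define d where "d x = of_real (1/2) * u (r i) x + of_real (- 1/2) * u (r j) x" for x
      have c: "c \<in> FFS" and d: "d \<in> FFS" unfolding c_def d_def by (rule FFS.lin_closed[OF uF uF])+
      have "ip c c = (1/2)\<^sup>2 * ip (u (r i)) (u (r i)) + 2 * (1/2) * (1/2) * ip (u (r i)) (u (r j)) + (1/2)\<^sup>2 * ip (u (r j)) (u (r j))"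
        unfolding c_def by (rule FFS.nrm2_lin[OF uF uF])
      moreover have "ip d d = (1/2)\<^sup>2 * ip (u (r i)) (u (r i)) + 2 * (1/2) * (- 1/2) * ip (u (r i)) (u (r j)) + (- 1/2)\<^sup>2 * ip (u (r j)) (u (r j))"
        unfolding d_def by (rule FFS.nrm2_lin[OF uF uF])
      ultimately have "ip c c \<le> 1"
        using ip_nonneg[OF d] u1[of "r i"] u1[of "r j"] by (simp add: power2_eq_square)
      then have "Q c \<le> K" using K(2)[OF c, of 1] by simp
      moreover have "Q d \<le> \<delta>" unfolding d_def by (rule N[OF ij])
      ultimately have "Q (\<lambda>x. c x + d x) \<le> Q c + e" by (rule \<delta>(2)[OF c d])
      moreover have "(\<lambda>x. c x + d x) = u (r i)" by (simp add: c_def d_def fun_eq_iff)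
      ultimately have "Q (u (r i)) \<le> Q c + e" by simp
      then show ?thesis unfolding c_def by linarith
    qed
    then show ?thesis by blast
  qed
  with r show ?thesis by blast
qed

end

section \<open>A radial test function\<close>

text \<open>The flat function \<open>exp (- 1 / t)\<close>, with a polynomial in \<open>1 / t\<close> as an additional factor so that the family
is closed under differentiation.\<close>

definition flat_exp :: "real poly \<Rightarrow> real \<Rightarrow> real" where
  "flat_exp P t = (if 0 < t then poly P (1 / t) * exp (- (1 / t)) else 0)"

lemma poly_times_exp_minus_tendsto_0:
  "((\<lambda>x::real. x ^ k * poly P x / exp x) \<longlongrightarrow> 0) at_top"
proof (induction P arbitrary: k)
  case 0 then show ?case by simp
next
  case (pCons a P)
  have "((\<lambda>x::real. a * (x ^ k / exp x) + x ^ Suc k * poly P x / exp x) \<longlongrightarrow> a * 0 + 0) at_top"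
    by (intro tendsto_add tendsto_mult tendsto_const tendsto_power_div_exp_0 pCons.IH)
  then show ?case by (simp add: field_simps)
qed

lemma flat_exp_derivative:
  "(flat_exp P has_real_derivative flat_exp ([:0, 0, 1:] * (P - pderiv P)) t) (at t)"
proof -
  consider "0 < t" | "t < 0" | "t = 0" by linarith
  then show ?thesis
  proof cases
    case 1
    have "((\<lambda>t. poly P (1 / t) * exp (- (1 / t))) has_real_derivative flat_exp ([:0, 0, 1:] * (P - pderiv P)) t) (at t)"
      using 1 by (auto intro!: derivative_eq_intros simp: flat_exp_def power2_eq_square field_simps)
    then show ?thesis
      by (rule has_field_derivative_transform_within_open[of _ _ _ "{0<..}"]) (use 1 in \<open>auto simp: flat_exp_def\<close>)
  next
    case 2
    have "((\<lambda>t. 0) has_real_derivative flat_exp ([:0, 0, 1:] * (P - pderiv P)) t) (at t)"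
      using 2 by (simp add: flat_exp_def)
    then show ?thesis
      by (rule has_field_derivative_transform_within_open[of _ _ _ "{..<0}"]) (use 2 in \<open>auto simp: flat_exp_def\<close>)
  next
    case 3
    have "((\<lambda>h. flat_exp P h / h) \<longlongrightarrow> 0) (at_left 0)"
      by (rule tendsto_eventually) (auto simp: eventually_at_left_field flat_exp_def intro!: exI[of _ "-1"])
    moreover have "((\<lambda>h. flat_exp P h / h) \<longlongrightarrow> 0) (at_right 0)"
    proof -
      have "((\<lambda>h::real. (inverse h) ^ 1 * poly P (inverse h) / exp (inverse h)) \<longlongrightarrow> 0) (at_right 0)"
        by (rule filterlim_compose[OF poly_times_exp_minus_tendsto_0 filterlim_inverse_at_top_right])
      moreover have "\<forall>\<^sub>F h in at_right 0. (inverse h) ^ 1 * poly P (inverse h) / exp (inverse h) = flat_exp P h / h"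
        unfolding eventually_at_right_field by (rule exI[of _ 1]) (auto simp: flat_exp_def exp_minus field_simps)
      ultimately show ?thesis by (rule Lim_transform_eventually)
    qed
    ultimately have "((\<lambda>h. flat_exp P h / h) \<longlongrightarrow> 0) (at 0)"
      by (simp add: filterlim_split_at)
    then show ?thesis
      using 3 by (simp add: has_field_derivative_iff flat_exp_def)
  qed
qed

text \<open>A class of functions that contains the bump and all directional derivatives of its members; hence every
member is smooth.\<close>

inductive bump_class :: "(R3 \<Rightarrow> complex) \<Rightarrow> bool" where
  base: "bump_class (\<lambda>x. of_real (flat_exp P (1 - x \<bullet> x)))"
| inner: "bump_class f \<Longrightarrow> bump_class (\<lambda>x. of_real (x \<bullet> w) * f x)"
| scale: "bump_class f \<Longrightarrow> bump_class (\<lambda>x. of_real c * f x)"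
| add: "bump_class f \<Longrightarrow> bump_class g \<Longrightarrow> bump_class (\<lambda>x. f x + g x)"

lemma bump_class_derivative:
  assumes "bump_class f"
  shows "\<exists>f'. (\<forall>x. (f has_derivative f' x) (at x)) \<and> (\<forall>v. bump_class (\<lambda>x. f' x v))"
  using assms
proof induction
  case (base P)
  let ?P' = "[:0, 0, 1:] * (P - pderiv P)"
  define f' :: "R3 \<Rightarrow> R3 \<Rightarrow> complex" where "f' x v = of_real (-2) * (of_real (x \<bullet> v) * of_real (flat_exp ?P' (1 - x \<bullet> x)))" for x v
  have "((\<lambda>x. of_real (flat_exp P (1 - x \<bullet> x)) :: complex) has_derivative f' x) (at x)" for x :: R3
  proof -
    have d1: "((\<lambda>x::R3. 1 - x \<bullet> x) has_derivative (\<lambda>v. - 2 * (x \<bullet> v))) (at x)"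
      by (auto intro!: derivative_eq_intros simp: inner_commute)
    have d2: "(flat_exp P has_derivative (*) (flat_exp ?P' (1 - x \<bullet> x))) (at (1 - x \<bullet> x))"
      using flat_exp_derivative[of P "1 - x \<bullet> x"] unfolding has_field_derivative_def .
    have "((\<lambda>x::R3. flat_exp P (1 - x \<bullet> x)) has_derivative (\<lambda>v. flat_exp ?P' (1 - x \<bullet> x) * (- 2 * (x \<bullet> v)))) (at x)"
      by (rule has_derivative_compose[OF d1, where g = "flat_exp P", OF d2])
    then have "((\<lambda>x::R3. of_real (flat_exp P (1 - x \<bullet> x)) :: complex) has_derivative (\<lambda>v. of_real (flat_exp ?P' (1 - x \<bullet> x) * (- 2 * (x \<bullet> v))))) (at x)"
      by (rule has_derivative_of_real)
    moreover have "f' x = (\<lambda>v. of_real (flat_exp ?P' (1 - x \<bullet> x) * (- 2 * (x \<bullet> v))))"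
      by (simp add: f'_def fun_eq_iff)
    ultimately show ?thesis by simp
  qed
  moreover have "bump_class (\<lambda>x. f' x v)" for v
    unfolding f'_def by (intro bump_class.intros)
  ultimately show ?case by blast
next
  case (inner f w)
  then obtain f' where f': "\<And>x. (f has_derivative f' x) (at x)" "\<And>v. bump_class (\<lambda>x. f' x v)" by blast
  have "((\<lambda>x. of_real (x \<bullet> w) * f x) has_derivative (\<lambda>v. of_real (x \<bullet> w) * f' x v + of_real (v \<bullet> w) * f x)) (at x)" for x
    by (rule has_derivative_mult[OF has_derivative_of_real f'(1)]) (auto intro!: derivative_eq_intros)
  moreover have "bump_class (\<lambda>x. of_real (x \<bullet> w) * f' x v + of_real (v \<bullet> w) * f x)" for v
    by (intro bump_class.intros f' inner.hyps)
  ultimately show ?case by (intro exI[of _ "\<lambda>x v. of_real (x \<bullet> w) * f' x v + of_real (v \<bullet> w) * f x"]) blast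
next
  case (scale f c)
  then obtain f' where f': "\<And>x. (f has_derivative f' x) (at x)" "\<And>v. bump_class (\<lambda>x. f' x v)" by blast
  then show ?case
    by (intro exI[of _ "\<lambda>x v. of_real c * f' x v"]) (auto intro!: bump_class.intros has_derivative_mult_right)
next
  case (add f g)
  then obtain f' g' where "\<And>x. (f has_derivative f' x) (at x)" "\<And>v. bump_class (\<lambda>x. f' x v)"
    "\<And>x. (g has_derivative g' x) (at x)" "\<And>v. bump_class (\<lambda>x. g' x v)" by blast
  then show ?case
    by (intro exI[of _ "\<lambda>x v. f' x v + g' x v"]) (auto intro!: bump_class.intros has_derivative_add)
qed

lemma bump_class_C_k: "bump_class f \<Longrightarrow> C_k k f"
proof (induction k arbitrary: f)
  case 0
  then obtain f' where f': "\<And>x. (f has_derivative f' x) (at x)" using bump_class_derivative by blast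
  show ?case
    using has_derivative_continuous[OF f'] by (simp add: continuous_on_eq_continuous_at)
next
  case (Suc k)
  then obtain f' where f': "\<And>x. (f has_derivative f' x) (at x)" "\<And>v. bump_class (\<lambda>x. f' x v)"
    using bump_class_derivative by blast
  have "frechet_derivative f (at x) = f' x" for x
    using frechet_derivative_at[OF f'(1)] by simp
  then show ?case
    using f' Suc.IH by (auto simp: differentiable_on_def differentiable_def)
qed

definition bump :: "R3 \<Rightarrow> complex" where
  "bump x = of_real (flat_exp 1 (1 - x \<bullet> x))"

lemma flat_exp_1_bounds: "0 \<le> flat_exp 1 t" "flat_exp 1 t \<le> 1"
  by (auto simp: flat_exp_def)

text \<open>The derivative \<open>t powr (- 2) * exp (- 1 / t)\<close> is at most \<open>2 powr 2\<close>.\<close>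

lemma flat_exp_1_lipschitz: "\<bar>flat_exp 1 a - flat_exp 1 b\<bar> \<le> 4 * \<bar>a - b\<bar>"
proof -
  have "norm (flat_exp 1 a - flat_exp 1 b) \<le> 4 * norm (a - b)"
  proof (rule field_differentiable_bound[of UNIV])
    show "(flat_exp 1 has_field_derivative flat_exp ([:0, 0, 1:] * (1 - pderiv 1)) t) (at t within UNIV)" for t
      by (rule flat_exp_derivative)
    show "norm (flat_exp ([:0, 0, 1:] * (1 - pderiv 1)) t) \<le> 4" for t :: real
    proof (cases "0 < t")
      case True
      have "(1 / t) powr 2 * exp (- (1 / t)) \<le> 2 powr 2"
        using True by (intro powr_mult_exp_minus_le) auto
      then show ?thesis using True by (simp add: flat_exp_def power2_eq_square)
    qed (simp add: flat_exp_def)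
  qed auto
  then show ?thesis by simp
qed

lemma bump_bounds: "cmod (bump x) \<le> 1"
  unfolding bump_def using flat_exp_1_bounds[of "1 - x \<bullet> x"] by simp

lemma bump_outside: "1 \<le> norm x \<Longrightarrow> bump x = 0"
proof -
  assume "1 \<le> norm x"
  then have "1 \<le> (norm x)\<^sup>2" by simp
  then show ?thesis by (simp add: bump_def flat_exp_def dot_square_norm)
qed

lemma bump_inside: "norm x < 1 \<Longrightarrow> bump x \<noteq> 0"
proof -
  assume "norm x < 1"
  then have "(norm x)\<^sup>2 < 1" by (simp add: power_less_one_iff abs_square_less_1)
  then show ?thesis by (simp add: bump_def flat_exp_def dot_square_norm)
qed

text \<open>The function \<open>x \<bullet> x\<close> is not Lipschitz continuous on the whole space, but the bump depends only on \<open>min (norm x) 1\<close>, whose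
square is.\<close>

lemma bump_lipschitz: "cmod (bump x - bump y) \<le> 8 * dist x y"
proof -
  have e: "flat_exp 1 (1 - z \<bullet> z) = flat_exp 1 (1 - (min (norm z) 1)\<^sup>2)" for z :: R3
  proof (cases "norm z \<le> 1")
    case True then show ?thesis by (simp add: dot_square_norm)
  next
    case False
    then have "1\<^sup>2 < (norm z)\<^sup>2" by (intro power_strict_mono) auto
    then have "1 < (norm z)\<^sup>2" by (simp only: one_power2)
    then have "\<not> 0 < 1 - (norm z)\<^sup>2" by linarith
    then have "flat_exp 1 (1 - z \<bullet> z) = 0" unfolding flat_exp_def dot_square_norm by (rule if_not_P)
    then show ?thesis using False by (simp add: flat_exp_def)
  qed
  let ?a = "min (norm x) 1" and ?b = "min (norm y) 1"
  have "cmod (bump x - bump y) = \<bar>flat_exp 1 (1 - ?a\<^sup>2) - flat_exp 1 (1 - ?b\<^sup>2)\<bar>"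
    unfolding bump_def e[of x] e[of y] of_real_diff[symmetric] norm_of_real ..
  also have "\<dots> \<le> 4 * \<bar>(1 - ?a\<^sup>2) - (1 - ?b\<^sup>2)\<bar>" by (rule flat_exp_1_lipschitz)
  also have "\<bar>(1 - ?a\<^sup>2) - (1 - ?b\<^sup>2)\<bar> = \<bar>?a - ?b\<bar> * (?a + ?b)"
  proof -
    have "(1 - ?a\<^sup>2) - (1 - ?b\<^sup>2) = - ((?a - ?b) * (?a + ?b))" by (simp add: power2_eq_square algebra_simps)
    moreover have "0 \<le> ?a + ?b" by simp
    ultimately show ?thesis by (simp only: abs_minus_cancel abs_mult abs_of_nonneg)
  qed
  also have "\<dots> \<le> dist x y * 2"
  proof (intro mult_mono)
    have "\<bar>?a - ?b\<bar> \<le> \<bar>norm x - norm y\<bar>" by (simp add: min_def)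
    also have "\<dots> \<le> dist x y" using norm_triangle_ineq3 by (simp add: dist_norm)
    finally show "\<bar>?a - ?b\<bar> \<le> dist x y" .
  qed auto
  finally show ?thesis by simp
qed

lemma bump_test_function: "bump \<in> test_functions"
proof -
  have "bounded {x. bump x \<noteq> 0}"
    by (rule bounded_subset[of "ball 0 1"]) (use bump_outside in \<open>auto simp: not_le[symmetric]\<close>)
  moreover have "bump_class bump"
    using bump_class.base[of 1] by (simp add: bump_def[abs_def])
  ultimately show ?thesis by (auto simp: test_functions_iff bump_class_C_k)
qed

lemma bump_continuous: "continuous_on UNIV bump"
  using bump_test_function by (metis C_k.simps(1) test_functions_iff)

lemma bump_measurable [measurable]: "bump \<in> borel_measurable borel"
  using bump_continuous by (rule borel_measurable_continuous_onI)

lemma radially_symmetric_bump: "radially_symmetric bump"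
  unfolding radially_symmetric_def bump_def by (simp add: dot_square_norm)

lemma nn_integral_reflect_translate:
  fixes f :: "R3 \<Rightarrow> ennreal"
  assumes [measurable]: "f \<in> borel_measurable borel"
  shows "(\<integral>\<^sup>+y. f (x - y) \<partial>lborel) = (\<integral>\<^sup>+z. f z \<partial>lborel)"
  by (subst (2) lborel_affine[of "-1" x]) (auto simp: nn_integral_density nn_integral_distr)

context magnetic begin

text \<open>At distance at most 1 the midpoint stays in the ball of radius 2, where \<open>A\<close> is bounded, so phase and bump are both
Lipschitz. At larger distance the bound 2 for the difference is enough.\<close>

lemma D_bump_bound:
  obtains C where "0 \<le> C" "\<And>x y. (cmod (D bump x y))\<^sup>2 \<le> C * (dist x y)\<^sup>2 * (indicator (ball 0 1) x + indicator (ball 0 1) y)"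
proof -
  obtain a where a: "0 \<le> a" "\<And>x. norm x \<le> 2 \<Longrightarrow> norm (A x) \<le> a"
    using A_bounded_on_ball by blast
  show ?thesis
  proof (rule that[of "(a + 8)\<^sup>2"])
    fix x y :: R3
    show "(cmod (D bump x y))\<^sup>2 \<le> (a + 8)\<^sup>2 * (dist x y)\<^sup>2 * (indicator (ball 0 1) x + indicator (ball 0 1) y)"
    proof (cases "x \<in> ball 0 1 \<or> y \<in> ball 0 1")
      case False
      then have "bump x = 0" "bump y = 0" using bump_outside by auto
      then show ?thesis by (simp add: magnetic_diff_def)
    next
      case True
      define \<theta> where "\<theta> = - ((x - y) \<bullet> A (midpoint x y))"
      have D: "D bump x y = (exp (\<i> * of_real \<theta>) - 1) * bump x + (bump x - bump y)"
        by (simp add: magnetic_diff_def \<theta>_def algebra_simps)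
      have "cmod (D bump x y) \<le> (a + 8) * dist x y"
      proof (cases "dist x y \<le> 1")
        case near: True
        have "norm (midpoint x y) \<le> 2"
        proof -
          have "norm (midpoint x y) \<le> (norm x + norm y) / 2"
            using norm_triangle_ineq[of x y] by (simp add: midpoint_def)
          moreover have "norm x \<le> norm y + dist x y" "norm y \<le> norm x + dist x y"
            using norm_triangle_sub[of x y] norm_triangle_sub[of y x] by (simp_all add: dist_norm norm_minus_commute)
          ultimately show ?thesis using True near by auto
        qed
        then have "norm (A (midpoint x y)) \<le> a" by (rule a(2))
        then have "cmod (exp (\<i> * of_real \<theta>) - 1) \<le> dist x y * a"
          unfolding \<theta>_def by (rule phase_bound)
        then have "cmod ((exp (\<i> * of_real \<theta>) - 1) * bump x) \<le> (dist x y * a) * 1"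
          unfolding norm_mult using bump_bounds a(1) by (intro mult_mono) auto
        then show ?thesis
          unfolding D using norm_triangle_ineq[of "(exp (\<i> * of_real \<theta>) - 1) * bump x" "bump x - bump y"] bump_lipschitz[of x y]
          by (simp add: algebra_simps)
      next
        case far: False
        have "cmod (D bump x y) \<le> cmod (exp (\<i> * of_real \<theta>) * bump x) + cmod (bump y)"
          unfolding magnetic_diff_def \<theta>_def using norm_triangle_ineq4 by simp
        also have "\<dots> \<le> 1 + 1"
          using bump_bounds by (intro add_mono) (auto simp: norm_mult)
        also have "\<dots> \<le> (a + 8) * dist x y"
        proof -
          have "8 * 1 \<le> (a + 8) * dist x y" using far a(1) by (intro mult_mono) auto
          then show ?thesis by simp
        qed
        finally show ?thesis .
      qed
      then have "(cmod (D bump x y))\<^sup>2 \<le> ((a + 8) * dist x y)\<^sup>2" by (intro power_mono) auto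
      also have "\<dots> = (a + 8)\<^sup>2 * (dist x y)\<^sup>2 * 1" by (simp add: power_mult_distrib)
      also have "\<dots> \<le> (a + 8)\<^sup>2 * (dist x y)\<^sup>2 * (indicator (ball 0 1) x + indicator (ball 0 1) y)"
        using True by (intro mult_left_mono) (auto simp: indicator_def)
      finally show ?thesis .
    qed
  qed simp
qed

text \<open>The second moment of the kernel absorbs the factor \<open>dist x y\<close> squared from \<open>D_bump_bound\<close>.\<close>

lemma bump_in_FFS: "bump \<in> FFS"
proof -
  obtain C where C: "0 \<le> C" "\<And>x y. (cmod (D bump x y))\<^sup>2 \<le> C * (dist x y)\<^sup>2 * (indicator (ball 0 1) x + indicator (ball 0 1) y)"
    using D_bump_bound by blast
  define k where "k z = ennreal ((norm z)\<^sup>2 * \<kappa> z)" for z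
  have [measurable]: "k \<in> borel_measurable borel" unfolding k_def[abs_def] by measurable
  define M where "M = (\<integral>\<^sup>+z. k z \<partial>lborel)"
  have M: "M < \<infinity>" unfolding M_def k_def using bessel_kernel_second_moment s_pos s_less_1 m_pos by blast
  have k_sym: "k (x - y) = k (y - x)" for x y
    by (simp add: k_def bessel_kernel_def norm_minus_commute)
  note [measurable] = borel_open[OF open_ball, of "0 :: R3" 1]
  have "nonlocal bump \<le> (\<integral>\<^sup>+x. \<integral>\<^sup>+y. ennreal C * (k (x - y) * indicator (ball 0 1) x + k (x - y) * indicator (ball 0 1) y) \<partial>lborel \<partial>lborel)"
    unfolding nonlocal_iterated[OF bump_measurable]
  proof (intro nn_integral_mono)
    fix x y :: R3
    have "(cmod (D bump x y))\<^sup>2 * \<kappa> (x - y) \<le> C * (dist x y)\<^sup>2 * (indicator (ball 0 1) x + indicator (ball 0 1) y) * \<kappa> (x - y)"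
      by (intro mult_right_mono C bessel_kernel_nonneg)
    then have "ennreal ((cmod (D bump x y))\<^sup>2 * \<kappa> (x - y)) \<le> ennreal (C * ((norm (x - y))\<^sup>2 * \<kappa> (x - y) * (indicator (ball 0 1) x + indicator (ball 0 1) y)))"
      by (intro ennreal_leI) (simp add: dist_norm mult_ac)
    also have "\<dots> = ennreal C * (k (x - y) * ennreal (indicator (ball 0 1) x + indicator (ball 0 1) y))"
      unfolding k_def by (subst ennreal_mult'[OF C(1)], subst ennreal_mult') (auto simp: bessel_kernel_nonneg)
    also have "ennreal (indicator (ball 0 1) x + indicator (ball 0 1) y) = indicator (ball 0 1) x + indicator (ball 0 1) y"
      by (auto simp: indicator_def)
    also have "k (x - y) * (indicator (ball 0 1) x + indicator (ball 0 1) y) = k (x - y) * indicator (ball 0 1) x + k (x - y) * indicator (ball 0 1) y"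
      by (rule distrib_left)
    finally show "ennreal ((cmod (D bump x y))\<^sup>2 * \<kappa> (x - y)) \<le> ennreal C * (k (x - y) * indicator (ball 0 1) x + k (x - y) * indicator (ball 0 1) y)" .
  qed
  also have "\<dots> = ennreal C * ((\<integral>\<^sup>+x. \<integral>\<^sup>+y. k (x - y) * indicator (ball 0 1) x \<partial>lborel \<partial>lborel) + (\<integral>\<^sup>+x. (\<integral>\<^sup>+y\<in>ball 0 1. k (x - y) \<partial>lborel) \<partial>lborel))"
    by (simp add: nn_integral_cmult nn_integral_add)
  also have "(\<integral>\<^sup>+x. \<integral>\<^sup>+y. k (x - y) * indicator (ball 0 1) x \<partial>lborel \<partial>lborel) = M * emeasure lborel (ball (0 :: R3) 1)"
    by (simp add: nn_integral_multc nn_integral_reflect_translate M_def[symmetric] nn_integral_cmult)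
  also have "(\<integral>\<^sup>+x. (\<integral>\<^sup>+y\<in>ball 0 1. k (x - y) \<partial>lborel) \<partial>lborel) = (\<integral>\<^sup>+y. \<integral>\<^sup>+x. k (x - y) * indicator (ball 0 1) y \<partial>lborel \<partial>lborel)"
    by (rule lborel_pair.Fubini'[symmetric]) measurable
  also have "\<dots> = (\<integral>\<^sup>+y\<in>(ball (0 :: R3) 1). M \<partial>lborel)"
  proof (intro nn_integral_cong)
    fix y :: R3
    have "(\<integral>\<^sup>+x. k (x - y) * indicator (ball 0 1) y \<partial>lborel) = (\<integral>\<^sup>+x. k (x - y) \<partial>lborel) * indicator (ball 0 1) y"
      by (rule nn_integral_multc) measurable
    also have "(\<integral>\<^sup>+x. k (x - y) \<partial>lborel) = (\<integral>\<^sup>+x. k (y - x) \<partial>lborel)"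
      by (intro nn_integral_cong k_sym)
    also have "\<dots> = M" unfolding M_def by (rule nn_integral_reflect_translate) measurable
    finally show "(\<integral>\<^sup>+x. k (x - y) * indicator (ball 0 1) y \<partial>lborel) = M * indicator (ball 0 1) y" .
  qed
  also have "\<dots> = M * emeasure lborel (ball (0 :: R3) 1)"
    by (simp add: nn_integral_cmult)
  finally have "nonlocal bump \<le> ennreal C * (M * emeasure lborel (ball (0 :: R3) 1) + M * emeasure lborel (ball (0 :: R3) 1))" .
  also have "\<dots> < \<infinity>"
    using M by (simp add: ennreal_mult_less_top emeasure_ball_R3)
  finally have 1: "nonlocal bump < \<infinity>" .
  have "mass bump \<le> (\<integral>\<^sup>+x. indicator (ball (0 :: R3) 1) x \<partial>lborel)"
    unfolding mass_borel
  proof (intro nn_integral_mono)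
    fix x :: R3
    show "esq (bump x) \<le> indicator (ball 0 1) x"
      using bump_bounds[of x] bump_outside[of x] by (cases "norm x < 1") (auto simp: power_le_one ennreal_le_1)
  qed
  also have "\<dots> < \<infinity>" by (simp add: emeasure_ball_R3)
  finally show ?thesis
    using 1 by (simp add: FFS_iff measurable_completion)
qed

lemma bump_in_HR: "bump \<in> HR"
proof -
  have "dist2 bump bump = 0"
    using FFS.nrm2_diff[OF bump_in_FFS bump_in_FFS] by simp
  then have "bump \<in> HA"
    unfolding HA_iff using bump_in_FFS bump_test_function
    by (intro conjI allI impI bexI[of _ bump]) auto
  then show ?thesis by (simp add: HR_iff radially_symmetric_bump)
qed

end

section \<open>Radial representatives\<close>

definition ball_average :: "(R3 \<Rightarrow> complex) \<Rightarrow> real \<Rightarrow> R3 \<Rightarrow> complex" where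
  "ball_average f r x = of_real (1 / (ball_vol * r ^ 3)) * (\<integral>y. indicator (ball x r) y *\<^sub>R f y \<partial>lborel)"

text \<open>Averages do not see null sets: invariance of \<open>f\<close> almost everywhere becomes symmetry of the average at
every point.\<close>

lemma ball_average_rotation_invariant:
  assumes [measurable]: "f \<in> borel_measurable borel"
    and inv: "\<And>g. orthogonal_transformation g \<Longrightarrow> AE x in lborel. f (g x) = f x"
    and xy: "norm x = norm y"
  shows "ball_average f r x = ball_average f r y"
proof -
  obtain g where g: "orthogonal_transformation g" "g x = y"
    using orthogonal_transformation_exists[OF xy] by blast
  note [measurable] = orthogonal_measurable[OF g(1)] borel_open[OF open_ball, of x r] borel_open[OF open_ball, of y r]
  have iso: "dist (g a) (g b) = dist a b" for a b
    using g(1) by (simp add: orthogonal_transformation_isometry)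
  have "(\<integral>z. indicator (ball y r) z *\<^sub>R f z \<partial>lborel) = (\<integral>z. indicator (ball y r) z *\<^sub>R f z \<partial>(distr lborel borel g))"
    by (simp only: distr_orthogonal[OF g(1)])
  also have "\<dots> = (\<integral>z. indicator (ball y r) (g z) *\<^sub>R f (g z) \<partial>lborel)"
    by (rule integral_distr) measurable
  also have "\<dots> = (\<integral>z. indicator (ball x r) z *\<^sub>R f z \<partial>lborel)"
  proof (rule integral_cong_AE)
    show "AE z in lborel. indicator (ball y r) (g z) *\<^sub>R f (g z) = indicator (ball x r) z *\<^sub>R f z"
      using inv[OF g(1)]
    proof eventually_elim
      case (elim z)
      have "indicator (ball y r) (g z) = (indicator (ball x r) z :: real)"
        using iso[of x z] g(2) by (simp add: indicator_def)
      then show ?case using elim by simp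
    qed
  qed measurable
  finally show ?thesis by (simp add: ball_average_def)
qed

lemma ball_average_measurable:
  assumes [measurable]: "f \<in> borel_measurable borel"
  shows "ball_average f r \<in> borel_measurable borel"
proof -
  have "(\<lambda>z. indicator (ball (fst z) r) (snd z) *\<^sub>R f (snd z)) \<in> borel_measurable (borel \<Otimes>\<^sub>M lborel)"
    unfolding indicator_def ball_def mem_Collect_eq by measurable
  then have "(\<lambda>x. \<integral>y. indicator (ball x r) y *\<^sub>R f y \<partial>lborel) \<in> borel_measurable borel"
    using lborel.borel_measurable_lebesgue_integral[of "\<lambda>x y. indicator (ball x r) y *\<^sub>R f y" borel] by (simp add: split_beta')
  then show ?thesis unfolding ball_average_def[abs_def] by measurable
qed

context magnetic begin

lemma ball_average_error:
  assumes f [measurable]: "f \<in> borel_measurable borel" and r: "0 < r" and ms: "mass f < \<infinity>"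
  shows "ennreal (ball_vol * r ^ 3) * esq (f x - ball_average f r x)
    \<le> (\<integral>\<^sup>+y\<in>ball x r. esq (f x - f y) \<partial>lborel)"
proof -
  let ?b = "ball_vol * r ^ 3"
  have b: "0 < ?b" using r ball_vol_pos by simp
  note Bm [measurable] = borel_open[OF open_ball, of x r]
  have Bfin: "emeasure lborel (ball x r) < \<infinity>" by (rule emeasure_lborel_ball_finite)
  define h where "h y = f x - f y" for y
  have h [measurable]: "h \<in> borel_measurable borel" unfolding h_def[abs_def] by measurable
  have ff: "(\<integral>\<^sup>+y\<in>ball x r. esq (f y) \<partial>lborel) < \<infinity>"
  proof -
    have "(\<integral>\<^sup>+y\<in>ball x r. esq (f y) \<partial>lborel) \<le> mass f"
      unfolding mass_borel by (intro nn_integral_mono) (auto simp: indicator_def)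
    then show ?thesis using ms by (rule le_less_trans)
  qed
  have hf: "(\<integral>\<^sup>+y\<in>ball x r. esq (h y) \<partial>lborel) < \<infinity>"
  proof -
    have "(\<integral>\<^sup>+y\<in>ball x r. esq (h y) \<partial>lborel)
      \<le> (\<integral>\<^sup>+y. ennreal (2 * (cmod (f x))\<^sup>2) * indicator (ball x r) y + 2 * (esq (f y) * indicator (ball x r) y) \<partial>lborel)"
    proof (intro nn_integral_mono)
      fix y
      have "(cmod (h y))\<^sup>2 \<le> 2 * (cmod (f x))\<^sup>2 + 2 * (cmod (f y))\<^sup>2"
        using power2_cmod_add_le[of "f x" "- f y"] by (simp add: h_def)
      then have "esq (h y) \<le> ennreal (2 * (cmod (f x))\<^sup>2) + 2 * esq (f y)"
        by (subst (asm) ennreal_le_iff[symmetric]) (auto simp: ennreal_plus ennreal_mult)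
      then show "esq (h y) * indicator (ball x r) y \<le> ennreal (2 * (cmod (f x))\<^sup>2) * indicator (ball x r) y + 2 * (esq (f y) * indicator (ball x r) y)"
        by (simp add: indicator_def)
    qed
    also have "\<dots> = ennreal (2 * (cmod (f x))\<^sup>2) * emeasure lborel (ball x r) + 2 * (\<integral>\<^sup>+y\<in>ball x r. esq (f y) \<partial>lborel)"
      by (simp add: nn_integral_add nn_integral_cmult)
    also have "\<dots> < \<infinity>"
      using ff Bfin by (simp add: ennreal_mult_less_top)
    finally show ?thesis .
  qed
  have fi: "integrable lborel (\<lambda>y. indicator (ball x r) y *\<^sub>R f y)"
    by (rule cell_variance(3)[OF f Bm Bfin ff])
  have ci: "integrable lborel (\<lambda>y. indicator (ball x r) y *\<^sub>R f x)"
    using Bfin by (intro integrable_scaleR_left integrable_real_indicator) auto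
  have "(\<integral>y. indicator (ball x r) y *\<^sub>R h y \<partial>lborel) = (\<integral>y. indicator (ball x r) y *\<^sub>R f x \<partial>lborel) - (\<integral>y. indicator (ball x r) y *\<^sub>R f y \<partial>lborel)"
    unfolding h_def scaleR_diff_right using fi ci by (intro Bochner_Integration.integral_diff)
  also have "(\<integral>y. indicator (ball x r) y *\<^sub>R f x \<partial>lborel) = of_real ?b * f x"
  proof -
    have "measure lborel (ball x r) = ?b"
      using emeasure_ball_R3[of r x] r b by (simp add: measure_def)
    then show ?thesis using Bfin by (subst integral_scaleR_left) (auto simp: scaleR_conv_of_real less_top)
  qed
  also have "(\<integral>y. indicator (ball x r) y *\<^sub>R f y \<partial>lborel) = of_real ?b * ball_average f r x"
    using ball_vol_pos r by (simp add: ball_average_def)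
  finally have "(cmod (\<integral>y. indicator (ball x r) y *\<^sub>R h y \<partial>lborel))\<^sup>2 = ?b\<^sup>2 * (cmod (f x - ball_average f r x))\<^sup>2"
    by (simp only: right_diff_distrib[symmetric] norm_mult power_mult_distrib norm_of_real power2_abs)
  with cell_variance(2)[OF h Bm Bfin hf]
  have le: "ennreal (?b\<^sup>2 * (cmod (f x - ball_average f r x))\<^sup>2) \<le> ennreal ?b * (\<integral>\<^sup>+y\<in>ball x r. esq (h y) \<partial>lborel)"
    using r by (simp add: emeasure_ball_R3)
  have bn: "0 \<le> ?b" using b by simp
  have "?b\<^sup>2 * (cmod (f x - ball_average f r x))\<^sup>2 = ?b * (?b * (cmod (f x - ball_average f r x))\<^sup>2)"
    by (simp only: power2_eq_square mult.assoc)
  then have "ennreal (?b\<^sup>2 * (cmod (f x - ball_average f r x))\<^sup>2) = ennreal ?b * (ennreal ?b * esq (f x - ball_average f r x))"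
    by (simp only: ennreal_mult'[OF bn])
  with le have "ennreal ?b * (ennreal ?b * esq (f x - ball_average f r x)) \<le> ennreal ?b * (\<integral>\<^sup>+y\<in>ball x r. esq (h y) \<partial>lborel)"
    by (simp only:)
  then have "ennreal ?b * esq (f x - ball_average f r x) \<le> ennreal (?b / ?b) * (\<integral>\<^sup>+y\<in>ball x r. esq (h y) \<partial>lborel)"
    by (rule ennreal_le_divideI[OF b bn])
  then show ?thesis using r ball_vol_pos by (simp add: h_def)
qed

text \<open>On a ball, \<open>local_oscillation\<close> bounds the squared error of the average of radius \<open>r\<close> in \<open>L\<^sup>2\<close> by a multiple of \<open>r powr (2 * s)\<close>.
This is summable along \<open>r = 2 powr (- n)\<close>, so almost everywhere the errors tend to 0.\<close>

lemma ball_averages_converge_AE: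
  assumes f [measurable]: "f \<in> borel_measurable borel" and fF: "f \<in> FFS"
  shows "AE x in lborel. (\<lambda>n. ball_average f ((1 / 2) ^ n) x) \<longlonglongrightarrow> f x"
proof -
  define T where "T = max (enn2real (nonlocal f)) (enn2real (mass f)) + 1"
  have T: "0 < T" by (simp add: T_def add_nonneg_pos le_max_iff_disj)
  have nm: "nonlocal f \<le> ennreal T" "mass f \<le> ennreal T" "mass f < \<infinity>"
  proof -
    have "nonlocal f = ennreal (enn2real (nonlocal f))" "mass f = ennreal (enn2real (mass f))"
      using fF by (auto simp: FFS_iff)
    moreover have "ennreal (enn2real (nonlocal f)) \<le> ennreal T" "ennreal (enn2real (mass f)) \<le> ennreal T"
      by (intro ennreal_leI; simp add: T_def)+
    ultimately show "nonlocal f \<le> ennreal T" "mass f \<le> ennreal T" by simp_all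
    show "mass f < \<infinity>" using fF by (simp add: FFS_iff)
  qed
  define e where "e n x = esq (f x - ball_average f ((1 / 2) ^ n) x)" for n x
  have em [measurable]: "e n \<in> borel_measurable borel" for n
    unfolding e_def[abs_def] using ball_average_measurable[OF f, of "(1 / 2) ^ n"] by measurable
  have "AE x in lborel. x \<in> ball 0 (real b) \<longrightarrow> (\<lambda>n. ball_average f ((1 / 2) ^ n) x) \<longlonglongrightarrow> f x" for b :: nat
  proof -
    obtain C where C: "0 < C" "\<And>u h. u \<in> borel_measurable borel \<Longrightarrow> nonlocal u \<le> ennreal T \<Longrightarrow> mass u \<le> ennreal T \<Longrightarrow> 0 < h \<Longrightarrow> h \<le> 1 \<Longrightarrow>
      (\<integral>\<^sup>+x\<in>(ball 0 (real b)). (\<integral>\<^sup>+y\<in>ball x h. esq (u x - u y) \<partial>lborel) \<partial>lborel) \<le> ennreal (C * h powr (3 + 2 * s))"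
      using local_oscillation[OF T, of "real b"] by blast
    define q where "q = (1 / 2 :: real) powr (2 * s)"
    have q: "0 < q" "q < 1" using s_pos by (auto simp: q_def powr_less_one powr_divide)
    note [measurable] = borel_open[OF open_ball, of "0 :: R3" "real b"]
    have step: "(\<integral>\<^sup>+x\<in>(ball 0 (real b)). e n x \<partial>lborel) \<le> ennreal (C / ball_vol * q ^ n)" for n
    proof -
      define r where "r = (1 / 2 :: real) ^ n"
      have r: "0 < r" "r \<le> 1" by (auto simp: r_def power_le_one)
      let ?b = "ball_vol * r ^ 3"
      have bp: "0 < ?b" using r ball_vol_pos by simp
      have "ennreal ?b * (\<integral>\<^sup>+x\<in>(ball 0 (real b)). e n x \<partial>lborel) = (\<integral>\<^sup>+x\<in>(ball 0 (real b)). ennreal ?b * e n x \<partial>lborel)"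
        by (subst nn_integral_cmult[symmetric]) (auto simp: mult.assoc)
      also have "\<dots> \<le> (\<integral>\<^sup>+x\<in>(ball 0 (real b)). (\<integral>\<^sup>+y\<in>ball x r. esq (f x - f y) \<partial>lborel) \<partial>lborel)"
        using ball_average_error[OF f r(1) nm(3)] by (intro nn_integral_mono mult_right_mono) (auto simp: e_def r_def)
      also have "\<dots> \<le> ennreal (C * r powr (3 + 2 * s))" by (rule C(2)[OF f nm(1,2) r])
      finally have le: "ennreal ?b * (\<integral>\<^sup>+x\<in>(ball 0 (real b)). e n x \<partial>lborel) \<le> ennreal (C * r powr (3 + 2 * s))" .
      have "C * r powr (3 + 2 * s) / ?b = C / ball_vol * q ^ n"
      proof -
        have "r powr (3 + 2 * s) = r ^ 3 * r powr (2 * s)" using r by (simp add: powr_add)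
        moreover have "r powr (2 * s) = q ^ n"
        proof -
          have "r = (1 / 2) powr real n" by (simp add: r_def powr_realpow)
          then have "r powr (2 * s) = q powr real n" by (simp add: q_def powr_powr mult.commute)
          then show ?thesis using q by (simp add: powr_realpow)
        qed
        ultimately show ?thesis using r ball_vol_pos by simp
      qed
      with ennreal_le_divideI'[OF bp _ le] C(1) show ?thesis by simp
    qed
    have "(\<integral>\<^sup>+x. (\<Sum>n. e n x * indicator (ball 0 (real b)) x) \<partial>lborel) = (\<Sum>n. \<integral>\<^sup>+x\<in>(ball 0 (real b)). e n x \<partial>lborel)"
      by (rule nn_integral_suminf) measurable
    also have "\<dots> \<le> (\<Sum>n. ennreal (C / ball_vol * q ^ n))"
      by (intro suminf_le step) auto
    also have "\<dots> = ennreal (\<Sum>n. C / ball_vol * q ^ n)"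
      using q C ball_vol_pos by (intro suminf_ennreal2 summable_mult summable_geometric) auto
    also have "\<dots> < \<infinity>" by simp
    finally have "AE x in lborel. (\<Sum>n. e n x * indicator (ball 0 (real b)) x) \<noteq> \<infinity>"
      by (intro nn_integral_PInf_AE) auto
    then show ?thesis
    proof eventually_elim
      case (elim x)
      show ?case
      proof
        assume x: "x \<in> ball 0 (real b)"
        then have fin: "(\<Sum>n. e n x) \<noteq> \<infinity>" using elim by simp
        have "summable (\<lambda>n. (cmod (f x - ball_average f ((1 / 2) ^ n) x))\<^sup>2)"
          using fin unfolding e_def by (intro summable_suminf_not_top) (auto simp: e_def)
        then have "(\<lambda>n. (cmod (f x - ball_average f ((1 / 2) ^ n) x))\<^sup>2) \<longlonglongrightarrow> 0"
          by (rule summable_LIMSEQ_zero)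
        then have "(\<lambda>n. sqrt ((cmod (f x - ball_average f ((1 / 2) ^ n) x))\<^sup>2)) \<longlonglongrightarrow> sqrt 0"
          by (rule tendsto_real_sqrt)
        then have "(\<lambda>n. cmod (ball_average f ((1 / 2) ^ n) x - f x)) \<longlonglongrightarrow> 0"
          by (simp add: norm_minus_commute)
        then show "(\<lambda>n. ball_average f ((1 / 2) ^ n) x) \<longlonglongrightarrow> f x"
          by (rule LIM_zero_cancel[OF tendsto_norm_zero_cancel])
      qed
    qed
  qed
  then have "AE x in lborel. \<forall>b :: nat. x \<in> ball 0 (real b) \<longrightarrow> (\<lambda>n. ball_average f ((1 / 2) ^ n) x) \<longlonglongrightarrow> f x"
    unfolding AE_all_countable by blast
  then show ?thesis
  proof eventually_elim
    case (elim x)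
    obtain b :: nat where "norm x < real b" using reals_Archimedean2 by blast
    then have "x \<in> ball 0 (real b)" by simp
    with elim show ?case by blast
  qed
qed

text \<open>The limit of the ball averages, where it exists, is radially symmetric at every point and equal to \<open>w\<close> almost
everywhere.\<close>

lemma radial_representative:
  assumes w: "w \<in> FFS" and inv: "\<And>g. orthogonal_transformation g \<Longrightarrow> AE x in lebesgue. w (g x) = w x"
  obtains v where "radially_symmetric v" "AE x in lebesgue. w x = v x"
proof -
  obtain f where f [measurable]: "f \<in> borel_measurable borel" and ae: "AE x in lebesgue. w x = f x"
    using borel_representative[OF FFS_measurable[OF w]] .
  have fF: "f \<in> FFS" using FFS_cong_AE[OF w ae] .
  have finv: "AE x in lborel. f (g x) = f x" if g: "orthogonal_transformation g" for g
  proof -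
    have "AE x in distr lebesgue lebesgue g. w x = f x"
      unfolding distr_orthogonal_lebesgue[OF g] by (rule ae)
    then have "AE x in lebesgue. w (g x) = f (g x)"
      by (rule AE_distrD[OF orthogonal_measurable_lebesgue[OF g]])
    then have "AE x in lebesgue. f (g x) = f x"
      using ae inv[OF g] by eventually_elim simp
    then show ?thesis by (simp add: AE_completion_iff)
  qed
  define v where "v x = (if convergent (\<lambda>n. ball_average f ((1 / 2) ^ n) x) then lim (\<lambda>n. ball_average f ((1 / 2) ^ n) x) else 0)" for x
  have "radially_symmetric v"
    unfolding radially_symmetric_def
  proof (intro allI impI)
    fix x y :: R3 assume "norm x = norm y"
    then have "ball_average f r x = ball_average f r y" for r
      by (intro ball_average_rotation_invariant f finv)
    then show "v x = v y" by (simp add: v_def)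
  qed
  moreover have "AE x in lborel. f x = v x"
    using ball_averages_converge_AE[OF f fF]
    by eventually_elim (auto simp: v_def convergent_def dest: limI)
  then have "AE x in lebesgue. f x = v x" by (simp add: AE_completion_iff)
  then have "AE x in lebesgue. w x = v x"
    using ae by eventually_elim simp
  ultimately show ?thesis by (rule that)
qed

end

section \<open>The maximizer and symmetric criticality\<close>

context magnetic_radial begin

lemma radial_maximizer:
  obtains u where "u \<in> HR" "ip u u = 1" "0 < Q u" "\<And>v. v \<in> HR \<Longrightarrow> Q v \<le> Q u * ip v v powr (p / 2)"
proof -
  obtain K where K: "0 < K" "\<And>u e. u \<in> FFS \<Longrightarrow> 0 < e \<Longrightarrow> ip u u \<le> e\<^sup>2 \<Longrightarrow> Q u \<le> K * e powr p"
    using Q_bound by blast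
  have "\<exists>u\<in>HR. ip u u = 1 \<and> 0 < Q u \<and> (\<forall>v\<in>HR. Q v \<le> Q u * ip v v powr (p / 2))"
  proof (rule HR.extremal_exists[OF HR_nrm_complete])
    show "0 < p" using p_gt_2 by simp
    show "Q (\<lambda>x. of_real c * u x) = c powr p * Q u" if "0 < c" "u \<in> HR" for c u
      using Q_scale[OF HR_FFS[OF that(2)], of "of_real c"] that(1) by simp
    show "bump \<in> HR" by (rule bump_in_HR)
    show "0 < Q bump"
    proof (rule ccontr)
      assume "\<not> 0 < Q bump"
      then have "Qn bump = 0" using Q_nonneg[of bump] Qn_eq[OF bump_in_FFS] by simp
      then have z: "(\<integral>\<^sup>+x. ennreal (cmod (bump x) powr p) \<partial>lborel) = 0"
        by (simp add: Qn_def nn_integral_completion)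
      have "(\<lambda>x. ennreal (cmod (bump x) powr p)) \<in> borel_measurable lborel" by measurable
      then have "AE x in lborel. ennreal (cmod (bump x) powr p) = 0"
        using z by (simp only: nn_integral_0_iff_AE)
      then have "AE x in lborel. x \<notin> ball (0 :: R3) 1"
        by eventually_elim (use bump_inside in \<open>auto simp: ennreal_eq_0_iff\<close>)
      then have "emeasure lborel {x \<in> space lborel. \<not> x \<notin> ball (0 :: R3) 1} = 0"
        by (subst (asm) AE_iff_measurable[OF _ refl]) auto
      moreover have "{x \<in> space lborel. \<not> x \<notin> ball (0 :: R3) 1} = ball 0 1" by auto
      ultimately have "emeasure lborel (ball (0 :: R3) 1) = 0" by (simp only:)
      then show False using ball_vol_pos by (simp add: emeasure_ball_R3)
    qed
    show "Q u \<le> K" if "u \<in> HR" "ip u u \<le> 1" for u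
      using K(2)[OF HR_FFS[OF that(1)], of 1] that(2) by simp
    show "(\<lambda>n. Q (u n)) \<longlonglongrightarrow> Q l" if "\<And>n. u n \<in> HR" "l \<in> HR" "(\<lambda>n. dist2 (u n) l) \<longlonglongrightarrow> 0" for u l
      by (rule Q_continuous[OF HR_FFS[OF that(1)] HR_FFS[OF that(2)] Q_tendsto_0[OF _ that(3)]])
         (intro FFS.diff_closed HR_FFS that)
    show "\<exists>r. strict_mono (r :: nat \<Rightarrow> nat) \<and>
       (\<forall>e>0. \<exists>N. \<forall>i\<ge>N. \<forall>j\<ge>N. min (Q (u (r i))) (Q (u (r j))) - e \<le> Q (\<lambda>x. of_real (1/2) * u (r i) x + of_real (1/2) * u (r j) x))"
      if "\<And>n. u n \<in> HR \<and> ip (u n) (u n) \<le> 1" for u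
      using that by (rule radial_quasi_concave)
  qed
  then show ?thesis using that by blast
qed

text \<open>Let \<open>w\<close> represent \<open>R u\<close> on the whole space. For a rotation \<open>g\<close> the function \<open>w \<circ> g\<close> represents the same functional, so it equals
\<open>w\<close> almost everywhere and \<open>w\<close> has a radial representative. The difference of \<open>c * u\<close> and this representative is
radial and, by \<open>crit\<close>, orthogonal to all radial functions, hence to itself.\<close>

lemma symmetric_criticality:
  assumes u: "u \<in> HR" and crit: "\<And>v. v \<in> HR \<Longrightarrow> R u v = c * ip u v" and v: "v \<in> HA"
  shows "R u v = c * ip u v"
proof -
  have uA: "u \<in> HA" and ur: "radially_symmetric u" using u by (auto simp: HR_iff)
  have uF: "u \<in> FFS" using uA by (rule HA_FFS)
  obtain K where K: "0 < K" "\<And>u e. u \<in> FFS \<Longrightarrow> 0 < e \<Longrightarrow> ip u u \<le> e\<^sup>2 \<Longrightarrow> Q u \<le> K * e powr p"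
    using Q_bound by blast
  define E where "E = sqrt (ip u u) + 1"
  have E: "0 < E" using ip_nonneg[OF uF] by (simp add: E_def add_nonneg_pos)
  have "\<exists>w\<in>HA. \<forall>v\<in>HA. R u v = ip w v"
  proof (rule HA.riesz[OF HA_nrm_complete uA])
    show "R u (\<lambda>x. of_real a * v x + of_real b * w x) = a * R u v + b * R u w" if "v \<in> HA" "w \<in> HA" for v w a b
      using that by (intro R_lin uF HA_FFS)
    show "R u v \<le> K * E powr p / p" if "v \<in> HA" "ip v v \<le> 1" for v
    proof -
      have vF: "v \<in> FFS" using that(1) by (rule HA_FFS)
      have "sqrt (ip (\<lambda>x. u x + v x) (\<lambda>x. u x + v x)) \<le> sqrt (ip u u) + sqrt (ip v v)"
        by (rule FFS.triangle[OF uF vF])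
      also have "\<dots> \<le> E" using that(2) by (simp add: E_def)
      finally have "ip (\<lambda>x. u x + v x) (\<lambda>x. u x + v x) \<le> E\<^sup>2" by (rule sqrt_le_D)
      then have "Q (\<lambda>x. u x + v x) \<le> K * E powr p" by (rule K(2)[OF FFS_add[OF uF vF] E])
      moreover have "Q u + p * R u v \<le> Q (\<lambda>x. u x + v x)" using Q_below[OF uF vF, of 1] by simp
      ultimately have "p * R u v \<le> K * E powr p" using Q_nonneg[of u] by linarith
      then show ?thesis using p_gt_2 by (simp add: field_simps)
    qed
  qed
  then obtain w where w: "w \<in> HA" and rep: "\<And>v. v \<in> HA \<Longrightarrow> R u v = ip w v" by blast
  have wF: "w \<in> FFS" using w by (rule HA_FFS)
  have "AE x in lebesgue. w (g x) = w x" if g: "orthogonal_transformation g" for g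
  proof -
    have ginv: "orthogonal_transformation (inv g)" using g by (rule orthogonal_transformation_inv)
    have cancel: "inv g (g x) = x" for x
      using orthogonal_transformation_inj[OF g] by (simp add: inv_f_f)
    define d where "d x = w (g x) - w x" for x
    have wg: "(\<lambda>x. w (g x)) \<in> HA" by (rule HA_rotate[OF g w])
    have d: "d \<in> HA" unfolding d_def by (rule HA.diff_closed[OF wg w])
    have dF: "d \<in> FFS" using d by (rule HA_FFS)
    have dg: "(\<lambda>x. d (inv g x)) \<in> HA" by (rule HA_rotate[OF ginv d])
    have "ip (\<lambda>x. w (g x)) d = ip w (\<lambda>x. d (inv g x))"
      using ip_rotate[OF g FFS_measurable[OF wF] FFS_measurable[OF HA_FFS[OF dg]]] by (simp add: cancel)
    also have "\<dots> = R u (\<lambda>x. d (inv g x))" by (rule rep[OF dg, symmetric])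
    also have "\<dots> = R (\<lambda>x. u (g x)) d"
      using R_rotate[OF g uF HA_FFS[OF dg]] by (simp add: cancel)
    also have "(\<lambda>x. u (g x)) = u"
    proof
      fix x show "u (g x) = u x"
        using ur orthogonal_transformation_norm[OF g] unfolding radially_symmetric_def by blast
    qed
    also have "R u d = ip w d" by (rule rep[OF d])
    finally have "ip d d = 0"
      using HA.ip_diff_left[OF wg w d] by (simp add: d_def[symmetric])
    from null_iff_AE_zero[OF dF this] show ?thesis by eventually_elim (simp add: d_def)
  qed
  then obtain w' where w': "radially_symmetric w'" "AE x in lebesgue. w x = w' x"
    by (rule radial_representative[OF wF])
  have w'R: "w' \<in> HR" using HA_cong_AE[OF w w'(2)] w'(1) by (simp add: HR_iff)
  define z where "z x = of_real c * u x - w' x" for x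
  have cu: "(\<lambda>x. of_real c * u x) \<in> HR" by (rule HR_scale[OF u])
  have z: "z \<in> HR" unfolding z_def by (rule HR.diff_closed[OF cu w'R])
  have zF: "z \<in> FFS" using z by (rule HR_FFS)
  have "ip z z = c * ip u z - ip w' z"
    using HR.ip_diff_left[OF cu w'R z] by (simp add: z_def[symmetric] ip_scale)
  also have "ip w' z = ip w z" by (rule ip_cong_AE[OF wF w'(2) zF, symmetric])
  also have "\<dots> = R u z" using rep z by (simp add: HR_iff)
  also have "\<dots> = c * ip u z" by (rule crit[OF z])
  finally have "ip z z = 0" by simp
  then have "AE x in lebesgue. z x = 0" by (rule null_iff_AE_zero[OF zF])
  then have ae: "AE x in lebesgue. w x = of_real c * u x"
    using w'(2) by eventually_elim (simp add: z_def)
  have "R u v = ip w v" by (rule rep[OF v])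
  also have "\<dots> = ip (\<lambda>x. of_real c * u x) v" by (rule ip_cong_AE[OF wF ae HA_FFS[OF v]])
  finally show ?thesis by (simp add: ip_scale)
qed

lemma nontrivial_radial_weak_solution:
  "\<exists>u\<in>HR. weak_solution A s m p u \<and> \<not> (AE x in lebesgue. u x = 0)"
proof -
  obtain u where u: "u \<in> HR" "ip u u = 1" "0 < Q u" and max: "\<And>v. v \<in> HR \<Longrightarrow> Q v \<le> Q u * ip v v powr (p / 2)"
    using radial_maximizer by blast
  have uF: "u \<in> FFS" using u(1) by (rule HR_FFS)
  have "R u v = Q u * ip u v" if v: "v \<in> HR" for v
  proof -
    have "p * R u v = Q u * p * ip u v"
      by (rule HR.euler_lagrange[OF u(1,2) v max]) (use Q_below[OF uF HR_FFS[OF v]] in auto)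
    then show ?thesis using p_gt_2 by simp
  qed
  then have crit: "R u v = Q u * ip u v" if "v \<in> HA" for v
    using that by (rule symmetric_criticality[OF u(1)])
  \<comment> \<open>The two sides of the equation have degrees 1 and \<open>p - 1\<close> in \<open>u\<close>, so the factor \<open>Q u\<close> is removed by \<open>c\<close> with
    \<open>c powr (p - 2) * Q u = 1\<close>.\<close>
  define c where "c = (1 / Q u) powr (1 / (p - 2))"
  have c: "0 < c" using u(3) by (simp add: c_def)
  have "c powr (p - 2) = 1 / Q u" using u(3) p_gt_2 by (simp add: c_def powr_powr)
  moreover have "c powr (p - 1) = c powr (p - 2) * c" using c by (simp add: powr_diff power2_eq_square)
  ultimately have cQ: "c powr (p - 1) * Q u = c" using u(3) by simp
  define U where "U x = of_real c * u x" for x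
  have U: "U \<in> HR" unfolding U_def by (rule HR_scale[OF u(1)])
  have eq: "ip U v = R U v" if v: "v \<in> HA" for v
  proof -
    have "R U v = c powr (p - 1) * (Q u * ip u v)"
      unfolding U_def R_scale_left[OF c] crit[OF v] ..
    also have "\<dots> = c * ip u v" unfolding mult.assoc[symmetric] cQ ..
    also have "\<dots> = ip U v" unfolding U_def ip_scale ..
    finally show ?thesis ..
  qed
  have "weak_solution A s m p U"
    unfolding weak_solution_def
  proof (intro conjI ballI)
    show "U \<in> HA" using U by (simp add: HR_iff)
    fix v assume v: "v \<in> HA"
    show "integrable lebesgue (\<lambda>x. of_real (norm (U x) powr (p - 2)) * U x * cnj (v x))"
      by (rule R_integrable[OF HR_FFS[OF U] HA_FFS[OF v]])
    show "ip U v = Re (\<integral>x. of_real (norm (U x) powr (p - 2)) * U x * cnj (v x) \<partial>lebesgue)"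
      using eq[OF v] by (simp only: R_def)
  qed
  moreover have "\<not> (AE x in lebesgue. U x = 0)"
  proof
    assume ae: "AE x in lebesgue. U x = 0"
    have "ip U U = ip (\<lambda>x. 0) U" by (rule ip_cong_AE[OF HR_FFS[OF U] ae HR_FFS[OF U]])
    also have "\<dots> = 0" using ip_scale[of 0 U U] by simp
    also have "ip U U = c\<^sup>2" unfolding U_def using HR.nrm2_scale[OF u(1), of c] u(2) by simp
    finally show False using c by simp
  qed
  ultimately show ?thesis using U by blast
qed

end

theorem theorem5p2:
  fixes s m p :: real and A :: "real ^ 3 \<Rightarrow> real ^ 3"
  assumes "0 < s" and "s < 1" and "0 < m"
    and "continuous_on UNIV A" and "locally_bounded_gradient A"
    and "\<And>(g :: real ^ 3 ^ 3) x y. orthogonal_matrix g \<Longrightarrow>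
           (g *v (x - y)) \<bullet> A (g *v midpoint x y) = (x - y) \<bullet> A (midpoint x y)"
    and "2 < p" and "p < 6 / (3 - 2 * s)"
  shows "\<exists>u \<in> H_As_rad A s m. weak_solution A s m p u \<and> \<not> (AE x in lebesgue. u x = 0)"
proof -
  interpret magnetic_radial A s m p
    by unfold_locales (use assms in auto)
  show ?thesis by (rule nontrivial_radial_weak_solution)
qed

end
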